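(* Any $d$-variate multivariate extreme-value (mev) distribution with unit-Fréchet margins is the cdf of a $(d\times r)$ mixture model (for some positive integer $r$) whose coefficient matrix has mutually different signatures. As a consequence, any multivariate generalized Pareto (mgp) distribution is associated with a mixture model whose coefficient matrix has mutually different signatures.
   Context: $D=\{1,\dots,d\}$, $R=\{1,\dots,r\}$, $\mathbb E=[0,\infty)^d\setminus\{\boldsymbol 0\}$, $\mathbb E_J=\{\boldsymbol x\in\mathbb E:x_j>0\text{ iff }j\in J\}$. An mev distribution is a limit in distribution (with non-degenerate margins) of affinely normalized componentwise maxima of i.i.d. random vectors. For an mev distribution $G^*$ with unit-Fréchet margins ($e^{-1/x}$, $x>0$), the exponent measure $\mu$ is the unique Borel measure on $\mathbb E$ with $G^*(\boldsymbol x)=\exp\{-\mu(\mathbb E\setminus[\boldsymbol 0,\boldsymbol x])\}$, $\boldsymbol x\in[\boldsymbol 0,\boldsymbol\infty]$. A non-empty $J\subseteq D$ is an extreme direction if $\mu(\mathbb E_J)>0$. Mixture model: let $\boldsymbol Z^{(1)},\ldots,\boldsymbol Z^{(r)}$ be independent random vectors in $\mathbb R^d$, each having an mev distribution with unit-Fréchet margins and single extreme direction $D$. Let $A=(a_{jk})_{j\in D;k\in R}\in[0,1]^{d\times r}$ (the coefficient matrix) have unit row sums and positive column sums. The $(d\times r)$ mixture model is $$\boldsymbol M=\Big(\max_{k\in R}\{a_{1k}Z_1^{(k)}\},\ldots,\max_{k\in R}\{a_{dk}Z_d^{(k)}\}\Big).$$ With $J_k=\{j\in D:a_{jk}>0\}$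 (the $k$-th signature), only the subvectors $\boldsymbol Z^{(k)}_{J_k}=(Z^{(k)}_j)_{j\in J_k}$ matter, and it suffices that these be given, each with unit-Fréchet margins, an mev distribution and only extreme direction $J_k$. The matrix $A$ has mutually different signatures if $J_1,\dots,J_r$ are all distinct. $\boldsymbol M$ has an mev distribution $G_{\boldsymbol M}$ with unit-Fréchet margins. mgp distributions (standardized): for an mev distribution $G$ with Gumbel margins ($\exp(-e^{-x})$), let $\mu$ be the exponent measure of $G^*(\boldsymbol x)=G(\ln x_1,\dots,\ln x_d)$; $\mathrm{GP}(G)$ is the law of the random vector $\boldsymbol Y$ in $[-\infty,\infty)^d$ with $\mathsf P[e^{\boldsymbol Y}\in B]=\mu(B\cap\{\boldsymbol x\ge\boldsymbol 0:\boldsymbol x\not\le\boldsymbol 1\})/\mu(\{\boldsymbol x\ge\boldsymbol 0:\boldsymbol x\not\le\boldsymbol 1\})$, where $\boldsymbol x\not\le\boldsymbol 1$ means $x_j>1$ for some $j$ and $e^{-\infty}=0$. An mgp distribution is any $\mathrm{GP}(G)$ of this form. The mgp distribution associated with $\boldsymbol M$ is $\mathrm{GP}(\tilde G_{\boldsymbol M})$, where $\tilde G_{\boldsymbol M}$ is the cdf of $(\ln M_1,\dots,\ln M_d)$. *)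

theory Defs
  imports "HOL-Probability.Probability"
begin

text \<open>
  Vectors with index set \<open>D\<close> are elements of \<^typ>\<open>real^'n\<close>, so \<open>d = CARD('n)\<close> and \<open>D = UNIV\<close>.
  A distribution on \<open>\<real>\<^sup>d\<close> is a Borel probability measure, and \<open>\<le>\<close> on vectors is componentwise.
\<close>

definition mcdf :: "(real^'n::finite) measure \<Rightarrow> real^'n \<Rightarrow> real" where
  "mcdf G x = measure G {..x}"

text \<open>
  Convergence in distribution on \<open>\<real>\<^sup>d\<close>, the multivariate form of \<^const>\<open>weak_conv_m\<close>.
\<close>
definition mweak_conv :: "(nat \<Rightarrow> (real^'n::finite) measure) \<Rightarrow> (real^'n) measure \<Rightarrow> bool" where
  "mweak_conv F G \<longleftrightarrow>
     (\<forall>x. isCont (mcdf G) x \<longrightarrow> (\<lambda>n. mcdf (F n) x) \<longlonglongrightarrow> mcdf G x)"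

definition margin :: "(real^'n::finite) measure \<Rightarrow> 'n \<Rightarrow> real measure" where
  "margin G j = distr G borel (\<lambda>x. x $ j)"

text \<open>
  The sample space type \<^typ>\<open>nat \<Rightarrow> real^'n\<close> is no restriction: it carries an i.i.d. sequence
  with any prescribed law.
\<close>
definition mev :: "(real^'n::finite) measure \<Rightarrow> bool" where
  "mev G \<longleftrightarrow>
     prob_space G \<and> sets G = sets borel \<and>
     (\<forall>j. \<not> (\<exists>c. AE t in margin G j. t = c)) \<and>
     (\<exists>(P :: (nat \<Rightarrow> real^'n) measure) (X :: nat \<Rightarrow> (nat \<Rightarrow> real^'n) \<Rightarrow> real^'n)
        (a :: nat \<Rightarrow> real^'n) (b :: nat \<Rightarrow> real^'n).
        prob_space P \<and>
        prob_space.indep_vars P (\<lambda>_. borel) X UNIV \<and>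
        (\<forall>i. distr P borel (X i) = distr P borel (X 0)) \<and>
        (\<forall>n j. a n $ j > 0) \<and>
        mweak_conv
          (\<lambda>n. distr P borel (\<lambda>\<omega>. \<chi> j. ((MAX i\<in>{..n}. X i \<omega> $ j) - b n $ j) / a n $ j))
          G)"

definition unit_frechet_margins :: "(real^'n::finite) measure \<Rightarrow> bool" where
  "unit_frechet_margins G \<longleftrightarrow>
     (\<forall>j x. cdf (margin G j) x = (if x > 0 then exp (- 1 / x) else 0))"

definition gumbel_margins :: "(real^'n::finite) measure \<Rightarrow> bool" where
  "gumbel_margins G \<longleftrightarrow> (\<forall>j x. cdf (margin G j) x = exp (- exp (- x)))"

definition EE :: "(real^'n::finite) set" where
  "EE = {x. \<forall>j. x $ j \<ge> 0} - {0}"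

definition EE_sub :: "'n set \<Rightarrow> (real^'n::finite) set" where
  "EE_sub J = {x \<in> EE. \<forall>j. x $ j > 0 \<longleftrightarrow> j \<in> J}"

text \<open>
  The argument \<open>x\<close> ranges over \<open>[0, \<infinity>]\<^sup>d\<close>, and \<open>exp (- \<infinity>) = 0\<close>.
\<close>
definition is_exponent_measure ::
    "(real^'n::finite) measure \<Rightarrow> (real^'n) measure \<Rightarrow> bool" where
  "is_exponent_measure G \<mu> \<longleftrightarrow>
     sets \<mu> = sets (restrict_space borel EE) \<and>
     (\<forall>x :: ereal^'n. (\<forall>j. 0 \<le> x $ j) \<longrightarrow>
        measure G {y. \<forall>j. ereal (y $ j) \<le> x $ j} =
        (let m = emeasure \<mu> (EE - {y. \<forall>j. ereal (y $ j) \<le> x $ j})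
         in if m = \<infinity> then 0 else exp (- enn2real m)))"

definition extreme_direction :: "(real^'n::finite) measure \<Rightarrow> 'n set \<Rightarrow> bool" where
  "extreme_direction G J \<longleftrightarrow>
     J \<noteq> {} \<and> (\<exists>\<mu>. is_exponent_measure G \<mu> \<and> emeasure \<mu> (EE_sub J) > 0)"

definition coefficient_matrix :: "nat \<Rightarrow> ('n::finite \<Rightarrow> nat \<Rightarrow> real) \<Rightarrow> bool" where
  "coefficient_matrix r A \<longleftrightarrow>
     (\<forall>j. \<forall>k\<in>{1..r}. 0 \<le> A j k \<and> A j k \<le> 1) \<and>
     (\<forall>j. (\<Sum>k\<in>{1..r}. A j k) = 1) \<and>
     (\<forall>k\<in>{1..r}. (\<Sum>j\<in>UNIV. A j k) > 0)"

definition signature :: "('n::finite \<Rightarrow> nat \<Rightarrow> real) \<Rightarrow> nat \<Rightarrow> 'n set" where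
  "signature A k = {j. A j k > 0}"

definition different_signatures :: "nat \<Rightarrow> ('n::finite \<Rightarrow> nat \<Rightarrow> real) \<Rightarrow> bool" where
  "different_signatures r A \<longleftrightarrow> inj_on (signature A) {1..r}"

definition mixture_model ::
    "'w measure \<Rightarrow> nat \<Rightarrow> ('n::finite \<Rightarrow> nat \<Rightarrow> real) \<Rightarrow> (nat \<Rightarrow> 'w \<Rightarrow> real^'n) \<Rightarrow> bool" where
  "mixture_model P r A Z \<longleftrightarrow>
     prob_space P \<and> r > 0 \<and> coefficient_matrix r A \<and>
     prob_space.indep_vars P (\<lambda>_. borel) Z {1..r} \<and>
     (\<forall>k\<in>{1..r}.
        mev (distr P borel (Z k)) \<and>
        unit_frechet_margins (distr P borel (Z k)) \<and>
        {J. extreme_direction (distr P borel (Z k)) J} = {UNIV})"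

definition mixture ::
    "nat \<Rightarrow> ('n::finite \<Rightarrow> nat \<Rightarrow> real) \<Rightarrow> (nat \<Rightarrow> 'w \<Rightarrow> real^'n) \<Rightarrow> 'w \<Rightarrow> real^'n" where
  "mixture r A Z \<omega> = (\<chi> j. MAX k\<in>{1..r}. A j k * Z k \<omega> $ j)"

text \<open>The exponential on \<open>[-\<infinity>, \<infinity>)\<close>; the value at \<open>\<infinity>\<close> is never used.\<close>
definition exp_ereal :: "ereal \<Rightarrow> real" where
  "exp_ereal y = (if y = -\<infinity> then 0 else exp (real_of_ereal y))"

text \<open>
  \<open>is_GP G H\<close>: the law \<open>H\<close> on \<open>[-\<infinity>, \<infinity>)\<^sup>d\<close> is \<open>GP(G)\<close>. If \<open>X\<close> has distribution \<open>G\<close>, then the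
  distribution with cdf \<open>x \<mapsto> G(ln x\<^sub>1, \<dots>, ln x\<^sub>d)\<close> is the law of the componentwise exponential of \<open>X\<close>.
\<close>
definition is_GP :: "(real^'n::finite) measure \<Rightarrow> (ereal^'n) measure \<Rightarrow> bool" where
  "is_GP G H \<longleftrightarrow>
     mev G \<and> gumbel_margins G \<and>
     prob_space H \<and> sets H = sets (restrict_space borel {y. \<forall>j. y $ j < \<infinity>}) \<and>
     (\<exists>\<mu>. is_exponent_measure (distr G borel (\<lambda>x. \<chi> j. exp (x $ j))) \<mu> \<and>
        (let L = {x :: real^'n. (\<forall>j. x $ j \<ge> 0) \<and> (\<exists>j. x $ j > 1)}
         in \<forall>B\<in>sets borel.
              emeasure H {y \<in> space H. (\<chi> j. exp_ereal (y $ j)) \<in> B} =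
              emeasure \<mu> (B \<inter> L) / emeasure \<mu> L))"

definition mgp :: "(ereal^'n::finite) measure \<Rightarrow> bool" where
  "mgp H \<longleftrightarrow> (\<exists>G. is_GP G H)"

text \<open>
  The logarithm is only relevant on positive reals, since the components of a mixture
  model are almost surely positive.
\<close>
definition mgp_associated ::
    "'w measure \<Rightarrow> nat \<Rightarrow> ('n::finite \<Rightarrow> nat \<Rightarrow> real) \<Rightarrow> (nat \<Rightarrow> 'w \<Rightarrow> real^'n) \<Rightarrow>
     (ereal^'n) measure \<Rightarrow> bool" where
  "mgp_associated P r A Z H \<longleftrightarrow>
     is_GP (distr P borel (\<lambda>\<omega>. \<chi> j. ln (mixture r A Z \<omega> $ j))) H"

end

theory Submission
  imports Defs
begin

text \<open>
  Convergence in distribution of normalized maxima makes a law \<open>G\<close> with unit-Frechet margins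
  max-stable, so \<open>n P(X / n \<in> A)\<close> converges for finite unions \<open>A\<close> of boxes bounded away from \<open>0\<close>;
  tightness of the margins makes the limit countably additive, and its Caratheodory extension is the
  exponent measure \<open>\<mu>\<close>, homogeneous of order \<open>-1\<close>. Splitting \<open>\<mu>\<close> over the finitely many charged
  faces \<open>EE_sub J\<close> and rescaling the margins of each piece, with the coordinates outside \<open>J\<close> replaced
  by a coordinate in \<open>J\<close>, yields exponent measures with single extreme direction \<open>D\<close>. Each is realized
  by the maximum of a Poisson process. The margins of the pieces form the coefficient matrix, whose
  signatures are the distinct sets \<open>J\<close>, and cdfs multiply because the pieces of \<open>\<mu>\<close> add up. For
  Gumbel margins the same argument gives max-stability after exponentiation.
\<close>

text \<open>The definition of \<open>mev\<close> offers limits along integers only, under unknown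
  affine normings, whereas max-stability is wanted for every real t > 0: homogeneity of \<mu> must
  turn one number, the mass that a face gives to \<open>1 < x $ j\<close>, into the whole margin c /
  s. Blocks of about n and t n observations are therefore compared, and the known margins determine
  how their normings are related in the limit.

  Two features of \<mu> shape the rest. Its mass near the origin is infinite, so the sets that are
  measured carry a positive lower bound on some coordinate, and laws are assembled from pieces of
  finite mass. It may also charge the boundary faces, although \<open>G\<close> itself charges none
  of them; the faces appear only in the limit, so the components of the mixture are built from \<mu>
  and not directly from \<open>G\<close>.

  Since \<open>extreme_direction\<close> accepts any exponent measure as a witness, excluding a
  direction also requires that this measure be unique.\<close>

lemma borel_measurable_vec_nth [measurable (raw)]:
  fixes f :: "'a \<Rightarrow> real^'n::finite"
  assumes "f \<in> borel_measurable M"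
  shows "(\<lambda>x. f x $ j) \<in> borel_measurable M"
proof -
  have "(\<lambda>v::real^'n. v $ j) \<in> borel_measurable borel"
    by (intro borel_measurable_continuous_onI continuous_intros)
  then show ?thesis using assms by measurable
qed

lemma borel_measurable_vec_lambda [measurable (raw)]:
  fixes f :: "'n::finite \<Rightarrow> 'a \<Rightarrow> real"
  assumes [measurable]: "\<And>j. f j \<in> borel_measurable M"
  shows "(\<lambda>x. \<chi> j. f j x) \<in> borel_measurable M"
proof -
  have "(\<lambda>x. (\<chi> j. f j x) \<bullet> axis i (1::real)) \<in> borel_measurable M" for i
    by (simp add: inner_axis)
  then show ?thesis
    by (intro borel_measurable_euclidean_space[THEN iffD2]) (auto simp: Basis_vec_def)
qed

section \<open>Distribution functions on R^d: uniqueness, continuity, convergence of margins\<close>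

lemma prob_eqI_mcdf:
  fixes L L' :: "(real^'n::finite) measure"
  assumes "prob_space L" "prob_space L'" "sets L = sets borel" "sets L' = sets borel"
    and eq: "mcdf L = mcdf L'"
  shows "L = L'"
proof (rule measure_eqI_generator_eq)
  interpret L: prob_space L by fact
  interpret L': prob_space L' by fact
  let ?E = "range (\<lambda>a. {..a :: real^'n})"
  show "Int_stable ?E"
  proof (rule Int_stableI, safe)
    fix a b :: "real^'n"
    have "{..a} \<inter> {..b} = {..\<chi> j. min (a $ j) (b $ j)}"
      by (auto simp: less_eq_vec_def)
    then show "{..a} \<inter> {..b} \<in> ?E" by auto
  qed
  show "sets L = sigma_sets UNIV ?E" "sets L' = sigma_sets UNIV ?E"
    using assms by (simp_all add: borel_eq_atMost)
  show "emeasure L X = emeasure L' X" if "X \<in> ?E" for X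
    using that fun_cong[OF eq] by (auto simp: mcdf_def L.emeasure_eq_measure L'.emeasure_eq_measure)
  show "range (\<lambda>k::nat. {..\<chi> j. real k}) \<subseteq> ?E" by auto
  show "(\<Union>k::nat. {..(\<chi> j. real k) :: real^'n}) = UNIV"
  proof -
    have "\<exists>k::nat. v \<le> (\<chi> j. real k)" for v :: "real^'n"
    proof -
      obtain k :: nat where "norm v \<le> real k" using real_arch_simple by blast
      then show ?thesis
        by (intro exI[of _ k]) (auto simp: less_eq_vec_def intro: order_trans[OF order_trans[OF abs_ge_self component_le_norm_cart]])
    qed
    then show ?thesis by auto
  qed
  show "emeasure L {..\<chi> j. real k} \<noteq> \<infinity>" for k :: nat by simp
qed auto

lemma atMost_vec_eq: "{..x :: real^'n::finite} = {y. \<forall>j. y $ j \<le> x $ j}"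
  by (auto simp: less_eq_vec_def)

lemma cdf_margin:
  assumes "sets G = sets borel"
  shows "cdf (margin G j) x = measure G {y. y $ j \<le> x}"
proof -
  have [measurable_cong]: "sets G = sets borel" by fact
  have sp: "space G = UNIV" using sets_eq_imp_space_eq[OF assms] by simp
  show ?thesis unfolding cdf_def margin_def
    by (subst measure_distr) (auto simp: sp vimage_def)
qed

text \<open>\<open>{..x}\<close> is covered by \<open>{..y}\<close> and one slab per coordinate, and
  the mass of a slab is an increment of a margin. No order between \<open>x\<close> and
  \<open>y\<close> is assumed, so the bound can be used in both directions.\<close>

lemma diff_mcdf_le:
  fixes G :: "(real^'n::finite) measure"
  assumes "prob_space G" and b: "sets G = sets borel"
  shows "mcdf G x - mcdf G y \<le> (\<Sum>j\<in>UNIV. \<bar>cdf (margin G j) (x $ j) - cdf (margin G j) (y $ j)\<bar>)"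
proof -
  interpret prob_space G by fact
  have [measurable_cong]: "sets G = sets borel" by fact
  let ?S = "\<lambda>j. {v :: real^'n. v $ j \<le> x $ j} - {v. v $ j \<le> y $ j}"
  have S: "?S j \<in> sets G" for j unfolding b by measurable
  have "measure G {..x} \<le> measure G ({..y} \<union> (\<Union>j. ?S j))"
    using S b by (intro finite_measure_mono) (auto simp: less_eq_vec_def)
  also have "\<dots> \<le> measure G {..y} + measure G (\<Union>j. ?S j)"
    using S b by (intro measure_Un_le) auto
  also have "measure G (\<Union>j. ?S j) \<le> (\<Sum>j\<in>UNIV. measure G (?S j))"
    using S by (intro measure_UNION_le) auto
  also have "\<dots> \<le> (\<Sum>j\<in>UNIV. \<bar>cdf (margin G j) (x $ j) - cdf (margin G j) (y $ j)\<bar>)"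
  proof (rule sum_mono)
    fix j
    show "measure G (?S j) \<le> \<bar>cdf (margin G j) (x $ j) - cdf (margin G j) (y $ j)\<bar>"
    proof (cases "x $ j \<le> y $ j")
      case True
      then have "?S j = {}" by (auto intro: order_trans)
      then show ?thesis by (simp only: measure_empty abs_ge_zero)
    next
      case False
      then have "measure G (?S j) = measure G {v. v $ j \<le> x $ j} - measure G {v. v $ j \<le> y $ j}"
        by (intro finite_measure_Diff) (auto simp: b)
      then show ?thesis by (simp add: cdf_margin[OF b])
    qed
  qed
  finally show ?thesis by (simp add: mcdf_def)
qed

text \<open>With continuous margins every point is a continuity point, and convergence in
  distribution becomes pointwise convergence of cdfs everywhere.\<close>

lemma isCont_mcdf:
  fixes G :: "(real^'n::finite) measure"
  assumes "prob_space G" and b: "sets G = sets borel" and c: "\<And>j y. isCont (cdf (margin G j)) y"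
  shows "isCont (mcdf G) x"
proof -
  let ?F = "\<lambda>j. cdf (margin G j)"
  have "((\<lambda>y. \<Sum>j\<in>UNIV. \<bar>?F j (x $ j) - ?F j (y $ j)\<bar>) \<longlongrightarrow> (\<Sum>j\<in>UNIV. \<bar>?F j (x $ j) - ?F j (x $ j)\<bar>)) (at x)"
    by (intro tendsto_intros isCont_tendsto_compose[OF c])
  then have "((\<lambda>y. \<Sum>j\<in>UNIV. \<bar>?F j (x $ j) - ?F j (y $ j)\<bar>) \<longlongrightarrow> 0) (at x)" by simp
  then have "((\<lambda>y. mcdf G y - mcdf G x) \<longlongrightarrow> 0) (at x)"
  proof (rule Lim_null_comparison[rotated])
    show "\<forall>\<^sub>F y in at x. norm (mcdf G y - mcdf G x) \<le> (\<Sum>j\<in>UNIV. \<bar>?F j (x $ j) - ?F j (y $ j)\<bar>)"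
      using diff_mcdf_le[OF assms(1,2), of _ x] diff_mcdf_le[OF assms(1,2), of x]
      by (auto intro!: always_eventually simp: abs_le_iff abs_minus_commute[of "?F _ (x $ _)"])
  qed
  then show ?thesis unfolding isCont_def by (simp add: LIM_zero_iff)
qed

lemma mcdf_mono:
  fixes G :: "(real^'n::finite) measure"
  assumes "prob_space G" and b: "sets G = sets borel" and "x \<le> y"
  shows "mcdf G x \<le> mcdf G y"
proof -
  interpret prob_space G by fact
  show ?thesis unfolding mcdf_def using assms by (intro finite_measure_mono) auto
qed

text \<open>Sets that leave a coordinate unbounded are not orthants \<open>{..x}\<close>. Capping
  all coordinates brings them within reach of the cdf; the factor \<open>r\<close> lets a set and
  its dilation be capped consistently.\<close>

lemma measure_capped_tendsto:
  fixes G :: "(real^'n::finite) measure"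
  assumes "prob_space G" and b: "sets G = sets borel" and A: "A \<in> sets borel" and r: "0 < r"
  shows "(\<lambda>K::nat. measure G (A \<inter> {y. \<forall>j. y $ j \<le> r * real K})) \<longlonglongrightarrow> measure G A"
proof -
  interpret prob_space G by fact
  have "(\<lambda>K::nat. measure G (A \<inter> {y. \<forall>j. y $ j \<le> r * real K})) \<longlonglongrightarrow>
      measure G (\<Union>K::nat. A \<inter> {y. \<forall>j. y $ j \<le> r * real K})"
  proof (rule finite_Lim_measure_incseq)
    show "range (\<lambda>K::nat. A \<inter> {y. \<forall>j. y $ j \<le> r * real K}) \<subseteq> events"
      using A unfolding b by (auto simp: atMost_vec_eq[of "\<chi> j. _", simplified, symmetric])
    have "r * real m \<le> r * real n" if "m \<le> n" for m n using that r by simp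
    then show "incseq (\<lambda>K::nat. A \<inter> {y. \<forall>j. y $ j \<le> r * real K})"
      unfolding incseq_def by (blast intro: order_trans)
  qed
  also have "(\<Union>K::nat. A \<inter> {y. \<forall>j. y $ j \<le> r * real K}) = A"
  proof -
    have "\<exists>K::nat. \<forall>j. v $ j \<le> r * real K" for v :: "real^'n"
    proof -
      obtain k :: nat where "norm v / r \<le> real k" using real_arch_simple by blast
      then have "norm v \<le> r * real k" using r by (simp add: field_simps)
      then show ?thesis
        by (intro exI[of _ k]) (auto intro: order_trans[OF order_trans[OF abs_ge_self component_le_norm_cart]])
    qed
    then show ?thesis by auto
  qed
  finally show ?thesis .
qed

text \<open>A marginal event bounds a single coordinate, so mass of \<open>Q n\<close> escaping to
  infinity in the others has to be excluded. Convergence at one far diagonal point, beyond which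
  \<open>G\<close> has little mass, bounds the escape for all large n.\<close>

lemma margin_tendsto:
  fixes G :: "(real^'n::finite) measure"
  assumes "prob_space G" and b: "sets G = sets borel"
    and Q: "\<And>n. prob_space (Q n)" "\<And>n. sets (Q n) = sets borel"
    and lim: "\<And>x. (\<lambda>n. mcdf (Q n) x) \<longlonglongrightarrow> mcdf G x"
  shows "(\<lambda>n. measure (Q n) {v. v $ j \<le> y}) \<longlonglongrightarrow> measure G {v. v $ j \<le> y}"
proof (rule LIMSEQ_I)
  interpret G: prob_space G by fact
  fix e :: real assume "0 < e"
  let ?x = "\<lambda>K::nat. (\<chi> i. if i = j then min y (real K) else real K) :: real^'n"
  let ?k = "\<lambda>K::nat. (\<chi> i. real K) :: real^'n"
  have x: "{..?x K} = {v. v $ j \<le> y} \<inter> {y. \<forall>j. y $ j \<le> real K}" for K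
  proof -
    have "v \<le> ?x K \<longleftrightarrow> v $ j \<le> y \<and> (\<forall>i. v $ i \<le> real K)" for v
      unfolding less_eq_vec_def by (simp only: vec_lambda_beta) (metis min.bounded_iff)
    then show ?thesis by auto
  qed
  have k: "{..?k K} = UNIV \<inter> {y. \<forall>j. y $ j \<le> real K}" for K
    by (auto simp: less_eq_vec_def)
  have "(\<lambda>K. mcdf G (?x K)) \<longlonglongrightarrow> measure G {v. v $ j \<le> y}"
    unfolding mcdf_def x by (rule measure_capped_tendsto[where r=1, simplified]) (use assms in auto)
  moreover have "(\<lambda>K. mcdf G (?k K)) \<longlonglongrightarrow> measure G UNIV"
    unfolding mcdf_def k by (rule measure_capped_tendsto[where r=1, simplified]) (use assms in auto)
  moreover have "measure G UNIV = 1"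
    using G.prob_space sets_eq_imp_space_eq[OF b] by simp
  ultimately have "\<forall>\<^sub>F K in sequentially. dist (mcdf G (?x K)) (measure G {v. v $ j \<le> y}) < e/4 \<and> dist (mcdf G (?k K)) 1 < e/4"
    using \<open>0 < e\<close> by (intro eventually_conj) (auto dest!: tendstoD[where e="e/4"])
  then obtain K where K: "dist (mcdf G (?x K)) (measure G {v. v $ j \<le> y}) < e/4" "dist (mcdf G (?k K)) 1 < e/4"
    by (auto simp: eventually_sequentially)
  have "\<forall>\<^sub>F n in sequentially. dist (mcdf (Q n) (?x K)) (mcdf G (?x K)) < e/4 \<and> dist (mcdf (Q n) (?k K)) (mcdf G (?k K)) < e/4"
    using \<open>0 < e\<close> by (intro eventually_conj tendstoD lim) auto
  then obtain N where N: "\<And>n. n \<ge> N \<Longrightarrow> dist (mcdf (Q n) (?x K)) (mcdf G (?x K)) < e/4"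
    "\<And>n. n \<ge> N \<Longrightarrow> dist (mcdf (Q n) (?k K)) (mcdf G (?k K)) < e/4"
    by (auto simp: eventually_sequentially)
  show "\<exists>N. \<forall>n\<ge>N. norm (measure (Q n) {v. v $ j \<le> y} - measure G {v. v $ j \<le> y}) < e"
  proof (intro exI[of _ N] allI impI)
    fix n assume "n \<ge> N"
    interpret Q: prob_space "Q n" by (rule Q)
    note b' = Q(2)[of n]
    have sp: "space (Q n) = UNIV" using sets_eq_imp_space_eq[OF b'] by simp
    have ev: "{..z} \<in> sets (Q n)" for z by (simp add: b')
    have lo: "measure (Q n) {..?x K} \<le> measure (Q n) {v. v $ j \<le> y}"
      unfolding x using b' by (intro Q.finite_measure_mono) auto
    have "measure (Q n) {v. v $ j \<le> y} \<le> measure (Q n) ({..?x K} \<union> (space (Q n) - {..?k K}))"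
      using b' by (intro Q.finite_measure_mono) (auto simp: sp x k)
    also have "\<dots> \<le> measure (Q n) {..?x K} + measure (Q n) (space (Q n) - {..?k K})"
      by (rule measure_Un_le[OF ev sets.compl_sets[OF ev]])
    also have "measure (Q n) (space (Q n) - {..?k K}) = 1 - measure (Q n) {..?k K}"
      by (rule Q.prob_compl[OF ev])
    finally have hi: "measure (Q n) {v. v $ j \<le> y} \<le> measure (Q n) {..?x K} + (1 - measure (Q n) {..?k K})" .
    \<comment> \<open>The lower estimate costs two quarters of \<open>e\<close>; the upper one costs
      all four, because 1 - k' may reach e / 2.\<close>
    have "\<bar>q - g\<bar> < e" if "a \<le> q" "q \<le> a + (1 - k')" "\<bar>a - x\<bar> < e/4" "\<bar>k' - k\<bar> < e/4" "\<bar>x - g\<bar> < e/4" "\<bar>k - 1\<bar> < e/4"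
      for q g a k' x k :: real
      using that unfolding abs_less_iff by linarith
    from this[OF lo hi] K N[OF \<open>n \<ge> N\<close>]
    show "norm (measure (Q n) {v. v $ j \<le> y} - measure G {v. v $ j \<le> y}) < e"
      by (simp only: dist_real_def mcdf_def real_norm_def)
  qed
qed

text \<open>This replaces the convergence of types theorem.\<close>
lemma argument_tendsto:
  fixes H :: "nat \<Rightarrow> real \<Rightarrow> real"
  assumes mono: "\<And>n y z. y \<le> z \<Longrightarrow> H n y \<le> H n z"
    and lim: "\<And>y. (\<lambda>n. H n y) \<longlonglongrightarrow> \<Phi> y"
    and u: "(\<lambda>n. H n (u n)) \<longlonglongrightarrow> \<Phi> w"
    and strict: "\<And>z. w < z \<Longrightarrow> \<Phi> w < \<Phi> z" "\<And>z. z < w \<Longrightarrow> \<Phi> z < \<Phi> w"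
  shows "u \<longlonglongrightarrow> w"
proof (rule order_tendstoI)
  fix z assume "z < w"
  then obtain c where "\<Phi> z < c" "c < \<Phi> w" using strict dense by blast
  then have "\<forall>\<^sub>F n in sequentially. H n z < c" "\<forall>\<^sub>F n in sequentially. c < H n (u n)"
    using order_tendstoD[OF lim] order_tendstoD[OF u] by auto
  then show "\<forall>\<^sub>F n in sequentially. z < u n"
  proof eventually_elim
    case (elim n) then show ?case using mono[of "u n" z n] by linarith
  qed
next
  fix z assume "w < z"
  then obtain c where "\<Phi> w < c" "c < \<Phi> z" using strict dense by blast
  then have "\<forall>\<^sub>F n in sequentially. c < H n z" "\<forall>\<^sub>F n in sequentially. H n (u n) < c"
    using order_tendstoD[OF lim] order_tendstoD[OF u] by auto
  then show "\<forall>\<^sub>F n in sequentially. u n < z"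
  proof eventually_elim
    case (elim n) then show ?case using mono[of z "u n" n] by linarith
  qed
qed

text \<open>Monotonicity replaces uniform convergence: for large n the moving argument lies between
  the fixed points obtained from \<open>w\<close> by shifting all coordinates by -d and d, and there
  pointwise convergence suffices.\<close>

lemma monotone_tendsto_compose:
  fixes H :: "nat \<Rightarrow> real^'n::finite \<Rightarrow> real"
  assumes mono: "\<And>n y z. y \<le> z \<Longrightarrow> H n y \<le> H n z"
    and lim: "\<And>y. (\<lambda>n. H n y) \<longlonglongrightarrow> \<Phi> y"
    and u: "u \<longlonglongrightarrow> w" and c: "isCont \<Phi> w"
  shows "(\<lambda>n. H n (u n)) \<longlonglongrightarrow> \<Phi> w"
proof (rule LIMSEQ_I)
  fix e :: real assume "0 < e"
  let ?s = "\<lambda>d. w + (\<chi> i. d) :: real^'n"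
  have "((\<lambda>d. ?s d) \<longlongrightarrow> w + (\<chi> i. 0)) (at 0)" by (intro tendsto_intros tendsto_vec_lambda)
  then have "((\<lambda>d. ?s d) \<longlongrightarrow> w) (at 0)" by (simp add: zero_vec_def[symmetric])
  then have "((\<lambda>d. \<Phi> (?s d)) \<longlongrightarrow> \<Phi> w) (at 0)" by (rule isCont_tendsto_compose[OF c])
  then have "\<forall>\<^sub>F d in at 0. dist (\<Phi> (?s d)) (\<Phi> w) < e/2" using \<open>0 < e\<close> by (intro tendstoD) auto
  then obtain r where r: "r > 0" "\<And>d. d \<noteq> 0 \<Longrightarrow> \<bar>d\<bar> < r \<Longrightarrow> \<bar>\<Phi> (?s d) - \<Phi> w\<bar> < e/2"
    by (auto simp: eventually_at dist_real_def)
  define d where "d = r/2"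
  have d: "d > 0" "\<bar>\<Phi> (?s d) - \<Phi> w\<bar> < e/2" "\<bar>\<Phi> (?s (-d)) - \<Phi> w\<bar> < e/2"
    using r(1) r(2)[of d] r(2)[of "-d"] by (auto simp: d_def)
  have "\<forall>\<^sub>F n in sequentially. dist (u n) w < d \<and> dist (H n (?s d)) (\<Phi> (?s d)) < e/2
      \<and> dist (H n (?s (-d))) (\<Phi> (?s (-d))) < e/2"
    using d(1) \<open>0 < e\<close> by (intro eventually_conj tendstoD u lim) auto
  then obtain N where N: "\<And>n. n \<ge> N \<Longrightarrow> dist (u n) w < d \<and> dist (H n (?s d)) (\<Phi> (?s d)) < e/2
      \<and> dist (H n (?s (-d))) (\<Phi> (?s (-d))) < e/2"
    by (auto simp: eventually_sequentially)
  show "\<exists>N. \<forall>n\<ge>N. norm (H n (u n) - \<Phi> w) < e"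
  proof (intro exI[of _ N] allI impI)
    fix n assume n: "n \<ge> N"
    have "\<bar>u n $ i - w $ i\<bar> < d" for i
      using N[OF n] component_le_norm_cart[of "u n - w" i] by (simp add: dist_norm)
    then have "w $ i - d \<le> u n $ i" "u n $ i \<le> w $ i + d" for i
      by (simp_all add: abs_less_iff less_imp_le algebra_simps)
    then have "?s (-d) \<le> u n" "u n \<le> ?s d"
      by (simp_all add: less_eq_vec_def)
    then have "H n (?s (-d)) \<le> H n (u n)" "H n (u n) \<le> H n (?s d)" using mono by blast+
    then show "norm (H n (u n) - \<Phi> w) < e"
      using N[OF n] d unfolding dist_real_def real_norm_def by linarith
  qed
qed

section \<open>Max-stability\<close>

lemma normalized_max_le_iff:
  fixes X :: "nat \<Rightarrow> real^'n::finite"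
  assumes "\<And>j. a $ j > 0"
  shows "(\<chi> j. ((MAX i\<in>{..n}. X i $ j) - b $ j) / a $ j) \<le> x \<longleftrightarrow>
    (\<forall>i\<in>{..n}. X i \<le> (\<chi> j. a $ j * x $ j + b $ j))"
proof -
  have "((MAX i\<in>{..n}. X i $ j) - b $ j) / a $ j \<le> x $ j \<longleftrightarrow> (\<forall>i\<in>{..n}. X i $ j \<le> a $ j * x $ j + b $ j)" for j
  proof -
    have "((MAX i\<in>{..n}. X i $ j) - b $ j) / a $ j \<le> x $ j \<longleftrightarrow> (MAX i\<in>{..n}. X i $ j) \<le> a $ j * x $ j + b $ j"
      using assms[of j] by (simp add: divide_le_eq mult.commute algebra_simps)
    also have "\<dots> \<longleftrightarrow> (\<forall>i\<in>{..n}. X i $ j \<le> a $ j * x $ j + b $ j)"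
      by (subst Max_le_iff) auto
    finally show ?thesis .
  qed
  then show ?thesis by (auto simp: less_eq_vec_def)
qed

lemma measurable_normalized_max:
  fixes X :: "nat \<Rightarrow> 'a \<Rightarrow> real^'n::finite"
  assumes [measurable]: "\<And>i. X i \<in> borel_measurable P"
  shows "(\<lambda>\<omega>. \<chi> j. ((MAX i\<in>{..n}. X i \<omega> $ j) - b $ j) / a $ j) \<in> borel_measurable P"
  by measurable

lemma measure_iid_max:
  fixes X :: "nat \<Rightarrow> 'a \<Rightarrow> real^'n::finite"
  assumes P: "prob_space P" and ind: "prob_space.indep_vars P (\<lambda>_. borel) X UNIV"
    and id: "\<And>i. distr P borel (X i) = distr P borel (X 0)" and S: "S \<in> sets borel"
  shows "measure P {\<omega> \<in> space P. \<forall>i\<in>{..n}. X i \<omega> \<in> S} = measure (distr P borel (X 0)) S ^ Suc n"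
proof -
  interpret prob_space P by fact
  have rv[measurable]: "X i \<in> borel_measurable P" for i
    using ind unfolding indep_vars_def by auto
  have "measure P {\<omega> \<in> space P. \<forall>i\<in>{..n}. X i \<omega> \<in> S} = measure P (\<Inter>i\<in>{..n}. X i -` S \<inter> space P)"
    by (intro arg_cong[where f="measure P"]) auto
  also have "\<dots> = (\<Prod>i\<in>{..n}. measure P (X i -` S \<inter> space P))"
    using ind S by (intro indep_varsD) auto
  also have "\<dots> = (\<Prod>i\<in>{..n}. measure (distr P borel (X i)) S)"
    using S by (intro prod.cong) (auto simp: measure_distr)
  also have "\<dots> = (\<Prod>i\<in>{..n}. measure (distr P borel (X 0)) S)"
    by (intro prod.cong refl arg_cong[where f="\<lambda>M. measure M S"] id)
  also have "\<dots> = measure (distr P borel (X 0)) S ^ Suc n" by simp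
  finally show ?thesis .
qed

lemma mcdf_normalized_max:
  fixes X :: "nat \<Rightarrow> 'a \<Rightarrow> real^'n::finite"
  assumes P: "prob_space P" and ind: "prob_space.indep_vars P (\<lambda>_. borel) X UNIV"
    and id: "\<And>i. distr P borel (X i) = distr P borel (X 0)" and a: "\<And>j. a $ j > 0"
  shows "mcdf (distr P borel (\<lambda>\<omega>. \<chi> j. ((MAX i\<in>{..n}. X i \<omega> $ j) - b $ j) / a $ j)) x =
    mcdf (distr P borel (X 0)) (\<chi> j. a $ j * x $ j + b $ j) ^ Suc n"
proof -
  interpret prob_space P by fact
  have rv[measurable]: "X i \<in> borel_measurable P" for i
    using ind unfolding indep_vars_def by auto
  have "mcdf (distr P borel (\<lambda>\<omega>. \<chi> j. ((MAX i\<in>{..n}. X i \<omega> $ j) - b $ j) / a $ j)) x =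
     measure P {\<omega> \<in> space P. \<forall>i\<in>{..n}. X i \<omega> \<in> {..\<chi> j. a $ j * x $ j + b $ j}}"
    unfolding mcdf_def
    by (subst measure_distr)
       (auto simp: measurable_normalized_max normalized_max_le_iff[of a, OF a] intro!: arg_cong[where f=prob])
  also have "\<dots> = mcdf (distr P borel (X 0)) (\<chi> j. a $ j * x $ j + b $ j) ^ Suc n"
    unfolding mcdf_def by (rule measure_iid_max[OF P ind id]) auto
  finally show ?thesis .
qed

lemma cdf_normalized_max_margin:
  fixes X :: "nat \<Rightarrow> 'a \<Rightarrow> real^'n::finite"
  assumes P: "prob_space P" and ind: "prob_space.indep_vars P (\<lambda>_. borel) X UNIV"
    and id: "\<And>i. distr P borel (X i) = distr P borel (X 0)" and a: "\<And>j. a $ j > 0"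
  shows "measure (distr P borel (\<lambda>\<omega>. \<chi> j. ((MAX i\<in>{..n}. X i \<omega> $ j) - b $ j) / a $ j)) {v. v $ j \<le> y} =
    measure (distr P borel (X 0)) {v. v $ j \<le> a $ j * y + b $ j} ^ Suc n"
proof -
  interpret prob_space P by fact
  have rv[measurable]: "X i \<in> borel_measurable P" for i
    using ind unfolding indep_vars_def by auto
  have *: "((MAX i\<in>{..n}. X i \<omega> $ j) - b $ j) / a $ j \<le> y \<longleftrightarrow> (\<forall>i\<in>{..n}. X i \<omega> $ j \<le> a $ j * y + b $ j)" for \<omega>
  proof -
    have "((MAX i\<in>{..n}. X i \<omega> $ j) - b $ j) / a $ j \<le> y \<longleftrightarrow> (MAX i\<in>{..n}. X i \<omega> $ j) \<le> a $ j * y + b $ j"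
      using a[of j] by (simp add: divide_le_eq mult.commute algebra_simps)
    then show ?thesis by (subst (asm) Max_le_iff) auto
  qed
  have "measure (distr P borel (\<lambda>\<omega>. \<chi> j. ((MAX i\<in>{..n}. X i \<omega> $ j) - b $ j) / a $ j)) {v. v $ j \<le> y} =
     measure P {\<omega> \<in> space P. \<forall>i\<in>{..n}. X i \<omega> \<in> {v. v $ j \<le> a $ j * y + b $ j}}"
    by (subst measure_distr)
       (auto simp: measurable_normalized_max * intro!: arg_cong[where f=prob])
  also have "\<dots> = measure (distr P borel (X 0)) {v. v $ j \<le> a $ j * y + b $ j} ^ Suc n"
    by (rule measure_iid_max[OF P ind id]) auto
  finally show ?thesis .
qed

text \<open>Stated for an arbitrary common margin \<Phi> so that one proof covers Frechet (\<phi>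
  multiplies by t, \<open>D\<close> the positive reals) and Gumbel margins (\<phi> adds ln t,
  \<open>D\<close> all reals). Normalized maxima of two block lengths with ratio t have cdfs that
  are powers of the same cdf \<open>F\<close> at affinely related arguments. The margins identify
  the limit of these arguments as \<phi>; inserting it into the joint cdf gives the claim.\<close>

lemma mev_max_stable:
  fixes G :: "(real^'n::finite) measure"
  assumes mev: "mev G" and marg: "\<And>j. cdf (margin G j) = \<Phi>" and cont: "\<And>y. isCont \<Phi> y"
    and strict: "\<And>y z. y \<in> D \<Longrightarrow> y < z \<Longrightarrow> \<Phi> y < \<Phi> z" "\<And>y z. y \<in> D \<Longrightarrow> z < y \<Longrightarrow> \<Phi> z < \<Phi> y"
    and t: "0 < t" and \<phi>: "\<And>y. y \<in> D \<Longrightarrow> \<phi> y \<in> D" "\<And>y. y \<in> D \<Longrightarrow> \<Phi> (\<phi> y) = \<Phi> y powr (1/t)"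
    and x: "\<And>j. x $ j \<in> D"
  shows "mcdf G (\<chi> j. \<phi> (x $ j)) powr t = mcdf G x"
proof -
  have G: "prob_space G" and b: "sets G = sets borel" using mev unfolding mev_def by auto
  obtain P :: "(nat \<Rightarrow> real^'n) measure" and X a c where P: "prob_space P"
    and ind: "prob_space.indep_vars P (\<lambda>_. borel) X UNIV"
    and id: "\<And>i. distr P borel (X i) = distr P borel (X 0)" and a: "\<And>n j. a n $ j > 0"
    and w: "mweak_conv (\<lambda>n. distr P borel (\<lambda>\<omega>. \<chi> j. ((MAX i\<in>{..n}. X i \<omega> $ j) - c n $ j) / a n $ j)) G"
    using mev unfolding mev_def by (elim conjE exE) (rule that; (assumption | simp))
  interpret P: prob_space P by fact
  have rv: "X i \<in> borel_measurable P" for i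
    using ind unfolding P.indep_vars_def by auto
  define Q where "Q n = distr P borel (\<lambda>\<omega>. \<chi> j. ((MAX i\<in>{..n}. X i \<omega> $ j) - c n $ j) / a n $ j)" for n
  have Q: "prob_space (Q n)" "sets (Q n) = sets borel" for n
    unfolding Q_def by (auto intro!: P.prob_space_distr measurable_normalized_max rv)
  have contG: "isCont (mcdf G) z" for z
    by (rule isCont_mcdf[OF G b]) (simp add: marg cont)
  have lim: "(\<lambda>n. mcdf (Q n) z) \<longlonglongrightarrow> mcdf G z" for z
    using w contG unfolding mweak_conv_def Q_def by auto
  have limj: "(\<lambda>n. measure (Q n) {v. v $ j \<le> y}) \<longlonglongrightarrow> \<Phi> y" for j y
    using margin_tendsto[OF G b Q lim, of j y] cdf_margin[OF b, of j y] by (simp add: marg)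
  define F where "F = distr P borel (X 0)"
  interpret F: prob_space F unfolding F_def by (intro P.prob_space_distr rv)
  have Qx: "mcdf (Q n) z = mcdf F (\<chi> j. a n $ j * z $ j + c n $ j) ^ Suc n" for n z
    unfolding Q_def F_def by (rule mcdf_normalized_max[OF P ind id a])
  have Qj: "measure (Q n) {v. v $ j \<le> y} = measure F {v. v $ j \<le> a n $ j * y + c n $ j} ^ Suc n" for n j y
    unfolding Q_def F_def by (rule cdf_normalized_max_margin[OF P ind id a])
  \<comment> \<open>A maximum over \<open>{..m n}\<close> has \<open>Suc (m n)\<close> terms, a
    number between t (n + 1) and t (n + 1) + 1.\<close>
  define m where "m n = nat \<lfloor>t * real (Suc n)\<rfloor>" for n
  have m_lim: "filterlim m at_top sequentially"
  proof -
    have "filterlim (\<lambda>n. t * real (Suc n)) at_top sequentially"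
      by (intro filterlim_tendsto_pos_mult_at_top[OF tendsto_const t] filterlim_compose[OF filterlim_real_sequentially filterlim_Suc])
    then show ?thesis unfolding m_def
      by (intro filterlim_compose[OF filterlim_nat_sequentially] filterlim_compose[OF filterlim_floor_sequentially])
  qed
  have ratio: "(\<lambda>n. real (Suc n) / real (Suc (m n))) \<longlonglongrightarrow> 1/t"
  proof -
    have "(\<lambda>n. real (Suc (m n)) / real (Suc n)) \<longlonglongrightarrow> t"
    proof (rule tendsto_sandwich)
      have "t * real (Suc n) \<le> real (Suc (m n))" "real (Suc (m n)) \<le> t * real (Suc n) + 1" for n
        using t unfolding m_def by (auto simp: of_nat_nat, linarith+)
      then show "\<forall>\<^sub>F n in sequentially. t \<le> real (Suc (m n)) / real (Suc n)"
        "\<forall>\<^sub>F n in sequentially. real (Suc (m n)) / real (Suc n) \<le> t + inverse (real (Suc n))"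
        by (auto intro!: always_eventually simp: field_simps simp del: of_nat_Suc)
      show "(\<lambda>n. t + inverse (real (Suc n))) \<longlonglongrightarrow> t"
        using tendsto_add[OF tendsto_const LIMSEQ_inverse_real_of_nat, of t] by simp
    qed simp
    from tendsto_inverse[OF this] show ?thesis using t by (simp add: inverse_eq_divide)
  qed
  \<comment> \<open>Both normalized cdfs are integer powers of the same p, so one is a real power of
    the other, with an exponent tending to 1 / t.\<close>
  have power_root: "p ^ Suc n = (p ^ Suc (m n)) powr (real (Suc n) / real (Suc (m n)))" if "0 \<le> p" for p :: real and n
  proof (cases "p = 0")
    case False
    then have "p > 0" using that by simp
    then show ?thesis by (simp add: powr_realpow[symmetric] powr_powr del: of_nat_Suc power_Suc)
  qed simp
  \<comment> \<open>\<open>u n z\<close> is the argument at which the norming of \<open>Q n\<close>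
    yields the same threshold for the raw observations as \<open>z\<close> does under the norming of
    \<open>Q (m n)\<close>.\<close>
  define u where "u n z = (\<chi> j. (a (m n) $ j * z $ j + c (m n) $ j - c n $ j) / a n $ j)" for n and z :: "real^'n"
  have un: "a n $ j * u n z $ j + c n $ j = a (m n) $ j * z $ j + c (m n) $ j" for n z j
    using a[of n j] by (simp add: u_def field_simps)
  \<comment> \<open>Convergence of the norming constants is never claimed. Only these values at
    \<open>x\<close> converge, forced by the strict monotonicity of \<Phi> at \<phi> (x j).\<close>
  have "(\<lambda>n. u n x $ j) \<longlonglongrightarrow> \<phi> (x $ j)" for j
  proof (rule argument_tendsto[where H="\<lambda>n y. measure (Q n) {v. v $ j \<le> y}" and \<Phi>=\<Phi>])
    show "measure (Q n) {v. v $ j \<le> y} \<le> measure (Q n) {v. v $ j \<le> z}" if "y \<le> z" for n y z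
    proof -
      interpret Q: prob_space "Q n" by (rule Q)
      show ?thesis using that by (intro Q.finite_measure_mono) (auto simp: Q)
    qed
    have "(\<lambda>n. measure (Q (m n)) {v. v $ j \<le> x $ j} powr (real (Suc n) / real (Suc (m n)))) \<longlonglongrightarrow> \<Phi> (x $ j) powr (1/t)"
      by (rule tendsto_powr'[OF filterlim_compose[OF limj m_lim] ratio]) (use t in auto)
    moreover have "measure (Q n) {v. v $ j \<le> u n x $ j} = measure (Q (m n)) {v. v $ j \<le> x $ j} powr (real (Suc n) / real (Suc (m n)))" for n
      unfolding Qj un by (rule power_root) simp
    ultimately show "(\<lambda>n. measure (Q n) {v. v $ j \<le> u n x $ j}) \<longlonglongrightarrow> \<Phi> (\<phi> (x $ j))"
      by (simp add: \<phi>(2)[OF x])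
  qed (use limj strict[OF \<phi>(1)[OF x]] in auto)
  then have u_lim: "(\<lambda>n. u n x) \<longlonglongrightarrow> (\<chi> j. \<phi> (x $ j))"
    by (intro vec_tendstoI) simp
  have "(\<lambda>n. mcdf (Q n) (u n x)) \<longlonglongrightarrow> mcdf G (\<chi> j. \<phi> (x $ j))"
    by (rule monotone_tendsto_compose[OF _ lim u_lim contG]) (rule mcdf_mono[OF Q])
  moreover have "mcdf (Q n) (u n x) = mcdf (Q (m n)) x powr (real (Suc n) / real (Suc (m n)))" for n
    unfolding Qx un by (rule power_root) (simp add: mcdf_def)
  moreover have "(\<lambda>n. mcdf (Q (m n)) x powr (real (Suc n) / real (Suc (m n)))) \<longlonglongrightarrow> mcdf G x powr (1/t)"
    by (rule tendsto_powr'[OF filterlim_compose[OF lim m_lim] ratio]) (use t in \<open>auto simp: mcdf_def\<close>)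
  ultimately have "mcdf G (\<chi> j. \<phi> (x $ j)) = mcdf G x powr (1/t)"
    using LIMSEQ_unique by fastforce
  then show ?thesis using t by (simp add: powr_powr mcdf_def)
qed

text \<open>The common interface of both claims: unit-Frechet mev laws and exponentiated Gumbel mev
  laws satisfy it. Restricting \<open>x\<close> to the open positive orthant loses nothing, since
  elsewhere the Frechet margins make both cdf values zero.\<close>

definition simple_max_stable :: "(real^'n::finite) measure \<Rightarrow> bool" where
  "simple_max_stable G \<longleftrightarrow>
     prob_space G \<and> sets G = sets borel \<and> unit_frechet_margins G \<and>
     (\<forall>t>0. \<forall>x. (\<forall>j. x $ j > 0) \<longrightarrow> mcdf G (t *\<^sub>R x) powr t = mcdf G x)"

definition frechet :: "real \<Rightarrow> real" where
  "frechet x = (if x > 0 then exp (- 1 / x) else 0)"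

lemma isCont_frechet: "isCont frechet x"
proof -
  consider "x < 0" | "x > 0" | "x = 0" by linarith
  then show ?thesis
  proof cases
    case 1
    then have "\<forall>\<^sub>F y in nhds x. frechet y = 0"
      by (intro eventually_mono[OF order_tendstoD(2)[OF filterlim_ident 1]]) (auto simp: frechet_def)
    then show ?thesis by (subst isCont_cong) auto
  next
    case 2
    then have "\<forall>\<^sub>F y in nhds x. frechet y = exp (- 1 / y)"
      by (intro eventually_mono[OF order_tendstoD(1)[OF filterlim_ident 2]]) (auto simp: frechet_def)
    then show ?thesis using 2 by (subst isCont_cong) (auto intro!: continuous_intros)
  next
    case 3
    have "(frechet \<longlongrightarrow> 0) (at 0)"
    proof (rule filterlim_split_at)
      have "\<forall>\<^sub>F y in at_left (0::real). 0 = frechet y"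
        unfolding eventually_at by (intro exI[of _ 1]) (auto simp: frechet_def)
      then show "(frechet \<longlongrightarrow> 0) (at_left 0)" by (rule Lim_transform_eventually[OF tendsto_const])
      have "\<forall>\<^sub>F y in at_right (0::real). exp (- inverse y) = frechet y"
        unfolding eventually_at by (intro exI[of _ 1]) (auto simp: frechet_def inverse_eq_divide)
      moreover have "((\<lambda>y::real. exp (- inverse y)) \<longlongrightarrow> 0) (at_right 0)"
        by (intro filterlim_compose[OF exp_at_bot] filterlim_compose[OF filterlim_uminus_at_bot_at_top] filterlim_inverse_at_top_right)
      ultimately show "(frechet \<longlongrightarrow> 0) (at_right 0)" by (rule Lim_transform_eventually[rotated])
    qed
    then show ?thesis using 3 by (simp add: isCont_def frechet_def)
  qed
qed

lemma unit_frechet_margins_iff: "unit_frechet_margins G \<longleftrightarrow> (\<forall>j. cdf (margin G j) = frechet)"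
  by (auto simp: unit_frechet_margins_def frechet_def fun_eq_iff)

lemma mev_imp_simple_max_stable:
  assumes "mev G" and fr: "unit_frechet_margins G"
  shows "simple_max_stable G"
proof -
  have "mcdf G (t *\<^sub>R x) powr t = mcdf G x" if t: "t > 0" and x: "\<forall>j. x $ j > 0" for t x
  proof -
    have "mcdf G (\<chi> j. t * (x $ j)) powr t = mcdf G x"
      using \<open>mev G\<close> _ isCont_frechet _ _ t
    proof (rule mev_max_stable[where D="{0<..}"])
      show "frechet y < frechet z" if "y \<in> {0<..}" "y < z" for y z
        using that by (simp add: frechet_def field_simps)
      show "frechet z < frechet y" if "y \<in> {0<..}" "z < y" for y z
        using that by (simp add: frechet_def field_simps)
      show "frechet (t * y) = frechet y powr (1/t)" if "y \<in> {0<..}" for y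
        using that t by (simp add: frechet_def exp_powr_real)
    qed (use fr t x in \<open>auto simp: unit_frechet_margins_iff\<close>)
    also have "(\<chi> j. t * (x $ j)) = t *\<^sub>R x" by (simp add: vec_eq_iff)
    finally show ?thesis .
  qed
  then show ?thesis using assms unfolding simple_max_stable_def mev_def by blast
qed

text \<open>Only max-stability is transported, not \<open>mev\<close> itself: exponentiation turns
  the shift by \<open>ln t\<close>, under which the Gumbel cdf becomes its power 1 / t, into
  multiplication by \<open>t\<close>.\<close>

lemma mev_gumbel_exp_simple_max_stable:
  fixes G :: "(real^'n::finite) measure"
  assumes "mev G" and gu: "gumbel_margins G"
  shows "simple_max_stable (distr G borel (\<lambda>x. \<chi> j. exp (x $ j)))"
proof -
  let ?L = "distr G borel (\<lambda>x. \<chi> j. exp (x $ j))"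
  have G: "prob_space G" and b[measurable_cong]: "sets G = sets borel" using assms unfolding mev_def by auto
  have sp: "space G = UNIV" using sets_eq_imp_space_eq[OF b] by simp
  interpret prob_space G by fact
  have m[measurable]: "(\<lambda>x. \<chi> j. exp (x $ j)) \<in> borel_measurable G" by measurable
  have "unit_frechet_margins ?L"
    unfolding unit_frechet_margins_def
  proof safe
    fix j and x :: real
    have "cdf (margin ?L j) x = measure G {y. exp (y $ j) \<le> x}"
      by (subst cdf_margin, simp, subst measure_distr) (auto simp: vimage_def sp)
    also have "\<dots> = (if x > 0 then measure G {y. y $ j \<le> ln x} else measure G {})"
    proof (cases "x > 0")
      case True
      then have "exp r \<le> x \<longleftrightarrow> r \<le> ln x" for r by (metis exp_ln exp_le_cancel_iff)
      then show ?thesis using True by simp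
    next
      case False
      then have "\<not> exp r \<le> x" for r by (meson exp_gt_zero less_le_trans)
      then show ?thesis using False by simp
    qed
    also have "\<dots> = (if x > 0 then exp (- 1 / x) else 0)"
      using gu by (simp add: cdf_margin[OF b, symmetric] gumbel_margins_def exp_minus inverse_eq_divide)
    finally show "cdf (margin ?L j) x = (if x > 0 then exp (- 1 / x) else 0)" .
  qed
  moreover have L: "mcdf ?L x = mcdf G (\<chi> j. ln (x $ j))" if "\<forall>j. x $ j > 0" for x
  proof -
    have "(\<chi> j. exp (y $ j)) \<le> x \<longleftrightarrow> y \<le> (\<chi> j. ln (x $ j))" for y
      using that by (simp add: less_eq_vec_def ln_ge_iff)
    then show ?thesis unfolding mcdf_def by (subst measure_distr) (auto simp: vimage_def sp atMost_def)
  qed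
  moreover have "mcdf ?L (t *\<^sub>R x) powr t = mcdf ?L x" if t: "t > 0" and x: "\<forall>j. x $ j > 0" for t x
  proof -
    have "mcdf G (\<chi> j. (\<chi> j. ln (x $ j)) $ j + ln t) powr t = mcdf G (\<chi> j. ln (x $ j))"
    proof (rule mev_max_stable[OF \<open>mev G\<close>, where D=UNIV and \<Phi>="\<lambda>x. exp (- exp (-x))"])
      show "exp (- exp (- (y + ln t))) = exp (- exp (- y)) powr (1 / t)" for y
        using t by (simp add: exp_powr_real exp_diff)
    qed (use t gu in \<open>auto simp: gumbel_margins_def intro!: continuous_intros\<close>)
    moreover have "(\<chi> j. (\<chi> j. ln (x $ j)) $ j + ln t) = (\<chi> j. ln ((t *\<^sub>R x) $ j))"
      using t x by (simp add: vec_eq_iff ln_mult_pos)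
    ultimately show ?thesis using L[OF x] L[of "t *\<^sub>R x"] t x by simp
  qed
  ultimately show ?thesis using m unfolding simple_max_stable_def by (auto intro: prob_space_distr)
qed

section \<open>Independent vectors as coordinates of product measures, and the converse from
  max-stability to \<open>mev\<close>\<close>

lemma measurable_PiM_coordinate:
  assumes "i \<in> K" "sets (M i) = sets N"
  shows "(\<lambda>\<omega>. \<omega> i) \<in> measurable (PiM K M) N"
  using measurable_component_singleton[OF assms(1), of M] measurable_cong_sets[OF refl assms(2), of "PiM K M"]
  by blast

text \<open>The factors may differ and \<open>K\<close> may exceed \<open>I\<close>, so the lemma
  serves both the i.i.d. sample behind \<open>mev\<close> and the components with indices
  \<open>{1..r}\<close> inside a product over all naturals.\<close>

lemma indep_vars_PiM_coordinates:
  fixes M :: "'i \<Rightarrow> 'a measure"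
  assumes M: "\<And>i. prob_space (M i)" and s: "\<And>i. sets (M i) = sets N" and I: "I \<noteq> {}" "I \<subseteq> K"
  shows "prob_space.indep_vars (PiM K M) (\<lambda>_. N) (\<lambda>i \<omega>. \<omega> i) I"
proof -
  interpret P: prob_space "PiM K M" by (rule prob_space_PiM) (rule M)
  have m: "(\<lambda>\<omega>. \<omega> i) \<in> measurable (PiM K M) N" if "i \<in> K" for i
    using that s by (rule measurable_PiM_coordinate)
  have "distr (PiM K M) (PiM I (\<lambda>_. N)) (\<lambda>x. \<lambda>i\<in>I. x i) = distr (PiM K M) (PiM I M) (\<lambda>x. restrict x I)"
    using s by (intro distr_cong sets_PiM_cong) auto
  also have "\<dots> = PiM I M" 
    using distr_PiM_reindex[of K M "\<lambda>i. i" I] M I by (simp add: restrict_def subset_eq)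
  also have "\<dots> = (\<Pi>\<^sub>M i\<in>I. distr (PiM K M) N (\<lambda>\<omega>. \<omega> i))"
  proof (intro PiM_cong refl)
    fix i assume "i \<in> I"
    have "distr (PiM K M) N (\<lambda>\<omega>. \<omega> i) = distr (PiM K M) (M i) (\<lambda>\<omega>. \<omega> i)"
      using s by (intro distr_cong) auto
    then show "M i = distr (PiM K M) N (\<lambda>\<omega>. \<omega> i)"
      using distr_PiM_component[of K M i] M \<open>i \<in> I\<close> I by auto
  qed
  finally show ?thesis
    using I m by (subst P.indep_vars_iff_distr_eq_PiM') auto
qed

lemma distr_PiM_coordinate:
  assumes M: "\<And>i. prob_space (M i)" and s: "\<And>i. sets (M i) = sets N" and "i \<in> K"
  shows "distr (PiM K M) N (\<lambda>\<omega>. \<omega> i) = M i"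
proof -
  have "distr (PiM K M) N (\<lambda>\<omega>. \<omega> i) = distr (PiM K M) (M i) (\<lambda>\<omega>. \<omega> i)"
    using s by (intro distr_cong) auto
  then show ?thesis using distr_PiM_component[of K M i] M \<open>i \<in> K\<close> by auto
qed

lemma mcdf_frechet_nonpos:
  assumes "prob_space G" and b: "sets G = sets borel" and fr: "unit_frechet_margins G" and "x $ j \<le> 0"
  shows "mcdf G x = 0"
proof -
  interpret prob_space G by fact
  have "mcdf G x \<le> measure G {y. y $ j \<le> x $ j}"
    unfolding mcdf_def by (intro finite_measure_mono) (auto simp: b less_eq_vec_def)
  also have "\<dots> = 0"
    using fr \<open>x $ j \<le> 0\<close> by (simp add: cdf_margin[OF b, symmetric] unit_frechet_margins_def)
  finally show ?thesis by (simp add: mcdf_def measure_le_0_iff)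
qed

text \<open>The components of a mixture model must satisfy \<open>mev\<close> by definition. For an
  i.i.d. sample from \<open>G\<close> itself, scaled by n + 1 and not centred, every normalized
  maximum already has cdf \<open>mcdf G\<close>, so the convergence is trivial.\<close>

lemma simple_max_stable_imp_mev:
  fixes G :: "(real^'n::finite) measure"
  assumes "simple_max_stable G"
  shows "mev G"
proof -
  have G: "prob_space G" and b: "sets G = sets borel" and fr: "unit_frechet_margins G"
    and ms: "\<And>t x. t > 0 \<Longrightarrow> (\<forall>j. x $ j > 0) \<Longrightarrow> mcdf G (t *\<^sub>R x) powr t = mcdf G x"
    using assms unfolding simple_max_stable_def by auto
  interpret prob_space G by fact
  let ?P = "PiM UNIV (\<lambda>_::nat. G)"
  let ?X = "\<lambda>(i::nat) (\<omega> :: nat \<Rightarrow> real^'n). \<omega> i"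
  have P: "prob_space ?P" by (intro prob_space_PiM G)
  have ind: "prob_space.indep_vars ?P (\<lambda>_. borel) ?X UNIV"
    by (rule indep_vars_PiM_coordinates) (auto simp: G b)
  have d: "distr ?P borel (?X i) = G" for i
    by (rule distr_PiM_coordinate) (auto simp: G b)
  have "mcdf (distr ?P borel (\<lambda>\<omega>. \<chi> j. ((MAX i\<in>{..n}. ?X i \<omega> $ j) - (0::real^'n) $ j) / (\<chi> j. real (Suc n)) $ j)) x = mcdf G x" for n x
  proof -
    have "mcdf (distr ?P borel (\<lambda>\<omega>. \<chi> j. ((MAX i\<in>{..n}. ?X i \<omega> $ j) - (0::real^'n) $ j) / (\<chi> j. real (Suc n)) $ j)) x =
      mcdf G (\<chi> j. (\<chi> j. real (Suc n)) $ j * x $ j + (0::real^'n) $ j) ^ Suc n"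
      by (subst mcdf_normalized_max[OF P ind]) (auto simp: d)
    also have "(\<chi> j. (\<chi> j. real (Suc n)) $ j * x $ j + (0::real^'n) $ j) = real (Suc n) *\<^sub>R x"
      by (simp add: vec_eq_iff)
    also have "mcdf G (real (Suc n) *\<^sub>R x) ^ Suc n = mcdf G x"
    proof (cases "\<forall>j. x $ j > 0")
      case True
      have "mcdf G (real (Suc n) *\<^sub>R x) ^ Suc n = mcdf G (real (Suc n) *\<^sub>R x) powr real (Suc n)"
        by (subst powr_realpow') (auto simp: mcdf_def)
      then show ?thesis using ms[of "real (Suc n)" x] True by simp
    next
      case False
      then obtain j where "x $ j \<le> 0" by (auto simp: not_less)
      then have "(real (Suc n) *\<^sub>R x) $ j \<le> 0" by (simp add: mult_nonneg_nonpos del: of_nat_Suc)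
      then show ?thesis
        using mcdf_frechet_nonpos[OF G b fr \<open>x $ j \<le> 0\<close>] mcdf_frechet_nonpos[OF G b fr, of "real (Suc n) *\<^sub>R x" j] by simp
    qed
    finally show ?thesis .
  qed
  then have conv: "mweak_conv (\<lambda>n. distr ?P borel (\<lambda>\<omega>. \<chi> j. ((MAX i\<in>{..n}. ?X i \<omega> $ j) - (\<lambda>n. 0::real^'n) n $ j) / (\<lambda>n. \<chi> j. real (Suc n)) n $ j)) G"
    unfolding mweak_conv_def by simp
  \<comment> \<open>A point mass has cdf value 0 or 1 at the point 1, but the Frechet value there is
    exp (-1).\<close>
  have nd: "\<not> (\<exists>c. AE t in margin G j. t = c)" for j
  proof
    assume "\<exists>c. AE t in margin G j. t = c"
    then obtain c where c: "AE t in margin G j. t = c" by blast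
    have [measurable_cong]: "sets G = sets borel" by (rule b)
    interpret M: prob_space "margin G j" unfolding margin_def by (intro prob_space_distr) measurable
    have s: "sets (margin G j) = sets borel" by (simp add: margin_def)
    have "measure (margin G j) {..1} = (if c \<le> 1 then 1 else 0)"
    proof (cases "c \<le> 1")
      case True
      then have "AE t in margin G j. t \<in> {..1}" using c by (auto elim!: eventually_mono)
      then have "M.prob {..1} = 1" by (intro M.prob_eq_1[THEN iffD2]) (auto simp: s)
      then show ?thesis using True by simp
    next
      case False
      then have "AE t in margin G j. t \<notin> {..1}" using c by (auto elim!: eventually_mono)
      then have "M.prob {..1} = 0" by (intro M.prob_eq_0[THEN iffD2]) (auto simp: s)
      then show ?thesis using False by simp
    qed
    moreover have "measure (margin G j) {..1} = exp (-1)"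
      using fr unfolding unit_frechet_margins_def cdf_def by simp
    ultimately show False by (auto split: if_splits)
  qed
  show ?thesis unfolding mev_def
    using G b nd P ind d conv
    by (intro conjI allI exI[of _ ?P] exI[of _ ?X] exI[of _ "\<lambda>n. \<chi> j. real (Suc n)"] exI[of _ "\<lambda>n. 0"]) auto
qed

section \<open>The limit measure on finite unions of cells\<close>

text \<open>A pair (j, s) is a threshold s for coordinate j. Sets of pairs, rather than vectors,
  allow unconstrained coordinates (the infinite entries of a vector in [0, \<infinity>]^d), and
  intersecting boxes amounts to uniting constraint sets.\<close>

definition constraints :: "('n \<times> real) set \<Rightarrow> bool" where
  "constraints H \<longleftrightarrow> finite H \<and> (\<forall>p\<in>H. 0 < snd p)"

definition lower_set :: "('n \<times> real) set \<Rightarrow> (real^'n::finite) set" where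
  "lower_set H = {y. \<forall>p\<in>H. y $ fst p \<le> snd p}"

definition upper_set :: "('n \<times> real) set \<Rightarrow> (real^'n::finite) set" where
  "upper_set L = {y. \<forall>p\<in>L. snd p < y $ fst p}"

definition cell :: "('n \<times> real) set \<Rightarrow> ('n \<times> real) set \<Rightarrow> (real^'n::finite) set" where
  "cell L H = EE \<inter> upper_set L \<inter> lower_set H"

text \<open>Positive thresholds and \<open>L \<noteq> {}\<close> keep a cell away from the origin,
  where the limit measure is infinite. \<open>H\<close> may be empty, so cells can be
  unbounded.\<close>

definition cells :: "(real^'n::finite) set set" where
  "cells = {cell L H | L H. constraints L \<and> constraints H \<and> L \<noteq> {}}"

definition cell_ring :: "(real^'n::finite) set set" where
  "cell_ring = {\<Union>C | C. finite C \<and> C \<subseteq> cells}"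

definition capped :: "('n \<times> real) set \<Rightarrow> real \<Rightarrow> real^'n::finite" where
  "capped H K = (\<chi> j. Min (insert K {t. (j, t) \<in> H}))"

lemma constraints_insert [simp]: "constraints (insert p H) \<longleftrightarrow> 0 < snd p \<and> constraints H"
  by (auto simp: constraints_def)

lemma constraints_empty [simp]: "constraints {}" by (simp add: constraints_def)

lemma constraints_Un [simp]: "constraints (H \<union> H') \<longleftrightarrow> constraints H \<and> constraints H'"
  by (auto simp: constraints_def)

lemma finite_coordinate: "finite H \<Longrightarrow> finite {t. (j, t) \<in> H}"
  by (rule finite_subset[of _ "snd ` H"]) force+

lemma capped_pos: "constraints H \<Longrightarrow> 0 < K \<Longrightarrow> 0 < capped H K $ j"
  using finite_coordinate[of H j] by (auto simp: capped_def constraints_def Min_gr_iff)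

lemma le_capped_iff: "constraints H \<Longrightarrow> y \<le> capped H K \<longleftrightarrow> y \<in> lower_set H \<and> (\<forall>j. y $ j \<le> K)"
  using finite_coordinate[of H]
  by (auto simp: less_eq_vec_def capped_def constraints_def Min_ge_iff lower_set_def)

lemma EE_borel [measurable]: "(EE :: (real^'n::finite) set) \<in> sets borel"
proof -
  have "{x :: real^'n. \<forall>j. x $ j \<ge> 0} = (\<Inter>j. {x. x $ j \<ge> 0})" by auto
  also have "\<dots> \<in> sets borel" by (intro sets.countable_INT) auto
  finally show ?thesis unfolding EE_def by auto
qed

lemma lower_set_borel [measurable]:
  assumes "finite H" shows "lower_set H \<in> sets (borel :: (real^'n::finite) measure)"
proof -
  have "lower_set H = (\<Inter>p\<in>H. {y :: real^'n. y $ fst p \<le> snd p})" by (auto simp: lower_set_def)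
  also have "\<dots> \<in> sets borel"
  proof (cases "H = {}")
    case False then show ?thesis using assms by (intro sets.finite_INT) auto
  qed auto
  finally show ?thesis .
qed

lemma upper_set_borel [measurable]:
  assumes "finite H" shows "upper_set H \<in> sets (borel :: (real^'n::finite) measure)"
proof -
  have "upper_set H = (\<Inter>p\<in>H. {y :: real^'n. snd p < y $ fst p})" by (auto simp: upper_set_def)
  also have "\<dots> \<in> sets borel"
  proof (cases "H = {}")
    case False then show ?thesis using assms by (intro sets.finite_INT) auto
  qed auto
  finally show ?thesis .
qed

lemma cell_borel: "finite L \<Longrightarrow> finite H \<Longrightarrow> cell L H \<in> sets borel"
  unfolding cell_def by (intro sets.Int EE_borel upper_set_borel lower_set_borel)

lemma cells_borel: "A \<in> cells \<Longrightarrow> A \<in> sets borel"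
  by (auto simp: cells_def constraints_def intro: cell_borel)

lemma cell_ring_borel: "A \<in> cell_ring \<Longrightarrow> A \<in> sets borel"
  by (auto simp: cell_ring_def dest: cells_borel intro!: sets.finite_Union)

lemma cellsI: "constraints L \<Longrightarrow> constraints H \<Longrightarrow> L \<noteq> {} \<Longrightarrow> cell L H \<in> cells"
  by (auto simp: cells_def)

lemma cells_Int: "A \<in> cells \<Longrightarrow> B \<in> cells \<Longrightarrow> A \<inter> B \<in> cells"
proof -
  assume "A \<in> cells" "B \<in> cells"
  then obtain L H L' H' where A: "A = cell L H" "constraints L" "constraints H" "L \<noteq> {}"
    and B: "B = cell L' H'" "constraints L'" "constraints H'" "L' \<noteq> {}"
    by (auto simp: cells_def)
  have "A \<inter> B = cell (L \<union> L') (H \<union> H')"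
    unfolding A B by (auto simp: cell_def upper_set_def lower_set_def)
  also have "\<dots> \<in> cells" using A B by (intro cellsI) auto
  finally show ?thesis .
qed

lemma cell_ringI: "finite C \<Longrightarrow> C \<subseteq> cells \<Longrightarrow> \<Union>C \<in> cell_ring"
  by (auto simp: cell_ring_def)

lemma cells_in_ring: "A \<in> cells \<Longrightarrow> A \<in> cell_ring"
  using cell_ringI[of "{A}"] by simp

lemma cell_ring_Un: "A \<in> cell_ring \<Longrightarrow> B \<in> cell_ring \<Longrightarrow> A \<union> B \<in> cell_ring"
proof -
  assume "A \<in> cell_ring" "B \<in> cell_ring"
  then obtain C D where "finite C" "C \<subseteq> cells" "A = \<Union>C" "finite D" "D \<subseteq> cells" "B = \<Union>D"
    by (auto simp: cell_ring_def)
  then show ?thesis using cell_ringI[of "C \<union> D"] by (simp add: Union_Un_distrib)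
qed

lemma cell_ring_UN: "finite I \<Longrightarrow> (\<And>i. i \<in> I \<Longrightarrow> A i \<in> cell_ring) \<Longrightarrow> (\<Union>i\<in>I. A i) \<in> cell_ring"
proof (induction I rule: finite_induct)
  case empty show ?case using cell_ringI[of "{}"] by simp
next
  case (insert i I) then show ?case using cell_ring_Un[of "A i" "\<Union>i\<in>I. A i"] by simp
qed

text \<open>A point of \<open>A\<close> leaves \<open>B\<close> by violating one constraint of
  \<open>B\<close>; the reversed constraint is added to those of \<open>A\<close>. The lower bounds
  of \<open>A\<close> are kept, so the new pieces stay away from the origin.\<close>

lemma cell_Diff_ring: assumes "A \<in> cells" "B \<in> cells" shows "A - B \<in> cell_ring"
proof -
  obtain L H L' H' where A: "A = cell L H" "constraints L" "constraints H" "L \<noteq> {}"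
    and B: "B = cell L' H'" "constraints L'" "constraints H'" "L' \<noteq> {}"
    using assms by (auto simp: cells_def)
  have "A - B = (\<Union>p\<in>L'. cell L (insert p H)) \<union> (\<Union>p\<in>H'. cell (insert p L) H)"
    unfolding A B by (auto simp: cell_def upper_set_def lower_set_def not_less not_le)
  moreover have "\<dots> \<in> cell_ring"
    using A B
    by (intro cell_ring_Un cell_ring_UN cells_in_ring cellsI) (auto simp: constraints_def)
  ultimately show ?thesis by simp
qed

text \<open>A ring and not an algebra: its members stay away from the origin, so \<open>EE\<close>
  is not one of them.\<close>

lemma cell_ring_ring: "ring_of_sets EE (cell_ring :: (real^'n::finite) set set)"
  unfolding ring_of_sets_iff
proof (intro conjI ballI)
  show "cell_ring \<subseteq> Pow (EE :: (real^'n) set)"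
    by (auto simp: cell_ring_def cells_def cell_def)
  show "{} \<in> (cell_ring :: (real^'n) set set)" using cell_ringI[of "{}"] by simp
  fix A B :: "(real^'n) set" assume A: "A \<in> cell_ring" and B: "B \<in> cell_ring"
  then show "A \<union> B \<in> cell_ring" by (rule cell_ring_Un)
  have 1: "A - b \<in> cell_ring" if A: "A \<in> cell_ring" and b: "b \<in> cells" for A b :: "(real^'n) set"
  proof -
    obtain C where C: "finite C" "C \<subseteq> cells" "A = \<Union>C" using A by (auto simp: cell_ring_def)
    have "A - b = (\<Union>c\<in>C. c - b)" using C by auto
    moreover have "(\<Union>c\<in>C. c - b) \<in> cell_ring"
      using C b by (intro cell_ring_UN cell_Diff_ring) auto
    ultimately show ?thesis by simp
  qed
  obtain C where C: "finite C" "C \<subseteq> cells" "B = \<Union>C" using B by (auto simp: cell_ring_def)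
  have "A - \<Union>C \<in> cell_ring" using C(1,2)
  proof (induction C rule: finite_induct)
    case (insert c C)
    have "A - \<Union>(insert c C) = (A - \<Union>C) - c" by auto
    then show ?case using insert 1 by simp
  qed (use A in simp)
  then show "A - B \<in> cell_ring" using C by simp
qed

section \<open>Limits of n P(X / n \<in> A) for a fixed max-stable law\<close>

locale max_stable_law = prob_space G for G :: "(real^'n::finite) measure" +
  assumes simple: "simple_max_stable G"
begin

lemma sets_G [measurable_cong]: "sets G = sets borel"
  using simple by (simp add: simple_max_stable_def)

lemma space_G [simp]: "space G = UNIV"
  using sets_eq_imp_space_eq[OF sets_G] by simp

lemma frechet_margins: "unit_frechet_margins G"
  using simple by (simp add: simple_max_stable_def)

text \<open>Written as a preimage, which makes measurability immediate; for \<open>0 < t\<close> it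
  is the dilation of \<open>A\<close> by \<open>t\<close>.\<close>

definition scaled :: "real \<Rightarrow> (real^'n) set \<Rightarrow> (real^'n) set" where
  "scaled t A = (\<lambda>y. y /\<^sub>R t) -` A"

lemma scaled_events: "A \<in> sets borel \<Longrightarrow> scaled t A \<in> events"
  unfolding scaled_def sets_G by (intro measurable_sets_borel[where M=borel]) auto

text \<open>Max-stability is given at finite vectors. Capping one side at \<open>K\<close> and the
  dilated side at \<open>t * K\<close>, with \<open>K\<close> tending to infinity, extends it to
  unconstrained coordinates.\<close>

lemma prob_lower_scaled:
  assumes H: "constraints H" and t: "0 < t"
  shows "prob (scaled t (lower_set H)) powr t = prob (lower_set H)"
proof -
  have b: "finite H" using H by (simp add: constraints_def)
  have A: "scaled t (lower_set H) \<inter> {y. \<forall>j. y $ j \<le> t * real K} = {..t *\<^sub>R capped H (real K)}" for K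
  proof -
    have "y \<le> t *\<^sub>R capped H (real K) \<longleftrightarrow> y /\<^sub>R t \<le> capped H (real K)" for y
      using t by (simp add: less_eq_vec_def field_simps)
    then show ?thesis
      using t by (auto simp: le_capped_iff[OF H] scaled_def field_simps)
  qed
  have B: "lower_set H \<inter> {y. \<forall>j. y $ j \<le> real K} = {..capped H (real K)}" for K
    by (auto simp: le_capped_iff[OF H])
  have "(\<lambda>K::nat. prob {..t *\<^sub>R capped H (real K)} powr t) \<longlonglongrightarrow> prob (scaled t (lower_set H)) powr t"
    unfolding A[symmetric]
    by (intro tendsto_powr' measure_capped_tendsto tendsto_const)
       (use t b scaled_events sets_G prob_space_axioms in auto)
  moreover have "(\<lambda>K::nat. prob {..capped H (real K)}) \<longlonglongrightarrow> prob (lower_set H)"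
    unfolding B[symmetric]
    by (rule measure_capped_tendsto[where r=1, simplified])
       (use b sets_G prob_space_axioms in auto)
  moreover have "\<forall>\<^sub>F K in sequentially. prob {..t *\<^sub>R capped H (real K)} powr t = prob {..capped H (real K)}"
    using eventually_gt_at_top[of 0]
  proof eventually_elim
    case (elim K)
    then show ?case
      using simple t capped_pos[OF H, of "real K"] unfolding simple_max_stable_def mcdf_def by auto
  qed
  ultimately show ?thesis
    by (intro LIMSEQ_unique[OF Lim_transform_eventually]) assumption+
qed

lemma prob_coordinate: "0 < s \<Longrightarrow> prob {y. y $ j \<le> s} = exp (- 1 / s)"
  using frechet_margins cdf_margin[OF sets_G, of j s] by (simp add: unit_frechet_margins_def)

lemma prob_coordinate_nonpos: "prob {y. y $ j \<le> 0} = 0"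
  using frechet_margins cdf_margin[OF sets_G, of j 0] by (simp add: unit_frechet_margins_def)

lemma AE_pos: "AE y in G. \<forall>j. 0 < y $ j"
proof -
  have "AE y in G. 0 < y $ j" for j
    by (rule AE_I[of _ _ "{y. y $ j \<le> 0}"])
       (auto simp: emeasure_eq_measure prob_coordinate_nonpos not_less sets_G)
  then show ?thesis by (simp add: AE_all_countable)
qed

text \<open>By max-stability it is enough to find one dilation with positive probability. For a
  large factor a union bound over the margins gives the complement mass less than 1.\<close>

lemma prob_lower_pos:
  assumes H: "constraints H" shows "0 < prob (lower_set H)"
proof -
  have fin: "finite H" using H by (simp add: constraints_def)
  have "((\<lambda>n. \<Sum>p\<in>H. 1 - exp (- (inverse (snd p) * inverse (real (Suc n))))) \<longlonglongrightarrow> (\<Sum>p\<in>H. 1 - exp (- (inverse (snd p) * 0))))"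
    by (intro tendsto_intros LIMSEQ_inverse_real_of_nat)
  then have "((\<lambda>n. \<Sum>p\<in>H. 1 - exp (- (inverse (snd p) * inverse (real (Suc n))))) \<longlonglongrightarrow> 0)" by simp
  from order_tendstoD(2)[OF this, of 1] obtain n :: nat where
    n: "(\<Sum>p\<in>H. 1 - exp (- (inverse (snd p) * inverse (real (Suc n))))) < 1"
    by (auto simp: eventually_sequentially)
  let ?t = "real (Suc n)"
  have "prob (UNIV - scaled ?t (lower_set H)) \<le> prob (\<Union>p\<in>H. UNIV - {y. y $ fst p \<le> ?t * snd p})"
  proof (rule finite_measure_mono)
    show "(\<Union>p\<in>H. UNIV - {y. y $ fst p \<le> ?t * snd p}) \<in> events"
      using fin unfolding sets_G by (intro sets.finite_UN sets.Diff) auto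
  qed (auto simp: scaled_def lower_set_def field_simps simp del: of_nat_Suc)
  also have "\<dots> \<le> (\<Sum>p\<in>H. prob (UNIV - {y. y $ fst p \<le> ?t * snd p}))"
    using fin by (intro measure_UNION_le) (auto simp: sets_G)
  also have "\<dots> = (\<Sum>p\<in>H. 1 - exp (- (inverse (snd p) * inverse ?t)))"
  proof (rule sum.cong[OF refl])
    fix p assume "p \<in> H"
    then have "0 < snd p" using H by (simp add: constraints_def)
    then show "prob (UNIV - {y. y $ fst p \<le> ?t * snd p}) = 1 - exp (- (inverse (snd p) * inverse ?t))"
      using prob_compl[of "{y. y $ fst p \<le> ?t * snd p}"]
      by (simp add: prob_coordinate sets_G field_simps del: of_nat_Suc)
  qed
  finally have "prob (UNIV - scaled ?t (lower_set H)) < 1" using n by linarith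
  then have "0 < prob (scaled ?t (lower_set H))"
    using prob_compl[OF scaled_events[OF lower_set_borel[OF fin]], of ?t] by simp
  then show ?thesis using prob_lower_scaled[OF H, of ?t] by (metis of_nat_0_less_iff powr_gt_zero zero_less_Suc less_irrefl)
qed

definition scaled_measure :: "nat \<Rightarrow> (real^'n) set \<Rightarrow> real" where
  "scaled_measure n A = real (Suc n) * prob (scaled (real (Suc n)) A)"

text \<open>\<open>lim\<close> is informative only where the sequence converges, which
  \<open>cell_ring_convergent\<close> supplies on \<open>cell_ring\<close>.\<close>

definition limit_measure :: "(real^'n) set \<Rightarrow> real" where
  "limit_measure A = lim (\<lambda>n. scaled_measure n A)"

text \<open>With p the probability of \<open>lower_set H\<close> and h = 1 / (n + 1), max-stability
  turns the sequence into the difference quotient (1 - exp (h ln p)) / h at 0. Taking ln p is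
  legitimate by \<open>prob_lower_pos\<close>.\<close>

lemma lower_tendsto:
  assumes H: "constraints H"
  shows "(\<lambda>n. real (Suc n) * (1 - prob (scaled (real (Suc n)) (lower_set H)))) \<longlonglongrightarrow> - ln (prob (lower_set H))"
proof -
  let ?c = "ln (prob (lower_set H))"
  have "((\<lambda>h. 1 - exp (?c * h)) has_real_derivative - ?c) (at 0)"
    by (auto intro!: derivative_eq_intros)
  then have "((\<lambda>h. (1 - exp (?c * h)) / h) \<longlongrightarrow> - ?c) (at 0)"
    by (simp add: has_field_derivative_iff)
  moreover have "filterlim (\<lambda>n. inverse (real (Suc n))) (at 0) sequentially"
    by (intro filterlim_atI LIMSEQ_inverse_real_of_nat) auto
  ultimately have "(\<lambda>n. (1 - exp (?c * inverse (real (Suc n)))) / inverse (real (Suc n))) \<longlonglongrightarrow> - ?c"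
    by (rule filterlim_compose)
  moreover have "prob (scaled (real (Suc n)) (lower_set H)) = exp (?c * inverse (real (Suc n)))" for n
  proof -
    have "prob (lower_set H) powr inverse (real (Suc n)) = prob (scaled (real (Suc n)) (lower_set H))"
      by (subst prob_lower_scaled[OF H, of "real (Suc n)", symmetric]) (simp_all add: powr_powr del: of_nat_Suc)
    then show ?thesis using prob_lower_pos[OF H] by (simp add: powr_def mult.commute)
  qed
  ultimately show ?thesis by (simp add: field_simps del: of_nat_Suc)
qed

text \<open>\<open>G\<close> lives on the open positive orthant, so restricting to \<open>EE\<close>
  is free for each n, even though the limit may charge the boundary faces.\<close>

lemma scaled_measure_Int_EE:
  assumes "A \<in> sets borel" shows "scaled_measure n (EE \<inter> A) = scaled_measure n A"
proof -
  have "AE y in G. y \<in> scaled (real (Suc n)) EE"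
    using AE_pos
  proof (rule eventually_mono)
    fix y :: "real^'n" assume y: "\<forall>j. 0 < y $ j"
    then have "0 < (y /\<^sub>R real (Suc n)) $ j" for j by simp
    then have "y /\<^sub>R real (Suc n) \<noteq> 0" "\<forall>j. 0 \<le> (y /\<^sub>R real (Suc n)) $ j"
      by (metis less_irrefl zero_index, blast intro: less_imp_le)
    then show "y \<in> scaled (real (Suc n)) EE" by (simp add: scaled_def EE_def)
  qed
  then have "prob (scaled (real (Suc n)) (EE \<inter> A)) = prob (scaled (real (Suc n)) A)"
    using assms by (intro measure_eq_AE scaled_events) (auto simp: scaled_def elim!: eventually_mono)
  then show ?thesis by (simp add: scaled_measure_def)
qed

lemma scaled_measure_Diff:
  assumes "A \<in> sets borel" "B \<in> sets borel" "B \<subseteq> A"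
  shows "scaled_measure n (A - B) = scaled_measure n A - scaled_measure n B"
proof -
  have "scaled t (A - B) = scaled t A - scaled t B" "scaled t B \<subseteq> scaled t A" for t
    using assms by (auto simp: scaled_def)
  then show ?thesis
    using finite_measure_Diff[OF scaled_events[OF assms(1)] scaled_events[OF assms(2)]]
    by (simp only: scaled_measure_def right_diff_distrib)
qed

lemma scaled_measure_Un:
  assumes "A \<in> sets borel" "B \<in> sets borel" "A \<inter> B = {}"
  shows "scaled_measure n (A \<union> B) = scaled_measure n A + scaled_measure n B"
  using scaled_measure_Diff[of "A \<union> B" B n] assms by (simp add: Un_Diff Diff_triv)

lemma scaled_measure_Un_Int:
  assumes "A \<in> sets borel" "B \<in> sets borel"
  shows "scaled_measure n (A \<union> B) = scaled_measure n A + scaled_measure n B - scaled_measure n (A \<inter> B)"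
proof -
  have "A \<union> B = A \<union> (B - A \<inter> B)" "A \<inter> (B - A \<inter> B) = {}" by auto
  then show ?thesis using scaled_measure_Un[of A "B - A \<inter> B" n] scaled_measure_Diff[of B "A \<inter> B" n] assms
    by (metis add_diff_eq inf_le2 sets.Diff sets.Int)
qed

text \<open>A lower bound is removed by subtracting the set with the reversed bound, so induction on
  \<open>L\<close> ends at lower sets. The scaled mass of a single lower set diverges; only
  differences converge, which is why the base case has one lower bound and pairs two
  complements.\<close>

lemma scaled_measure_upper_lower_convergent:
  assumes "constraints L" "L \<noteq> {}" "constraints H"
  shows "convergent (\<lambda>n. scaled_measure n (upper_set L \<inter> lower_set H))"
proof -
  have "finite L" using assms by (simp add: constraints_def)
  from this assms(2,1,3) show ?thesis
  proof (induction L arbitrary: H rule: finite_ne_induct)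
    case (singleton p)
    then have H: "constraints (insert p H)" by simp
    have fin: "finite H" using singleton by (simp add: constraints_def)
    have "scaled_measure n (upper_set {p} \<inter> lower_set H) =
      real (Suc n) * (1 - prob (scaled (real (Suc n)) (lower_set (insert p H)))) -
      real (Suc n) * (1 - prob (scaled (real (Suc n)) (lower_set H)))" for n
    proof -
      have "upper_set {p} \<inter> lower_set H = lower_set H - lower_set (insert p H)"
        by (auto simp: upper_set_def lower_set_def)
      moreover have "lower_set (insert p H) \<subseteq> lower_set H" by (auto simp: lower_set_def)
      ultimately have "scaled_measure n (upper_set {p} \<inter> lower_set H) =
          scaled_measure n (lower_set H) - scaled_measure n (lower_set (insert p H))"
        using fin by (simp add: scaled_measure_Diff lower_set_borel)
      then show ?thesis by (simp add: scaled_measure_def right_diff_distrib del: of_nat_Suc)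
    qed
    then show ?case
      using tendsto_diff[OF lower_tendsto[OF H] lower_tendsto[OF \<open>constraints H\<close>]]
      by (auto simp: convergent_def)
  next
    case (insert p L)
    then have H: "constraints (insert p H)" by simp
    have fin: "finite H" using insert by (simp add: constraints_def)
    have "upper_set (insert p L) \<inter> lower_set H = upper_set L \<inter> lower_set H - upper_set L \<inter> lower_set (insert p H)"
      by (auto simp: upper_set_def lower_set_def)
    moreover have "upper_set L \<inter> lower_set (insert p H) \<subseteq> upper_set L \<inter> lower_set H"
      by (auto simp: lower_set_def)
    ultimately have "scaled_measure n (upper_set (insert p L) \<inter> lower_set H) =
      scaled_measure n (upper_set L \<inter> lower_set H) - scaled_measure n (upper_set L \<inter> lower_set (insert p H))" for n
      using fin \<open>finite L\<close> by (simp add: scaled_measure_Diff lower_set_borel upper_set_borel)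
    then show ?case
      using convergent_diff[OF insert.IH[of H] insert.IH[of "insert p H"]] insert.prems H by simp
  qed
qed

lemma cells_convergent:
  assumes "A \<in> cells" shows "convergent (\<lambda>n. scaled_measure n A)"
proof -
  obtain L H where A: "A = cell L H" "constraints L" "constraints H" "L \<noteq> {}"
    using assms by (auto simp: cells_def)
  then have "finite L" "finite H" by (auto simp: constraints_def)
  then show ?thesis
    using scaled_measure_upper_lower_convergent[OF A(2,4,3)] unfolding A(1) cell_def Int_assoc
    by (subst scaled_measure_Int_EE) (auto simp: lower_set_borel upper_set_borel)
qed

lemma cell_ring_convergent:
  assumes "A \<in> cell_ring" shows "convergent (\<lambda>n. scaled_measure n A)"
proof -
  obtain C where C: "finite C" "C \<subseteq> cells" "A = \<Union>C" using assms by (auto simp: cell_ring_def)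
  \<comment> \<open>Inclusion-exclusion with one cell \<open>c\<close> split off. The induction runs
    over a bound on the cardinality because it is applied both to the remaining cells and to their
    traces on \<open>c\<close>, which may coincide.\<close>
  have "convergent (\<lambda>n. scaled_measure n (\<Union>C))" if "card C \<le> k" "finite C" "C \<subseteq> cells" for k C
    using that
  proof (induction k arbitrary: C)
    case 0 then show ?case by (simp add: scaled_measure_def scaled_def convergent_const)
  next
    case (Suc k)
    show ?case
    proof (cases "C = {}")
      case False
      then obtain c where "c \<in> C" by blast
      define D where "D = C - {c}"
      have C: "C = insert c D" "finite D" "D \<subseteq> cells" "c \<in> cells" "card D \<le> k"
        using Suc.prems \<open>c \<in> C\<close> by (auto simp: D_def)
      let ?D = "(\<lambda>d. d \<inter> c) ` D"
      have "card ?D \<le> k" using card_image_le[OF C(2), of "\<lambda>d. d \<inter> c"] C(5) by simp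
      moreover have "?D \<subseteq> cells" using C cells_Int by auto
      ultimately have "convergent (\<lambda>n. scaled_measure n (\<Union>?D))"
        using Suc.IH[of ?D] C(2) by blast
      moreover have "convergent (\<lambda>n. scaled_measure n (\<Union>D))" using Suc.IH[of D] C by blast
      ultimately have "convergent (\<lambda>n. scaled_measure n (\<Union>D) + scaled_measure n c - scaled_measure n (\<Union>?D))"
        using cells_convergent[OF C(4)] by (intro convergent_diff convergent_add)
      moreover have "\<Union>?D = \<Union>D \<inter> c" by auto
      moreover have "\<Union>D \<in> sets borel" "c \<in> sets borel" using C cells_borel by (auto intro: sets.finite_Union)
      moreover have "\<Union>C = \<Union>D \<union> c" using C by auto
      ultimately show ?thesis by (simp add: scaled_measure_Un_Int)
    qed (simp add: scaled_measure_def scaled_def convergent_const)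
  qed
  from this[OF order_refl C(1,2)] show ?thesis using C by simp
qed

lemma limit_measure_tendsto: "A \<in> cell_ring \<Longrightarrow> (\<lambda>n. scaled_measure n A) \<longlonglongrightarrow> limit_measure A"
  unfolding limit_measure_def using cell_ring_convergent convergent_LIMSEQ_iff by blast

lemma limit_measure_nonneg: "A \<in> cell_ring \<Longrightarrow> 0 \<le> limit_measure A"
  by (rule LIMSEQ_le_const[OF limit_measure_tendsto]) (auto simp: scaled_measure_def)

lemma limit_measure_empty [simp]: "limit_measure {} = 0"
  by (simp add: limit_measure_def scaled_measure_def scaled_def)

lemma limit_measure_Un:
  assumes "A \<in> cell_ring" "B \<in> cell_ring" "A \<inter> B = {}"
  shows "limit_measure (A \<union> B) = limit_measure A + limit_measure B"
proof (rule LIMSEQ_unique[OF limit_measure_tendsto])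
  show "A \<union> B \<in> cell_ring" using assms cell_ring_Un by blast
  show "(\<lambda>n. scaled_measure n (A \<union> B)) \<longlonglongrightarrow> limit_measure A + limit_measure B"
    using tendsto_add[OF limit_measure_tendsto[OF assms(1)] limit_measure_tendsto[OF assms(2)]]
    by (simp add: scaled_measure_Un assms cell_ring_borel)
qed

sublocale ring: ring_of_sets EE "cell_ring :: (real^'n) set set"
  by (rule cell_ring_ring)

lemma limit_measure_mono:
  assumes "A \<in> cell_ring" "B \<in> cell_ring" "A \<subseteq> B"
  shows "limit_measure A \<le> limit_measure B"
proof -
  have "B = A \<union> (B - A)" using assms by auto
  then have "limit_measure B = limit_measure A + limit_measure (B - A)"
    using limit_measure_Un[of A "B - A"] assms by auto
  then show ?thesis using limit_measure_nonneg[of "B - A"] assms by auto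
qed

lemma limit_measure_Un_le:
  assumes "A \<in> cell_ring" "B \<in> cell_ring"
  shows "limit_measure (A \<union> B) \<le> limit_measure A + limit_measure B"
proof -
  have "limit_measure (A \<union> (B - A)) = limit_measure A + limit_measure (B - A)"
    using assms by (intro limit_measure_Un) auto
  moreover have "limit_measure (B - A) \<le> limit_measure B" using assms by (intro limit_measure_mono) auto
  ultimately show ?thesis by simp
qed

lemma limit_measure_UN_le:
  assumes "finite I" "\<And>i. i \<in> I \<Longrightarrow> A i \<in> cell_ring"
  shows "limit_measure (\<Union>i\<in>I. A i) \<le> (\<Sum>i\<in>I. limit_measure (A i))"
  using assms
proof (induction I rule: finite_induct)
  case (insert i I)
  have U: "(\<Union>i\<in>I. A i) \<in> cell_ring" using insert by (intro cell_ring_UN) auto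
  show ?case using limit_measure_Un_le[OF _ U, of "A i"] insert by simp
qed simp

lemma limit_measure_upper:
  assumes "constraints H" "H \<noteq> {}"
  shows "EE - lower_set H \<in> cell_ring" "limit_measure (EE - lower_set H) = - ln (prob (lower_set H))"
proof -
  have fin: "finite H" using assms by (simp add: constraints_def)
  have "EE - lower_set H = (\<Union>p\<in>H. cell {p} {})"
    by (auto simp: cell_def lower_set_def upper_set_def not_le)
  also have "\<dots> \<in> cell_ring"
    using assms fin by (intro cell_ring_UN cells_in_ring cellsI) (auto simp: constraints_def)
  finally show R: "EE - lower_set H \<in> cell_ring" .
  have "scaled_measure n (EE - lower_set H) = real (Suc n) * (1 - prob (scaled (real (Suc n)) (lower_set H)))" for n
  proof -
    have "scaled_measure n (EE - lower_set H) = scaled_measure n (EE \<inter> (UNIV - lower_set H))"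
      by (simp add: Diff_eq)
    also have "\<dots> = scaled_measure n (UNIV - lower_set H)"
      using fin by (intro scaled_measure_Int_EE) (auto simp: lower_set_borel)
    also have "\<dots> = scaled_measure n UNIV - scaled_measure n (lower_set H)"
      using fin by (intro scaled_measure_Diff) (auto simp: lower_set_borel)
    also have "scaled_measure n UNIV = real (Suc n)"
      using prob_space by (simp add: scaled_measure_def scaled_def)
    finally show ?thesis by (simp add: scaled_measure_def algebra_simps)
  qed
  then show "limit_measure (EE - lower_set H) = - ln (prob (lower_set H))"
    using LIMSEQ_unique[OF limit_measure_tendsto[OF R]] lower_tendsto[OF assms(1)] by auto
qed

lemma limit_measure_coordinate:
  assumes "0 < s"
  shows "cell {(j, s)} {} \<in> cell_ring" "limit_measure (cell {(j, s)} {}) = 1 / s"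
proof -
  have "cell {(j, s)} {} = EE - lower_set {(j, s)}"
    by (auto simp: cell_def lower_set_def upper_set_def not_le)
  then show "cell {(j, s)} {} \<in> cell_ring" "limit_measure (cell {(j, s)} {}) = 1 / s"
    using limit_measure_upper[of "{(j, s)}"] assms by (auto simp: lower_set_def prob_coordinate)
qed

lemma limit_measure_strip:
  assumes "0 < s" "s \<le> s'"
  shows "cell {(j, s)} {(j, s')} \<in> cell_ring" "limit_measure (cell {(j, s)} {(j, s')}) = 1 / s - 1 / s'"
proof -
  show R: "cell {(j, s)} {(j, s')} \<in> cell_ring"
    using assms by (intro cells_in_ring cellsI) auto
  have "cell {(j, s)} {} = cell {(j, s)} {(j, s')} \<union> cell {(j, s')} {}"
    using assms by (auto simp: cell_def upper_set_def lower_set_def)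
  moreover have "cell {(j, s)} {(j, s')} \<inter> cell {(j, s')} {} = {}"
    by (auto simp: cell_def upper_set_def lower_set_def)
  ultimately have "limit_measure (cell {(j, s)} {}) = limit_measure (cell {(j, s)} {(j, s')}) + limit_measure (cell {(j, s')} {})"
    using limit_measure_Un[OF R, of "cell {(j, s')} {}"] limit_measure_coordinate[of s' j] assms by simp
  then show "limit_measure (cell {(j, s)} {(j, s')}) = 1 / s - 1 / s'"
    using limit_measure_coordinate(2) assms by simp
qed

text \<open>Raising each lower bound by d and capping each coordinate at 1 / d shrinks the cell to
  \<open>?B\<close>, and a compact set fits between the two. The caps lose little because the mass
  above 1 / d in a coordinate is d: this is where the Frechet margins prevent mass from sitting at
  infinity.\<close>

lemma cell_inner_approx:
  assumes A: "A \<in> cells" and e: "0 < e"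
  shows "\<exists>B\<in>cell_ring. \<exists>K. compact K \<and> B \<subseteq> K \<and> K \<subseteq> A \<and> limit_measure (A - B) \<le> e"
proof -
  obtain L H where L: "A = cell L H" "constraints L" "constraints H" "L \<noteq> {}"
    using A by (auto simp: cells_def)
  have fin: "finite L" "finite H" using L by (auto simp: constraints_def)
  \<comment> \<open>The first sum is the mass of the strips lost at the lower bounds, the second
    that of the tails cut off by the caps.\<close>
  let ?err = "\<lambda>d. (\<Sum>p\<in>L. 1 / snd p - 1 / (snd p + d)) + (\<Sum>j\<in>(UNIV::'n set). d)"
  have "(?err \<longlongrightarrow> (\<Sum>p\<in>L. 1 / snd p - 1 / (snd p + 0)) + (\<Sum>j\<in>(UNIV::'n set). 0)) (at_right 0)"
    using L by (intro tendsto_intros) (auto simp: constraints_def)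
  then have "(?err \<longlongrightarrow> 0) (at_right 0)" by simp
  then have "\<forall>\<^sub>F d in at_right 0. ?err d < e \<and> 0 < d"
    using e by (intro eventually_conj order_tendstoD eventually_at_right_less) auto
  then obtain d where d: "?err d < e" "0 < d"
    by (metis (no_types, lifting) eventually_happens trivial_limit_at_right_real)
  let ?L = "(\<lambda>p. (fst p, snd p + d)) ` L"
  let ?H = "H \<union> (\<lambda>j. (j, 1/d)) ` UNIV"
  let ?B = "cell ?L ?H"
  \<comment> \<open>Weak inequalities make the set closed; the margin \<open>d\<close> still keeps
    it within the strict lower bounds of \<open>A\<close>, and hence away from 0.\<close>
  let ?K = "{x. (\<forall>j. 0 \<le> x $ j) \<and> (\<forall>p\<in>L. snd p + d \<le> x $ fst p) \<and> (\<forall>p\<in>H. x $ fst p \<le> snd p) \<and> (\<forall>j. x $ j \<le> 1/d)}"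
  have B: "?B \<in> cell_ring"
    using L d fin by (intro cells_in_ring cellsI) (auto simp: constraints_def intro!: add_pos_pos)
  have "closed ?K"
    unfolding Ball_def
    by (intro closed_Collect_conj closed_Collect_all closed_Collect_imp open_Collect_const closed_Collect_le continuous_intros)
  moreover have "?K \<subseteq> cbox 0 (\<chi> j. 1/d)" by (auto simp: mem_box_cart)
  ultimately have "compact ?K"
    by (meson bounded_cbox bounded_subset compact_eq_bounded_closed)
  moreover have "?B \<subseteq> ?K"
  proof
    fix x assume x: "x \<in> ?B"
    then have H: "\<And>p. p \<in> ?H \<Longrightarrow> x $ fst p \<le> snd p" by (auto simp: cell_def lower_set_def)
    have "x $ j \<le> 1/d" for j using H[of "(j, 1/d)"] by simp
    then show "x \<in> ?K" using x H by (auto simp: cell_def upper_set_def EE_def intro: less_imp_le)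
  qed
  moreover have "?K \<subseteq> A"
  proof
    fix x assume x: "x \<in> ?K"
    obtain p where p: "p \<in> L" using L by blast
    then have "0 < x $ fst p" using x d L by (force simp: constraints_def)
    then have "x \<noteq> 0" by auto
    moreover have "snd p < x $ fst p" if "p \<in> L" for p using x d that by fastforce
    ultimately show "x \<in> A" using x by (simp add: L(1) cell_def upper_set_def lower_set_def EE_def)
  qed
  moreover have "limit_measure (A - ?B) \<le> e"
  proof -
    let ?S = "\<lambda>p. cell {p} {(fst p, snd p + d)}" and ?T = "\<lambda>j. cell {(j, 1/d)} {}"
    have S: "?S p \<in> cell_ring" "limit_measure (?S p) = 1 / snd p - 1 / (snd p + d)" if "p \<in> L" for p
      using limit_measure_strip[of "snd p" "snd p + d" "fst p"] that d L by (auto simp: constraints_def)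
    have T: "?T j \<in> cell_ring" "limit_measure (?T j) = d" for j
      using limit_measure_coordinate[of "1/d" j] d by auto
    have U: "(\<Union>p\<in>L. ?S p) \<in> cell_ring" "(\<Union>j::'n. ?T j) \<in> cell_ring"
      using S(1) T(1) fin by (simp_all add: cell_ring_UN)
    have "A - ?B \<subseteq> (\<Union>p\<in>L. ?S p) \<union> (\<Union>j::'n. ?T j)"
      unfolding L(1) by (auto simp: cell_def upper_set_def lower_set_def not_less not_le)
    then have "limit_measure (A - ?B) \<le> limit_measure ((\<Union>p\<in>L. ?S p) \<union> (\<Union>j::'n. ?T j))"
      using cells_in_ring[OF A] B U by (intro limit_measure_mono ring.Diff cell_ring_Un) simp_all
    also have "\<dots> \<le> limit_measure (\<Union>p\<in>L. ?S p) + limit_measure (\<Union>j::'n. ?T j)"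
      by (rule limit_measure_Un_le[OF U])
    also have "\<dots> \<le> (\<Sum>p\<in>L. limit_measure (?S p)) + (\<Sum>j\<in>UNIV. limit_measure (?T j))"
      using S T fin by (intro add_mono limit_measure_UN_le) auto
    also have "\<dots> = ?err d" using S T by simp
    finally show ?thesis using d by simp
  qed
  ultimately show ?thesis using B by blast
qed

lemma ring_inner_approx:
  assumes A: "A \<in> cell_ring" and e: "0 < e"
  shows "\<exists>B\<in>cell_ring. \<exists>K. compact K \<and> B \<subseteq> K \<and> K \<subseteq> A \<and> limit_measure (A - B) \<le> e"
proof -
  obtain C where C: "finite C" "C \<subseteq> cells" "A = \<Union>C" using A by (auto simp: cell_ring_def)
  \<comment> \<open>The added 1 covers the case of no cells.\<close>
  define d where "d = e / (real (card C) + 1)"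
  have d: "0 < d" using e by (simp add: d_def)
  have "\<forall>c\<in>C. \<exists>B K. B \<in> cell_ring \<and> compact K \<and> B \<subseteq> K \<and> K \<subseteq> c \<and> limit_measure (c - B) \<le> d"
  proof
    fix c assume "c \<in> C"
    then have "c \<in> cells" using C by blast
    from cell_inner_approx[OF this d]
    show "\<exists>B K. B \<in> cell_ring \<and> compact K \<and> B \<subseteq> K \<and> K \<subseteq> c \<and> limit_measure (c - B) \<le> d" by blast
  qed
  then obtain B K where BK: "\<And>c. c \<in> C \<Longrightarrow> B c \<in> cell_ring \<and> compact (K c) \<and> B c \<subseteq> K c \<and> K c \<subseteq> c \<and> limit_measure (c - B c) \<le> d"
    by metis
  have c: "c \<in> cell_ring" if "c \<in> C" for c using that C cells_in_ring by blast
  have BR: "(\<Union>c\<in>C. B c) \<in> cell_ring" using BK C by (intro cell_ring_UN) auto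
  have "limit_measure (A - (\<Union>c\<in>C. B c)) \<le> limit_measure (\<Union>c\<in>C. c - B c)"
    using C BK BR A c by (intro limit_measure_mono cell_ring_UN) auto
  also have "\<dots> \<le> (\<Sum>c\<in>C. limit_measure (c - B c))"
    using C BK c by (intro limit_measure_UN_le) auto
  also have "\<dots> \<le> (\<Sum>c\<in>C. d)" using BK by (intro sum_mono) auto
  also have "\<dots> \<le> e" using e by (simp add: d_def field_simps)
  finally have "limit_measure (A - (\<Union>c\<in>C. B c)) \<le> e" .
  moreover have "compact (\<Union>c\<in>C. K c)" using C BK by (intro compact_UN) auto
  moreover have "(\<Union>c\<in>C. B c) \<subseteq> (\<Union>c\<in>C. K c)" "(\<Union>c\<in>C. K c) \<subseteq> A" using C BK by blast+
  ultimately show ?thesis using BR by blast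
qed

text \<open>Countable additivity comes from compactness. If the masses stayed above some e > 0, each
  \<open>A i\<close> could be shrunk to a compact \<open>K i\<close> at a total loss below e; then
  no finite intersection of the \<open>K i\<close> is empty, and nested compact sets would put a
  point into the empty intersection of the \<open>A i\<close>.\<close>

lemma limit_measure_empty_continuous:
  assumes A: "range A \<subseteq> cell_ring" "decseq A" "(\<Inter>i. A i) = {}"
  shows "(\<lambda>i. limit_measure (A i)) \<longlonglongrightarrow> 0"
proof (rule ccontr)
  assume not0: "\<not> (\<lambda>i. limit_measure (A i)) \<longlonglongrightarrow> 0"
  have AR: "A i \<in> cell_ring" for i using A by auto
  have dec: "limit_measure (A j) \<le> limit_measure (A i)" if "i \<le> j" for i j
    using A(2) that by (intro limit_measure_mono AR) (auto simp: decseq_def)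
  have "\<exists>e>0. \<forall>i. e \<le> limit_measure (A i)"
  proof (rule ccontr)
    assume "\<not> ?thesis"
    then have small: "\<exists>i. limit_measure (A i) < e" if "0 < e" for e using that by (meson not_le)
    have "(\<lambda>i. limit_measure (A i)) \<longlonglongrightarrow> 0"
    proof (rule LIMSEQ_I)
      fix e :: real assume "0 < e"
      then obtain i where "limit_measure (A i) < e" using small by blast
      then show "\<exists>N. \<forall>n\<ge>N. norm (limit_measure (A n) - 0) < e"
        using dec limit_measure_nonneg[OF AR] by (intro exI[of _ i]) (auto intro: le_less_trans)
    qed
    then show False using not0 by simp
  qed
  then obtain e where e: "0 < e" "\<And>i. e \<le> limit_measure (A i)" by blast
  \<comment> \<open>The allowances add up to at most e / 2, strictly less than the mass
    \<open>e\<close> that every \<open>A n\<close> retains.\<close>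
  have "\<forall>i. \<exists>B K. B \<in> cell_ring \<and> compact K \<and> B \<subseteq> K \<and> K \<subseteq> A i \<and> limit_measure (A i - B) \<le> e / 4 * (1/2)^i"
  proof
    fix i
    have "0 < e / 4 * (1/2)^i" using e by simp
    from ring_inner_approx[OF AR[of i] this]
    show "\<exists>B K. B \<in> cell_ring \<and> compact K \<and> B \<subseteq> K \<and> K \<subseteq> A i \<and> limit_measure (A i - B) \<le> e / 4 * (1/2)^i"
      by blast
  qed
  then obtain B K where BK: "\<And>i. B i \<in> cell_ring \<and> compact (K i) \<and> B i \<subseteq> K i \<and> K i \<subseteq> A i \<and> limit_measure (A i - B i) \<le> e / 4 * (1/2)^i"
    by metis
  have ne: "(\<Inter>i\<le>n. K i) \<noteq> {}" for n
  proof -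
    \<comment> \<open>A point of \<open>A n\<close> outside all losses lies in \<open>A i\<close>
      for every i \<le> n, since the sets decrease, hence in \<open>B i\<close> and in
      \<open>K i\<close>.\<close>
    have "\<not> A n \<subseteq> (\<Union>i\<le>n. A i - B i)"
    proof
      assume "A n \<subseteq> (\<Union>i\<le>n. A i - B i)"
      then have "limit_measure (A n) \<le> limit_measure (\<Union>i\<le>n. A i - B i)"
        using AR BK by (intro limit_measure_mono cell_ring_UN) auto
      also have "\<dots> \<le> (\<Sum>i\<le>n. limit_measure (A i - B i))"
        using AR BK by (intro limit_measure_UN_le) auto
      also have "\<dots> \<le> (\<Sum>i\<le>n. e / 4 * (1/2)^i)" using BK by (intro sum_mono) auto
      also have "\<dots> \<le> e / 2"
      proof -
        have "(\<Sum>i\<le>n. (1/2::real)^i) \<le> 2" by (subst sum_gp0) (auto simp: field_simps)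
        then have "e / 4 * (\<Sum>i\<le>n. (1/2::real)^i) \<le> e / 4 * 2" using e(1) by (intro mult_left_mono) auto
        moreover have "(\<Sum>i\<le>n. e / 4 * (1/2)^i) = e / 4 * (\<Sum>i\<le>n. (1/2::real)^i)"
          by (rule sum_distrib_left[symmetric])
        ultimately show ?thesis by linarith
      qed
      finally show False using e(1) e(2)[of n] by simp
    qed
    then obtain x where "x \<in> A n" "\<forall>i\<le>n. x \<notin> A i - B i" by auto
    moreover have "x \<in> A i" if "i \<le> n" for i using \<open>x \<in> A n\<close> A(2) that by (auto simp: decseq_def)
    ultimately have "x \<in> (\<Inter>i\<le>n. K i)" using BK by blast
    then show ?thesis by blast
  qed
  have "(\<Inter>n. \<Inter>i\<le>n. K i) \<noteq> {}"
  proof (rule compact_nest)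
    fix n
    have "compact (K 0 \<inter> (\<Inter>i\<le>n. K i))"
      using BK by (intro compact_Int_closed closed_INT) (auto intro: compact_imp_closed)
    also have "K 0 \<inter> (\<Inter>i\<le>n. K i) = (\<Inter>i\<le>n. K i)" by auto
    finally show "compact (\<Inter>i\<le>n. K i)" .
  next
    show "(\<Inter>i\<le>n. K i) \<subseteq> (\<Inter>i\<le>m. K i)" if "m \<le> n" for m n using that by auto
  qed (use ne in auto)
  moreover have "(\<Inter>n. \<Inter>i\<le>n. K i) \<subseteq> (\<Inter>i. A i)"
  proof
    fix x assume "x \<in> (\<Inter>n. \<Inter>i\<le>n. K i)"
    then have "x \<in> K i" for i by auto
    then show "x \<in> (\<Inter>i. A i)" using BK by (meson INT_I subsetD)
  qed
  ultimately show False using A(3) by simp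
qed

lemma exists_limit_measure:
  "\<exists>\<mu>. sets \<mu> = sigma_sets EE cell_ring \<and> space \<mu> = EE \<and> (\<forall>A\<in>cell_ring. emeasure \<mu> A = ennreal (limit_measure A))"
proof -
  have "\<exists>\<mu> :: (real^'n) set \<Rightarrow> ennreal. (\<forall>A\<in>cell_ring. \<mu> A = ennreal (limit_measure A)) \<and> measure_space EE (sigma_sets EE cell_ring) \<mu>"
  proof (rule ring.caratheodory_empty_continuous)
    show "positive cell_ring (\<lambda>A. ennreal (limit_measure A))" by (simp add: positive_def)
    show "additive cell_ring (\<lambda>A. ennreal (limit_measure A))"
      unfolding additive_def by (auto simp: limit_measure_Un ennreal_plus limit_measure_nonneg)
    show "(\<lambda>i. ennreal (limit_measure (A i))) \<longlonglongrightarrow> 0"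
      if "range A \<subseteq> cell_ring" "decseq A" "(\<Inter>i. A i) = {}" for A
      using tendsto_ennrealI[OF limit_measure_empty_continuous[OF that]] by simp
  qed auto
  then obtain m :: "(real^'n) set \<Rightarrow> ennreal" where m: "\<forall>A\<in>cell_ring. m A = ennreal (limit_measure A)"
    "measure_space EE (sigma_sets EE cell_ring) m" by blast
  have "A \<subseteq> EE" if "A \<in> sigma_sets EE cell_ring" for A :: "(real^'n) set"
    using sigma_sets_into_sp[OF ring.space_closed that] .
  then have P: "sigma_sets EE cell_ring \<subseteq> Pow (EE :: (real^'n) set)" by blast
  let ?M = "measure_of EE (sigma_sets EE cell_ring) m"
  have "sets ?M = sigma_sets EE cell_ring" using P
    by (simp add: sets_measure_of sigma_sets_sigma_sets_eq[OF ring.space_closed])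
  moreover have "space ?M = EE" using P by (simp add: space_measure_of)
  moreover have "emeasure ?M A = ennreal (limit_measure A)" if "A \<in> cell_ring" for A
  proof -
    have "emeasure ?M A = m A"
      using m(2) that by (intro emeasure_measure_of_sigma) (auto simp: measure_space_def)
    then show ?thesis using m that by simp
  qed
  ultimately show ?thesis by blast
qed

end

section \<open>The exponent measure\<close>

lemma cells_sets: "A \<in> cells \<Longrightarrow> A \<in> sets (restrict_space borel EE)"
  by (auto simp: sets_restrict_space_iff cells_borel) (auto simp: cells_def cell_def)

text \<open>Cells know positive thresholds only. Threshold 0 is reached as a countable union over 1
  / (n + 1), negative thresholds are void on \<open>EE\<close>, and complements then yield the
  orthants that generate the Borel sets.\<close>

lemma sigma_sets_cells: "sigma_sets EE cells = sets (restrict_space borel (EE :: (real^'n::finite) set))"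
proof
  show "sigma_sets EE cells \<subseteq> sets (restrict_space borel (EE :: (real^'n) set))"
  proof (rule sets.sigma_sets_subset')
    show "cells \<subseteq> sets (restrict_space borel (EE :: (real^'n) set))" using cells_sets by blast
    show "EE \<in> sets (restrict_space borel (EE :: (real^'n) set))" by (simp add: sets_restrict_space_iff)
  qed
  interpret sigma_algebra EE "sigma_sets EE cells :: (real^'n) set set"
    by (rule sigma_algebra_sigma_sets) (auto simp: cells_def cell_def)
  have pos: "EE \<inter> {y :: real^'n. s < y $ j} \<in> sigma_sets EE cells" if "0 < s" for s j
  proof -
    have "EE \<inter> {y :: real^'n. s < y $ j} = cell {(j, s)} {}" by (auto simp: cell_def upper_set_def lower_set_def)
    also have "\<dots> \<in> cells" using that by (intro cellsI) auto
    finally show ?thesis by (rule sigma_sets.Basic)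
  qed
  have half: "EE \<inter> {y :: real^'n. s < y $ j} \<in> sigma_sets EE cells" for s j
  proof -
    consider "0 < s" | "s = 0" | "s < 0" by linarith
    then show ?thesis
    proof cases
      case 1 then show ?thesis by (rule pos)
    next
      case 2
      have "EE \<inter> {y :: real^'n. 0 < y $ j} = (\<Union>n::nat. EE \<inter> {y. inverse (real (Suc n)) < y $ j})"
      proof -
        have "0 < r \<longleftrightarrow> (\<exists>n. inverse (real (Suc n)) < r)" for r :: real
          using reals_Archimedean[of r] less_trans[of 0 "inverse (real (Suc _))" r] by auto
        then show ?thesis by blast
      qed
      also have "\<dots> \<in> sigma_sets EE cells"
        by (intro countable_UN image_subsetI pos) auto
      finally show ?thesis using 2 by simp
    next
      case 3
      then have "EE \<inter> {y :: real^'n. s < y $ j} = EE" by (auto simp: EE_def intro: less_le_trans)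
      then show ?thesis by (simp add: sigma_sets_top)
    qed
  qed
  have "EE \<inter> {..a} \<in> sigma_sets EE cells" for a :: "real^'n"
  proof -
    have "EE \<inter> {..a} = EE - (\<Union>j. EE \<inter> {y. a $ j < y $ j})"
    proof -
      have "y \<le> a \<longleftrightarrow> \<not> (\<exists>j. a $ j < y $ j)" for y by (simp add: less_eq_vec_def not_less)
      then show ?thesis by blast
    qed
    also have "\<dots> \<in> sigma_sets EE cells" using half by (intro compl_sets finite_UN) auto
    finally show ?thesis .
  qed
  then have "sigma_sets EE ((\<inter>) EE ` range atMost) \<subseteq> sigma_sets EE (cells :: (real^'n) set set)"
    by (intro sigma_sets_mono) auto
  moreover have "sets (restrict_space borel EE) = sigma_sets EE ((\<inter>) EE ` range (atMost :: real^'n \<Rightarrow> _))"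
  proof -
    have s: "sets (borel :: (real^'n) measure) = sigma_sets UNIV (range atMost)"
      by (simp add: borel_eq_atMost)
    show ?thesis unfolding sets_restrict_space s
      by (rule sigma_sets_Int) (simp_all only: s[symmetric] EE_borel subset_UNIV)
  qed
  ultimately show "sets (restrict_space borel EE) \<subseteq> sigma_sets EE (cells :: (real^'n) set set)" by simp
qed

text \<open>The total mass may be infinite. Finiteness off every box around 0 is what legitimates
  subtracting masses, and with it the uniqueness below.\<close>

definition finite_off_zero :: "(real^'n::finite) measure \<Rightarrow> bool" where
  "finite_off_zero \<mu> \<longleftrightarrow> sets \<mu> = sets (restrict_space borel EE) \<and>
     (\<forall>x. (\<forall>j. 0 < x $ j) \<longrightarrow> emeasure \<mu> (EE - {..x}) < \<infinity>)"

lemma space_finite_off_zero: "finite_off_zero \<mu> \<Longrightarrow> space \<mu> = EE"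
  using sets_eq_imp_space_eq[of \<mu> "restrict_space borel EE"] by (simp add: finite_off_zero_def space_restrict_space)

lemma in_sets_finite_off_zero:
  "finite_off_zero \<mu> \<Longrightarrow> A \<in> sets \<mu> \<longleftrightarrow> A \<subseteq> EE \<and> A \<in> sets borel"
  by (simp add: finite_off_zero_def sets_restrict_space_iff)

text \<open>Raising the cap shrinks the complement, so this is continuity from above and needs
  finite masses; \<open>Suc K\<close> keeps the cap positive, as \<open>finite_off_zero\<close>
  demands.\<close>

lemma emeasure_capped_tendsto:
  assumes \<mu>: "finite_off_zero \<mu>" and H: "constraints H"
  shows "(\<lambda>K. emeasure \<mu> (EE - {..capped H (real (Suc K))})) \<longlonglongrightarrow> emeasure \<mu> (EE - lower_set H)"
    "emeasure \<mu> (EE - lower_set H) < \<infinity>"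
proof -
  have fin: "finite H" using H by (simp add: constraints_def)
  have f: "emeasure \<mu> (EE - {..capped H (real (Suc K))}) < \<infinity>" for K
    using \<mu> capped_pos[OF H, of "real (Suc K)"] by (simp add: finite_off_zero_def)
  have "(\<lambda>K. emeasure \<mu> (EE - {..capped H (real (Suc K))})) \<longlonglongrightarrow> emeasure \<mu> (\<Inter>K. EE - {..capped H (real (Suc K))})"
  proof (rule Lim_emeasure_decseq)
    show "range (\<lambda>K. EE - {..capped H (real (Suc K))}) \<subseteq> sets \<mu>"
      by (auto simp: in_sets_finite_off_zero[OF \<mu>])
    show "decseq (\<lambda>K. EE - {..capped H (real (Suc K))})"
      unfolding decseq_Suc_iff
    proof
      fix K
      have "r \<le> real (Suc K) \<Longrightarrow> r \<le> real (Suc (Suc K))" for r by simp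
      then show "EE - {..capped H (real (Suc (Suc K)))} \<subseteq> EE - {..capped H (real (Suc K))}"
        unfolding atMost_def le_capped_iff[OF H] by blast
    qed
    show "emeasure \<mu> (EE - {..capped H (real (Suc K))}) \<noteq> \<infinity>" for K using f[of K] by simp
  qed
  also have "(\<Inter>K. EE - {..capped H (real (Suc K))}) = EE - lower_set H"
  proof -
    have "\<exists>K::nat. \<forall>j. v $ j \<le> 1 + real K" for v :: "real^'a"
    proof -
      obtain k :: nat where "norm v \<le> real k" using real_arch_simple by blast
      then have "norm v \<le> 1 + real k" by simp
      then show ?thesis
        by (intro exI[of _ k]) (auto intro: order_trans[OF order_trans[OF abs_ge_self component_le_norm_cart]])
    qed
    then show ?thesis by (auto simp: le_capped_iff[OF H])
  qed
  finally show "(\<lambda>K. emeasure \<mu> (EE - {..capped H (real (Suc K))})) \<longlonglongrightarrow> emeasure \<mu> (EE - lower_set H)" .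
  have "emeasure \<mu> (EE - lower_set H) \<le> emeasure \<mu> (EE - {..capped H (real (Suc 0))})"
    by (intro emeasure_mono) (auto simp: in_sets_finite_off_zero[OF \<mu>] le_capped_iff[OF H])
  then show "emeasure \<mu> (EE - lower_set H) < \<infinity>" using f[of 0] by (rule le_less_trans)
qed

text \<open>Cells form an intersection-stable generator, and \<open>EE\<close> is the countable
  union of the cells on which some coordinate exceeds 1 / (n + 1). Masses of cells are recovered
  from those of the sets \<open>EE - {..x}\<close> by lifting the cap and then subtracting one lower
  bound at a time.\<close>

lemma finite_off_zero_eqI:
  fixes \<mu> \<nu> :: "(real^'n::finite) measure"
  assumes \<mu>: "finite_off_zero \<mu>" and \<nu>: "finite_off_zero \<nu>"
    and eq: "\<And>x. (\<forall>j. 0 < x $ j) \<Longrightarrow> emeasure \<mu> (EE - {..x}) = emeasure \<nu> (EE - {..x})"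
  shows "\<mu> = \<nu>"
proof -
  have lower: "emeasure \<mu> (EE - lower_set H) = emeasure \<nu> (EE - lower_set H)" if H: "constraints H" for H
  proof -
    have "emeasure \<mu> (EE - {..capped H (real (Suc K))}) = emeasure \<nu> (EE - {..capped H (real (Suc K))})" for K
      by (intro eq allI capped_pos[OF H]) auto
    then show ?thesis
      using emeasure_capped_tendsto(1)[OF \<mu> H] emeasure_capped_tendsto(1)[OF \<nu> H]
      by (simp add: LIMSEQ_unique)
  qed
  have cells_in: "cell L H \<in> sets \<rho>" if "finite_off_zero \<rho>" "constraints L" "constraints H" for \<rho> L H
    using that by (auto simp: in_sets_finite_off_zero constraints_def cell_borel) (auto simp: cell_def)
  have cells_fin: "emeasure \<rho> (cell L H) \<noteq> \<infinity>"
    if \<rho>: "finite_off_zero \<rho>" and L: "constraints L" and H: "constraints H" and "L \<noteq> {}" for \<rho> :: "(real^'n) measure" and L H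
  proof -
    obtain p where "p \<in> L" using \<open>L \<noteq> {}\<close> by blast
    then have p: "constraints {p}" using L by (simp add: constraints_def)
    have "emeasure \<rho> (cell L H) \<le> emeasure \<rho> (EE - lower_set {p})"
      using \<open>p \<in> L\<close> p lower_set_borel[of "{p}"]
      by (intro emeasure_mono) (auto simp: in_sets_finite_off_zero[OF \<rho>] cell_def upper_set_def lower_set_def not_le)
    also have "\<dots> < \<infinity>" by (rule emeasure_capped_tendsto(2)[OF \<rho> p])
    finally show ?thesis by simp
  qed
  have cells_eq: "emeasure \<mu> (cell L H) = emeasure \<nu> (cell L H)"
    if "constraints L" "L \<noteq> {}" "constraints H" for L H
  proof -
    have "finite L" using that by (simp add: constraints_def)
    from this that(2,1,3) show ?thesis
    proof (induction L arbitrary: H rule: finite_ne_induct)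
      case (singleton p)
      have fin: "finite H" using singleton by (simp add: constraints_def)
      have c: "cell {p} H = (EE - lower_set (insert p H)) - (EE - lower_set H)"
        by (auto simp: cell_def upper_set_def lower_set_def)
      have s: "EE - lower_set (insert p H) \<in> sets \<rho>" "EE - lower_set H \<in> sets \<rho>" if "finite_off_zero \<rho>" for \<rho>
        using fin by (auto simp: in_sets_finite_off_zero[OF that] lower_set_borel)
      have sub: "EE - lower_set H \<subseteq> EE - lower_set (insert p H)" by (auto simp: lower_set_def)
      have "emeasure \<rho> (cell {p} H) = emeasure \<rho> (EE - lower_set (insert p H)) - emeasure \<rho> (EE - lower_set H)"
        if \<rho>: "finite_off_zero \<rho>" for \<rho>
        unfolding c using s[OF \<rho>] sub emeasure_capped_tendsto(2)[OF \<rho> singleton(2)]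
        by (intro emeasure_Diff) auto
      then show ?case using \<mu> \<nu> lower[of H] lower[of "insert p H"] singleton by simp
    next
      case (insert p L)
      have H': "constraints (insert p H)" "constraints L" using insert by auto
      have c: "cell (insert p L) H = cell L H - cell L (insert p H)"
        by (auto simp: cell_def upper_set_def lower_set_def)
      have sub: "cell L (insert p H) \<subseteq> cell L H" by (auto simp: cell_def lower_set_def)
      have "emeasure \<rho> (cell (insert p L) H) = emeasure \<rho> (cell L H) - emeasure \<rho> (cell L (insert p H))"
        if \<rho>: "finite_off_zero \<rho>" for \<rho>
        unfolding c using sub insert.prems H' insert.hyps
        by (intro emeasure_Diff cells_in[OF \<rho>] cells_fin[OF \<rho>]) auto
      then show ?case using \<mu> \<nu> insert.IH[of H] insert.IH[of "insert p H"] insert.prems H' by simp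
    qed
  qed
  show ?thesis
  proof (rule measure_eqI_generator_eq_countable[where E=cells and \<Omega>=EE and A="range (\<lambda>(j, n). cell {(j, inverse (real (Suc n)))} {})"])
    show "Int_stable (cells :: (real^'n) set set)" by (auto intro!: Int_stableI cells_Int)
    show "cells \<subseteq> Pow (EE :: (real^'n) set)" by (auto simp: cells_def cell_def)
    show "emeasure \<mu> X = emeasure \<nu> X" if "X \<in> cells" for X
      using that cells_eq by (auto simp: cells_def)
    show "sets \<mu> = sigma_sets EE cells" "sets \<nu> = sigma_sets EE cells"
      using \<mu> \<nu> by (simp_all add: finite_off_zero_def sigma_sets_cells)
    show "range (\<lambda>(j, n). cell {(j, inverse (real (Suc n)))} {}) \<subseteq> (cells :: (real^'n) set set)"
      by (auto intro!: cellsI)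
    show "countable (range (\<lambda>(j::'n, n). cell {(j, inverse (real (Suc n)))} {}))" by simp
    show "emeasure \<mu> a \<noteq> \<infinity>" if a: "a \<in> range (\<lambda>(j, n). cell {(j, inverse (real (Suc n)))} {})" for a
    proof -
      obtain j n where "a = cell {(j, inverse (real (Suc n)))} {}" using a by auto
      then show ?thesis by (simp only:) (rule cells_fin[OF \<mu>]; simp)
    qed
    show "\<Union>(range (\<lambda>(j, n). cell {(j, inverse (real (Suc n)))} {})) = (EE :: (real^'n) set)"
    proof
      show "\<Union>(range (\<lambda>(j, n). cell {(j, inverse (real (Suc n)))} {})) \<subseteq> (EE :: (real^'n) set)"
        by (auto simp: cell_def)
      show "(EE :: (real^'n) set) \<subseteq> \<Union>(range (\<lambda>(j, n). cell {(j, inverse (real (Suc n)))} {}))"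
      proof
        fix x :: "real^'n" assume x: "x \<in> EE"
        then obtain j where "x $ j \<noteq> 0" by (auto simp: EE_def vec_eq_iff)
        then have "0 < x $ j" using x by (simp add: EE_def less_le)
        then obtain n where "inverse (real (Suc n)) < x $ j" using reals_Archimedean by blast
        then have "x \<in> cell {(j, inverse (real (Suc n)))} {}"
          using x by (simp add: cell_def upper_set_def lower_set_def)
        then show "x \<in> \<Union>(range (\<lambda>(j, n). cell {(j, inverse (real (Suc n)))} {}))" by blast
      qed
    qed
  qed
qed

lemma atMost_eq_lower_set: "{..x :: real^'n::finite} = lower_set (range (\<lambda>j. (j, x $ j)))"
  by (auto simp: lower_set_def less_eq_vec_def)

lemma constraints_range: "(\<forall>j. 0 < x $ j) \<Longrightarrow> constraints (range (\<lambda>j. (j, x $ j)))"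
  for x :: "real^'n::finite"
  by (auto simp: constraints_def)

context max_stable_law begin

lemma exists_exponent_measure:
  "\<exists>\<mu>. finite_off_zero \<mu> \<and>
    (\<forall>H. constraints H \<longrightarrow> H \<noteq> {} \<longrightarrow> emeasure \<mu> (EE - lower_set H) = ennreal (- ln (prob (lower_set H))))"
proof -
  obtain \<mu> :: "(real^'n) measure" where \<mu>: "sets \<mu> = sigma_sets EE cell_ring" "\<forall>A\<in>cell_ring. emeasure \<mu> A = ennreal (limit_measure A)"
    using exists_limit_measure by blast
  have "sigma_sets EE cell_ring = sigma_sets EE (cells :: (real^'n) set set)"
  proof (rule sigma_sets_eqI)
    show "a \<in> sigma_sets EE cells" if a: "a \<in> cell_ring" for a :: "(real^'n) set"
    proof -
      obtain C where "finite C" "C \<subseteq> cells" "a = \<Union>C" using a by (auto simp: cell_ring_def)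
      then show ?thesis unfolding sigma_sets_cells using cells_sets by (blast intro: sets.finite_Union)
    qed
    show "b \<in> sigma_sets EE cell_ring" if "b \<in> cells" for b :: "(real^'n) set"
      using that by (intro sigma_sets.Basic cells_in_ring)
  qed
  then have "sets \<mu> = sets (restrict_space borel EE)" using \<mu> by (simp add: sigma_sets_cells)
  moreover have v: "emeasure \<mu> (EE - lower_set H) = ennreal (- ln (prob (lower_set H)))" if "constraints H" "H \<noteq> {}" for H
    using limit_measure_upper[OF that] \<mu>(2) by simp
  moreover have "emeasure \<mu> (EE - {..x}) < \<infinity>" if "\<forall>j. 0 < x $ j" for x
    unfolding atMost_eq_lower_set using v[OF constraints_range[OF that]] by simp
  ultimately show ?thesis unfolding finite_off_zero_def by blast
qed

text \<open>The image of \<mu> under division by \<open>t\<close>, multiplied by \<open>t\<close>,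
  has the same values as \<mu> on complements of orthants: this is the logarithm of max-stability.
  Uniqueness extends the identity to all Borel sets.\<close>

lemma exponent_measure_homogeneous:
  assumes \<mu>: "finite_off_zero \<mu>"
    and v: "\<And>H. constraints H \<Longrightarrow> H \<noteq> {} \<Longrightarrow> emeasure \<mu> (EE - lower_set H) = ennreal (- ln (prob (lower_set H)))"
    and t: "0 < t" and B: "B \<in> sets \<mu>"
  shows "ennreal t * emeasure \<mu> {y \<in> EE. y /\<^sub>R t \<in> B} = emeasure \<mu> B"
proof -
  let ?N = "restrict_space borel (EE :: (real^'n) set)"
  let ?D = "distr \<mu> ?N (\<lambda>y. y /\<^sub>R t)"
  let ?\<nu> = "scale_measure (ennreal t) ?D"
  note sp = space_finite_off_zero[OF \<mu>]
  have sets: "sets \<mu> = sets ?N" using \<mu> by (simp add: finite_off_zero_def)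
  have m: "(\<lambda>y. y /\<^sub>R t) \<in> measurable \<mu> ?N"
  proof (rule measurable_restrict_space2)
    show "(\<lambda>y. y /\<^sub>R t) \<in> space \<mu> \<rightarrow> EE" using t by (auto simp: sp EE_def)
    have "(\<lambda>y. y /\<^sub>R t) \<in> borel_measurable ?N"
      by (intro measurable_restrict_space1) simp
    then show "(\<lambda>y. y /\<^sub>R t) \<in> borel_measurable \<mu>"
      by (simp add: measurable_cong_sets[OF sets refl])
  qed
  have e: "emeasure ?\<nu> A = ennreal t * emeasure \<mu> {y \<in> EE. y /\<^sub>R t \<in> A}" if "A \<in> sets \<mu>" for A
    using that m by (auto simp: sets emeasure_distr sp intro!: arg_cong2[where f="(*)"] arg_cong[where f="emeasure \<mu>"])
  have val: "emeasure ?\<nu> (EE - {..x}) = emeasure \<mu> (EE - {..x})" if x: "\<forall>j. 0 < x $ j" for x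
  proof -
    have tx: "\<forall>j. 0 < (t *\<^sub>R x) $ j" using x t by simp
    have "{y \<in> EE. y /\<^sub>R t \<in> EE - {..x}} = EE - {..t *\<^sub>R x}"
      using t by (auto simp: EE_def less_eq_vec_def field_simps)
    then have "emeasure ?\<nu> (EE - {..x}) = ennreal t * emeasure \<mu> (EE - {..t *\<^sub>R x})"
      by (subst e) (auto simp: in_sets_finite_off_zero[OF \<mu>])
    also have "emeasure \<mu> (EE - {..t *\<^sub>R x}) = ennreal (- ln (prob {..t *\<^sub>R x}))"
      using v[OF constraints_range[OF tx]] by (simp add: atMost_eq_lower_set)
    also have "ennreal t * ennreal (- ln (prob {..t *\<^sub>R x})) = ennreal (t * - ln (prob {..t *\<^sub>R x}))"
      by (rule ennreal_mult'[symmetric]) (use t in simp)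
    also have "t * - ln (prob {..t *\<^sub>R x}) = - ln (prob {..x})"
    proof -
      have "prob {..t *\<^sub>R x} powr t = prob {..x}"
        using simple t x by (simp add: simple_max_stable_def mcdf_def)
      moreover have "0 < prob {..t *\<^sub>R x}"
        using prob_lower_pos[OF constraints_range[OF tx]] by (simp add: atMost_eq_lower_set)
      ultimately show ?thesis using ln_powr[of "prob {..t *\<^sub>R x}" t] by simp
    qed
    also have "ennreal (- ln (prob {..x})) = emeasure \<mu> (EE - {..x})"
      using v[OF constraints_range[OF x]] by (simp add: atMost_eq_lower_set)
    finally show ?thesis .
  qed
  have "finite_off_zero ?\<nu>"
    unfolding finite_off_zero_def using val \<mu> by (auto simp: finite_off_zero_def)
  then have "?\<nu> = \<mu>" by (rule finite_off_zero_eqI[OF _ \<mu> val])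
  then show ?thesis using e[OF B] by simp
qed

end

text \<open>Capping both sides extends the exponential formula to unconstrained coordinates, as
  needed for margins and for exponent measures evaluated at infinite entries.\<close>

lemma measure_lower_set_eq:
  fixes L \<mu> :: "(real^'n::finite) measure"
  assumes \<mu>: "finite_off_zero \<mu>" and L: "prob_space L" "sets L = sets borel"
    and cdf: "\<And>x. (\<forall>j. 0 < x $ j) \<Longrightarrow> measure L {..x} = exp (- measure \<mu> (EE - {..x}))"
    and H: "constraints H"
  shows "measure L (lower_set H) = exp (- measure \<mu> (EE - lower_set H))"
proof (rule LIMSEQ_unique)
  have fin: "finite H" using H by (simp add: constraints_def)
  have B: "lower_set H \<inter> {y. \<forall>j. y $ j \<le> real K} = {..capped H (real K)}" for K
    by (auto simp: le_capped_iff[OF H])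
  have "(\<lambda>K::nat. measure L {..capped H (real K)}) \<longlonglongrightarrow> measure L (lower_set H)"
    unfolding B[symmetric]
    by (rule measure_capped_tendsto[where r=1, simplified]) (use L fin in auto)
  then show "(\<lambda>K::nat. measure L {..capped H (real (Suc K))}) \<longlonglongrightarrow> measure L (lower_set H)"
    by (rule LIMSEQ_Suc)
  have f: "emeasure \<mu> (EE - {..capped H (real (Suc K))}) \<noteq> \<top>" for K
    using \<mu> capped_pos[OF H, of "real (Suc K)"] by (simp add: finite_off_zero_def less_top[symmetric])
  have "(\<lambda>K. measure \<mu> (EE - {..capped H (real (Suc K))})) \<longlonglongrightarrow> measure \<mu> (EE - lower_set H)"
    unfolding measure_def
    using emeasure_capped_tendsto[OF \<mu> H] by (intro tendsto_enn2real) auto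
  then have "(\<lambda>K. exp (- measure \<mu> (EE - {..capped H (real (Suc K))}))) \<longlonglongrightarrow> exp (- measure \<mu> (EE - lower_set H))"
    by (intro tendsto_intros)
  moreover have "measure L {..capped H (real (Suc K))} = exp (- measure \<mu> (EE - {..capped H (real (Suc K))}))" for K
    by (intro cdf allI capped_pos[OF H]) simp
  ultimately show "(\<lambda>K::nat. measure L {..capped H (real (Suc K))}) \<longlonglongrightarrow> exp (- measure \<mu> (EE - lower_set H))"
    by simp
qed

lemma exp_uminus_Suc_tendsto_0: "(\<lambda>n. exp (- real (Suc n))) \<longlonglongrightarrow> 0"
  by (intro filterlim_compose[OF exp_at_bot] filterlim_compose[OF filterlim_uminus_at_bot_at_top]
      filterlim_compose[OF filterlim_real_sequentially filterlim_Suc])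

lemma unit_frechet_marginsI:
  fixes L \<mu> :: "(real^'n::finite) measure"
  assumes \<mu>: "finite_off_zero \<mu>" and L: "prob_space L" "sets L = sets borel"
    and cdf: "\<And>x. (\<forall>j. 0 < x $ j) \<Longrightarrow> measure L {..x} = exp (- measure \<mu> (EE - {..x}))"
    and marg: "\<And>j s. 0 < s \<Longrightarrow> emeasure \<mu> (EE - lower_set {(j, s)}) = ennreal (1 / s)"
  shows "unit_frechet_margins L"
proof -
  interpret L: prob_space L by fact
  have pos: "measure L {y. y $ j \<le> s} = exp (- 1 / s)" if "0 < s" for j s
    using measure_lower_set_eq[OF assms(1-4), of "{(j, s)}"] that marg[OF that, of j]
    by (simp add: lower_set_def measure_def)
  \<comment> \<open>The formula is available at positive points only, so the value here is squeezed
    by those at 1 / (n + 1).\<close>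
  have "measure L {y. y $ j \<le> s} = 0" if "s \<le> 0" for j s
  proof -
    have "measure L {y. y $ j \<le> s} \<le> exp (- real (Suc n))" for n
    proof -
      have "measure L {y. y $ j \<le> s} \<le> measure L {y. y $ j \<le> inverse (real (Suc n))}"
        using that L by (intro L.finite_measure_mono) (auto intro: order_trans)
      also have "\<dots> = exp (- real (Suc n))" by (subst pos) (simp_all add: field_simps)
      finally show ?thesis .
    qed
    then have "measure L {y. y $ j \<le> s} \<le> 0"
      by (intro LIMSEQ_le_const[OF exp_uminus_Suc_tendsto_0]) auto
    then show ?thesis by (simp add: measure_le_0_iff)
  qed
  then show ?thesis using pos unfolding unit_frechet_margins_def by (auto simp: cdf_margin[OF L(2)])
qed

lemma is_exponent_measureI:
  fixes L \<mu> :: "(real^'n::finite) measure"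
  assumes \<mu>: "finite_off_zero \<mu>" and L: "prob_space L" "sets L = sets borel"
    and cdf: "\<And>x. (\<forall>j. 0 < x $ j) \<Longrightarrow> measure L {..x} = exp (- measure \<mu> (EE - {..x}))"
    and marg: "\<And>j s. 0 < s \<Longrightarrow> emeasure \<mu> (EE - lower_set {(j, s)}) = ennreal (1 / s)"
  shows "is_exponent_measure L \<mu>"
proof -
  interpret L: prob_space L by fact
  note fr = unit_frechet_marginsI[OF assms]
  have "measure L {y. \<forall>j. ereal (y $ j) \<le> x $ j} =
        (let m = emeasure \<mu> (EE - {y. \<forall>j. ereal (y $ j) \<le> x $ j})
         in if m = \<infinity> then 0 else exp (- enn2real m))" if x: "\<forall>j. 0 \<le> x $ j" for x :: "ereal^'n"
  proof (cases "\<forall>j. 0 < x $ j")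
    case True
    \<comment> \<open>Infinite entries impose no constraint and are left out.\<close>
    define H where "H = (\<lambda>j. (j, real_of_ereal (x $ j))) ` {j. x $ j \<noteq> \<infinity>}"
    have H: "constraints H"
      using True by (auto simp: H_def constraints_def zero_less_real_of_ereal)
    have "ereal (y $ j) \<le> x $ j \<longleftrightarrow> (x $ j \<noteq> \<infinity> \<longrightarrow> y $ j \<le> real_of_ereal (x $ j))" for y j
      using True by (cases "x $ j") (auto dest!: spec[of _ j])
    then have eq: "{y. \<forall>j. ereal (y $ j) \<le> x $ j} = lower_set H"
      by (auto simp: H_def lower_set_def)
    show ?thesis unfolding eq Let_def
      using measure_lower_set_eq[OF assms(1-4) H] emeasure_capped_tendsto(2)[OF \<mu> H]
      by (simp add: measure_def)
  next
    case False
    then obtain j where j: "x $ j = 0" using x by (metis order_le_less)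
    have meas: "{y :: real^'n. \<forall>j. ereal (y $ j) \<le> x $ j} \<in> sets borel"
    proof -
      have "{y :: real^'n. \<forall>j. ereal (y $ j) \<le> x $ j} = (\<Inter>j. {y. ereal (y $ j) \<le> x $ j})" by auto
      also have "\<dots> \<in> sets borel" by (intro sets.countable_INT) auto
      finally show ?thesis .
    qed
    have "measure L {y. \<forall>j. ereal (y $ j) \<le> x $ j} \<le> measure L {y. y $ j \<le> 0}"
      using L j by (intro L.finite_measure_mono) (auto dest!: spec[of _ j] simp: zero_ereal_def)
    also have "\<dots> = 0"
      using fr by (simp add: cdf_margin[OF L(2), symmetric] unit_frechet_margins_def)
    finally have "measure L {y. \<forall>j. ereal (y $ j) \<le> x $ j} = 0" by (simp add: measure_le_0_iff)
    \<comment> \<open>The set contains every half-space where coordinate \<open>j\<close> exceeds 1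
      / n, and such a half-space has mass n.\<close>
    moreover have "emeasure \<mu> (EE - {y. \<forall>j. ereal (y $ j) \<le> x $ j}) = \<infinity>"
    proof (rule ccontr)
      assume "emeasure \<mu> (EE - {y. \<forall>j. ereal (y $ j) \<le> x $ j}) \<noteq> \<infinity>"
      then obtain n :: nat where n: "emeasure \<mu> (EE - {y. \<forall>j. ereal (y $ j) \<le> x $ j}) < of_nat n"
        using ennreal_Ex_less_of_nat by (auto simp: less_top)
      then have "0 < n" by (cases n) auto
      have "of_nat n = emeasure \<mu> (EE - lower_set {(j, 1 / real n)})"
        using \<open>0 < n\<close> by (subst marg) (auto simp: ennreal_of_nat_eq_real_of_nat)
      also have "\<dots> \<le> emeasure \<mu> (EE - {y. \<forall>j. ereal (y $ j) \<le> x $ j})"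
      proof (rule emeasure_mono)
        show "EE - {y. \<forall>j. ereal (y $ j) \<le> x $ j} \<in> sets \<mu>"
          using meas by (auto simp: in_sets_finite_off_zero[OF \<mu>])
        show "EE - lower_set {(j, 1 / real n)} \<subseteq> EE - {y. \<forall>j. ereal (y $ j) \<le> x $ j}"
        proof
          fix y assume y: "y \<in> EE - lower_set {(j, 1 / real n)}"
          then have "1 / real n < y $ j" by (simp add: lower_set_def not_le)
          then have "0 < y $ j" by (rule le_less_trans[rotated]) simp
          then have "\<not> ereal (y $ j) \<le> x $ j" using j by (simp add: zero_ereal_def)
          then show "y \<in> EE - {y. \<forall>j. ereal (y $ j) \<le> x $ j}" using y by blast
        qed
      qed
      finally show False using n by simp
    qed
    ultimately show ?thesis by simp
  qed
  then show ?thesis using \<mu> unfolding is_exponent_measure_def finite_off_zero_def by blast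
qed

lemma is_exponent_measureD:
  assumes "is_exponent_measure L \<mu>" "\<forall>j. 0 < x $ j" "0 < measure L {..x}"
  shows "emeasure \<mu> (EE - {..x}) = ennreal (- ln (measure L {..x}))" "emeasure \<mu> (EE - {..x}) < \<infinity>"
proof -
  have eq: "{y. \<forall>j. ereal (y $ j) \<le> (\<chi> j. ereal (x $ j)) $ j} = {..x}" by (auto simp: less_eq_vec_def)
  have "\<forall>j. 0 \<le> (\<chi> j. ereal (x $ j)) $ j" using assms(2) by (simp add: less_imp_le)
  then have "measure L {..x} = (let m = emeasure \<mu> (EE - {..x}) in if m = \<infinity> then 0 else exp (- enn2real m))"
    using assms(1) unfolding is_exponent_measure_def eq[symmetric] by blast
  then have m: "emeasure \<mu> (EE - {..x}) \<noteq> \<infinity>" "measure L {..x} = exp (- enn2real (emeasure \<mu> (EE - {..x})))"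
    using assms(3) by (auto simp: Let_def split: if_splits)
  then show "emeasure \<mu> (EE - {..x}) < \<infinity>" by (simp add: less_top)
  show "emeasure \<mu> (EE - {..x}) = ennreal (- ln (measure L {..x}))"
    using m by (simp add: less_top)
qed

text \<open>Allows a direction to be ruled out by inspecting one exponent measure, although
  \<open>extreme_direction\<close> quantifies over all. A positive cdf value excludes infinite mass,
  which the definition encodes by the value 0.\<close>

lemma is_exponent_measure_unique:
  assumes "is_exponent_measure L \<mu>" "is_exponent_measure L \<nu>"
    and "\<And>x. (\<forall>j. 0 < x $ j) \<Longrightarrow> 0 < measure L {..x}"
  shows "\<mu> = \<nu>"
proof (rule finite_off_zero_eqI)
  have "finite_off_zero \<rho>" if \<rho>: "is_exponent_measure L \<rho>" for \<rho>
    unfolding finite_off_zero_def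
    by (intro conjI allI impI is_exponent_measureD(2)[OF \<rho>] assms(3))
       (use \<rho> in \<open>auto simp: is_exponent_measure_def\<close>)
  then show "finite_off_zero \<mu>" "finite_off_zero \<nu>" using assms by blast+
  show "emeasure \<mu> (EE - {..x}) = emeasure \<nu> (EE - {..x})" if x: "\<forall>j. 0 < x $ j" for x
    using is_exponent_measureD(1)[OF assms(1) x assms(3)[OF x]] is_exponent_measureD(1)[OF assms(2) x assms(3)[OF x]]
    by simp
qed

section \<open>Laws with a given exponent measure\<close>

text \<open>The Poisson generating function: the probability that all of a Poisson number of
  independent points fall into a set of probability q.\<close>

lemma expectation_poisson_power:
  assumes "0 < l" "0 \<le> q"
  shows "(\<integral>\<^sup>+ n. ennreal (q ^ n) \<partial>measure_pmf (poisson_pmf l)) = ennreal (exp (l * q - l))"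
proof -
  have "(\<integral>\<^sup>+ n. ennreal (q ^ n) \<partial>measure_pmf (poisson_pmf l)) =
      (\<Sum>n. ennreal (l ^ n / fact n * exp (- l)) * ennreal (q ^ n))"
    using assms by (simp add: nn_integral_measure_pmf nn_integral_count_space_nat)
  also have "\<dots> = (\<Sum>n. ennreal (exp (- l) * ((l * q) ^ n /\<^sub>R fact n)))"
    using assms by (intro suminf_cong) (simp add: ennreal_mult'[symmetric] power_mult_distrib field_simps)
  also have "\<dots> = ennreal (exp (- l) * exp (l * q))"
    using assms by (intro suminf_ennreal_eq sums_mult exp_converges) auto
  finally show ?thesis by (simp add: exp_add[symmetric])
qed

text \<open>The maximum of a Poisson number of independent points.\<close>
lemma exists_law_finite:
  fixes N :: "(real^'n::finite) measure"
  assumes "finite_measure N" and s: "sets N = sets borel"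
  shows "\<exists>L. prob_space L \<and> sets L = sets borel \<and>
    (\<forall>x. (\<forall>j. 0 \<le> x $ j) \<longrightarrow> measure L {..x} = exp (- measure N (- {..x})))"
proof -
  interpret finite_measure N by fact
  have sp: "space N = UNIV" using sets_eq_imp_space_eq[OF s] by simp
  define l where "l = measure N UNIV"
  show ?thesis
  proof (cases "l = 0")
    case True
    \<comment> \<open>Without mass there are no points and the law sits at 0; dividing by
      \<open>l\<close> below needs a positive total.\<close>
    have "measure N A = 0" for A
      using bounded_measure[of A] True by (simp add: l_def sp measure_le_0_iff)
    then show ?thesis
      by (intro exI[of _ "return borel 0"]) (auto simp: prob_space_return measure_return less_eq_vec_def)
  next
    case False
    then have l: "0 < l" by (simp add: l_def less_le)
    define Q where "Q = scale_measure (ennreal (1 / l)) N"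
    have sQ [measurable_cong]: "sets Q = sets borel" by (simp add: Q_def s)
    have mQ: "measure Q A = measure N A / l" for A
      using l by (simp add: Q_def)
    have Q: "prob_space Q"
    proof
      have "emeasure Q (space Q) = ennreal (1 / l) * ennreal l"
        by (simp add: Q_def emeasure_eq_measure sp l_def space_scale_measure)
      also have "\<dots> = 1" using l by (simp add: ennreal_mult'[symmetric])
      finally show "emeasure Q (space Q) = 1" .
    qed
    define P where "P = PiM UNIV (\<lambda>_::nat. Q)"
    interpret P: product_prob_space "\<lambda>_::nat. Q" UNIV
      by (rule product_prob_spaceI) (rule Q)
    have P: "prob_space P" unfolding P_def by (rule P.P.prob_space_axioms)
    \<comment> \<open>The inserted 0 is the maximum of no points. It does not alter the events,
      since only \<open>x\<close> with nonnegative entries is considered.\<close>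
    define Y where "Y n \<omega> = (\<chi> j. Max (insert 0 ((\<lambda>i. \<omega> i $ j) ` {..<n})))" for n and \<omega> :: "nat \<Rightarrow> real^'n"
    \<comment> \<open>As a maximum over the nonempty index set \<open>{..n}\<close>, the expression
      is covered by the standard measurability rules; index n contributes the 0.\<close>
    have Max_eq: "Max (insert 0 ((\<lambda>i. f i) ` {..<n})) = Max ((\<lambda>i. if i < n then f i else 0) ` {..n})" for f :: "nat \<Rightarrow> real" and n
      by (rule arg_cong[where f=Max]) (auto simp: image_iff split: if_splits intro: le_neq_implies_less)
    have comp [measurable]: "(\<lambda>\<omega>. \<omega> i) \<in> measurable P borel" for i
      unfolding P_def by (rule measurable_PiM_coordinate) (simp_all add: sQ)
    have Y [measurable]: "Y n \<in> borel_measurable P" for n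
      unfolding Y_def Max_eq by measurable
    define D where "D n = distr P borel (Y n)" for n
    have D: "prob_space (D n)" "sets (D n) = sets borel" for n
      unfolding D_def using prob_space.prob_space_distr[OF P Y] by auto
    have mD: "emeasure (D n) {..x} = ennreal (measure Q {..x} ^ n)" if x: "\<forall>j. 0 \<le> x $ j" for n x
    proof -
      have "Y n \<omega> \<le> x \<longleftrightarrow> (\<forall>i\<in>{..<n}. \<omega> i \<in> {..x})" for \<omega>
        using x by (auto simp: Y_def less_eq_vec_def)
      then have "emeasure (D n) {..x} = emeasure P {\<omega> \<in> space P. \<forall>i\<in>{..<n}. \<omega> i \<in> {..x}}"
        unfolding D_def by (subst emeasure_distr) (auto intro!: arg_cong[where f="emeasure P"])
      also have "\<dots> = (\<Prod>i\<in>{..<n}. emeasure Q {..x})"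
        unfolding P_def by (intro P.emeasure_PiM_Collect) (auto simp: sQ)
      also have "\<dots> = ennreal (measure Q {..x} ^ n)"
        by (simp add: finite_measure.emeasure_eq_measure[OF prob_space.finite_measure[OF Q]] ennreal_power)
      finally show ?thesis .
    qed
    define L where "L = measure_pmf (poisson_pmf l) \<bind> D"
    have Dm: "D \<in> measurable (measure_pmf (poisson_pmf l)) (subprob_algebra borel)"
      using D by (auto simp: measurable_pmf_measure1 space_subprob_algebra intro: prob_space_imp_subprob_space)
    have L: "prob_space L" unfolding L_def
      by (rule measure_pmf.prob_space_bind[OF _ Dm]) (simp add: D)
    have sL: "sets L = sets borel" unfolding L_def by (rule sets_bind) (auto simp: D)
    have "measure L {..x} = exp (- measure N (- {..x}))" if x: "\<forall>j. 0 \<le> x $ j" for x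
    proof -
      have "emeasure L {..x} = (\<integral>\<^sup>+ n. emeasure (D n) {..x} \<partial>measure_pmf (poisson_pmf l))"
        unfolding L_def by (rule emeasure_bind[OF _ Dm]) auto
      also have "\<dots> = ennreal (exp (l * measure Q {..x} - l))"
        unfolding mD[OF x] by (rule expectation_poisson_power[OF l]) simp
      finally have "measure L {..x} = exp (l * measure Q {..x} - l)" by (simp add: measure_def)
      also have "l * measure Q {..x} - l = - measure N (- {..x})"
        using finite_measure_compl[of "{..x}"] l by (simp add: mQ l_def[symmetric] sp s Compl_eq_Diff_UNIV)
      finally show ?thesis .
    qed
    then show ?thesis using L sL by blast
  qed
qed

lemma measure_PiM_Collect:
  fixes L :: "nat \<Rightarrow> 'a measure"
  assumes L: "\<And>i. prob_space (L i)" and J: "finite J" "\<And>i. i \<in> J \<Longrightarrow> X i \<in> sets (L i)"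
  shows "measure (PiM UNIV L) {\<omega> \<in> space (PiM UNIV L). \<forall>i\<in>J. \<omega> i \<in> X i} = (\<Prod>i\<in>J. measure (L i) (X i))"
proof -
  interpret product_prob_space L UNIV by (rule product_prob_spaceI) (rule L)
  have "emeasure (PiM UNIV L) {\<omega> \<in> space (PiM UNIV L). \<forall>i\<in>J. \<omega> i \<in> X i} = (\<Prod>i\<in>J. emeasure (L i) (X i))"
    using J by (intro emeasure_PiM_Collect) auto
  also have "\<dots> = ennreal (\<Prod>i\<in>J. measure (L i) (X i))"
    by (simp add: M.emeasure_eq_measure prod_ennreal)
  finally show ?thesis by (simp add: measure_def prod_nonneg)
qed

text \<open>\<open>EE\<close> is cut into countably many pieces of finite mass, the \<open>m\<close>-th one bounded by \<open>1/m\<close>;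
  the law is that of the supremum of independent vectors, one for each piece.\<close>
lemma exists_law:
  fixes \<mu> :: "(real^'n::finite) measure"
  assumes \<mu>: "finite_off_zero \<mu>"
  shows "\<exists>L. prob_space L \<and> sets L = sets borel \<and>
    (\<forall>x. (\<forall>j. 0 < x $ j) \<longrightarrow> measure L {..x} = exp (- measure \<mu> (EE - {..x})))"
proof -
  define e where "e m = (\<chi> j. inverse (real (Suc m)) :: real^'n)" for m
  have e: "e m $ j = inverse (real (Suc m))" for m j by (simp add: e_def)
  have e_pos: "\<forall>j. 0 < e m $ j" for m by (simp add: e)
  \<comment> \<open>For m > 0 the shell lies below 1 / m in every coordinate; shell 0 takes
    everything outside the unit box.\<close>
  define A where "A m = (EE - {..e m}) \<inter> (if m = 0 then UNIV else {..e (m - 1)})" for m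
  have A_meas: "A m \<in> sets \<mu>" for m
    by (auto simp: A_def in_sets_finite_off_zero[OF \<mu>])
  have A_fin: "emeasure \<mu> (A m) < \<infinity>" for m
  proof -
    have "emeasure \<mu> (A m) \<le> emeasure \<mu> (EE - {..e m})"
      by (rule emeasure_mono) (auto simp: A_def in_sets_finite_off_zero[OF \<mu>])
    also have "\<dots> < \<infinity>" using \<mu> e_pos by (simp add: finite_off_zero_def)
    finally show ?thesis .
  qed
  have e_anti: "e (Suc m) \<le> e m" for m by (simp add: less_eq_vec_def e le_imp_inverse_le)
  have A_Un: "(\<Union>m\<le>k. A m) = EE - {..e k}" for k
  proof (induction k)
    case (Suc k)
    have "(\<Union>m\<le>Suc k. A m) = (EE - {..e k}) \<union> A (Suc k)" using Suc by (auto simp: atMost_Suc)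
    also have "\<dots> = EE - {..e (Suc k)}" using order_trans[OF _ e_anti[of k]] by (auto simp: A_def)
    finally show ?case .
  qed (simp add: A_def)
  have A_disj: "disjoint_family_on A {..k}" for k
  proof -
    have "A m \<inter> A n = {}" if "m < n" for m n
    proof -
      from that obtain n' where n: "n = Suc n'" by (cases n) auto
      have "A m \<subseteq> EE - {..e n'}" using A_Un[of n'] that n by auto
      moreover have "A n \<subseteq> {..e n'}" by (simp add: A_def n)
      ultimately show ?thesis by blast
    qed
    then show ?thesis unfolding disjoint_family_on_def by (metis Int_commute nat_neq_iff)
  qed
  define N where "N m = distr (restrict_space \<mu> (A m)) borel (\<lambda>x. x)" for m
  have id: "(\<lambda>x. x) \<in> borel_measurable (restrict_space \<mu> (A m))" for m
  proof -
    have "(\<lambda>x. x) \<in> borel_measurable (restrict_space borel (EE :: (real^'n) set))"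
      by (intro measurable_restrict_space1) simp
    then have "(\<lambda>x. x) \<in> borel_measurable \<mu>"
      using \<mu> by (simp add: finite_off_zero_def cong: measurable_cong_sets)
    then show ?thesis by (rule measurable_restrict_space1)
  qed
  have N_e: "emeasure (N m) S = emeasure \<mu> (A m \<inter> S)" if "S \<in> sets borel" for m S
  proof -
    have "emeasure (N m) S = emeasure (restrict_space \<mu> (A m)) (S \<inter> space (restrict_space \<mu> (A m)))"
      unfolding N_def using that by (subst emeasure_distr[OF id]) auto
    also have "S \<inter> space (restrict_space \<mu> (A m)) = A m \<inter> S"
      using sets.sets_into_space[OF A_meas[of m]] by (auto simp: space_restrict_space)
    also have "emeasure (restrict_space \<mu> (A m)) (A m \<inter> S) = emeasure \<mu> (A m \<inter> S)"
      by (intro emeasure_restrict_space sets.Int[OF A_meas sets.top]) auto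
    finally show ?thesis .
  qed
  have "\<exists>L. prob_space L \<and> sets L = sets borel \<and>
    (\<forall>x. (\<forall>j. 0 \<le> x $ j) \<longrightarrow> measure L {..x} = exp (- measure (N m) (- {..x})))" for m
  proof (rule exists_law_finite)
    show "finite_measure (N m)"
      using N_e[of UNIV m] A_fin[of m] by (intro finite_measureI) (simp add: N_def)
  qed (simp add: N_def)
  then obtain L where L: "\<And>m. prob_space (L m)" "\<And>m. sets (L m) = sets borel"
    "\<And>m x. (\<forall>j. 0 \<le> x $ j) \<Longrightarrow> measure (L m) {..x} = exp (- measure (N m) (- {..x}))"
    by metis
  have Lx: "measure (L m) {..x} = exp (- measure \<mu> (A m - {..x}))" if "\<forall>j. 0 \<le> x $ j" for m x
    using L(3)[OF that, of m] N_e[of "- {..x}" m] by (simp add: measure_def Diff_eq)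
  \<comment> \<open>The m-th vector is below 1 / m almost surely. Truncating makes this hold surely,
    so the supremum is finite everywhere and, for fixed positive \<open>x\<close>, only finitely
    many m matter.\<close>
  define c where "c m y = (if m = 0 then y else min y (inverse (real m)))" for m and y :: real
  define P where "P = PiM UNIV L"
  interpret P: prob_space P unfolding P_def by (rule prob_space_PiM) (rule L)
  define Y where "Y \<omega> = (\<chi> j. SUP m. c m (\<omega> m $ j))" for \<omega> :: "nat \<Rightarrow> real^'n"
  have comp [measurable]: "(\<lambda>\<omega>. \<omega> i) \<in> measurable P borel" for i
    unfolding P_def by (rule measurable_PiM_coordinate) (simp_all add: L)
  have bdd: "bdd_above (range (\<lambda>m. c m (\<omega> m $ j)))" for \<omega> :: "nat \<Rightarrow> real^'n" and j
  proof (rule bdd_aboveI2)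
    fix m
    have "inverse (real m) \<le> 1" if "m \<noteq> 0" using that by (simp add: inverse_le_1_iff)
    then show "c m (\<omega> m $ j) \<le> max (\<omega> 0 $ j) 1" by (auto simp: c_def intro: min.coboundedI2)
  qed
  have cm [measurable]: "c m \<in> borel_measurable borel" for m unfolding c_def by measurable
  have Y: "Y \<in> borel_measurable P"
    unfolding Y_def by (intro borel_measurable_vec_lambda borel_measurable_cSUP bdd) auto
  have "measure (distr P borel Y) {..x} = exp (- measure \<mu> (EE - {..x}))" if x: "\<forall>j. 0 < x $ j" for x
  proof -
    have x0: "\<forall>j. 0 \<le> x $ j" using x by (simp add: less_imp_le)
    have "\<forall>j. \<exists>n. inverse (real (Suc n)) < x $ j" using x reals_Archimedean by blast
    then obtain n where n: "\<And>j. inverse (real (Suc (n j))) < x $ j" by metis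
    \<comment> \<open>This index serves twice: beyond it the truncated vectors are automatically
      below \<open>x\<close>, and the shells up to it cover \<open>EE - {..x}\<close>.\<close>
    define k where "k = Max (range n)"
    have k: "inverse (real (Suc m)) \<le> x $ j" if "k \<le> m" for m j
    proof -
      have "n j \<le> m" using that by (auto simp: k_def)
      then have "inverse (real (Suc m)) \<le> inverse (real (Suc (n j)))" by (simp add: le_imp_inverse_le)
      then show ?thesis using n[of j] by linarith
    qed
    define C where "C m = {z :: real^'n. \<forall>j. c m (z $ j) \<le> x $ j}" for m
    have C [measurable]: "C m \<in> sets borel" for m
    proof -
      have "C m = (\<Inter>j. {z. c m (z $ j) \<le> x $ j})" by (auto simp: C_def)
      also have "\<dots> \<in> sets borel" by (intro sets.countable_INT) auto
      finally show ?thesis .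
    qed
    have "Y \<omega> \<le> x \<longleftrightarrow> (\<forall>m\<in>{..k}. \<omega> m \<in> C m)" for \<omega>
    proof -
      have "Y \<omega> \<le> x \<longleftrightarrow> (\<forall>j m. c m (\<omega> m $ j) \<le> x $ j)"
        unfolding Y_def less_eq_vec_def using bdd by (simp add: cSUP_le_iff)
      also have "\<dots> \<longleftrightarrow> (\<forall>m\<in>{..k}. \<forall>j. c m (\<omega> m $ j) \<le> x $ j)"
      proof -
        have "c m y \<le> x $ j" if "\<not> m \<le> k" for m j y
        proof -
          from that obtain m' where "m = Suc m'" "k \<le> m'" by (cases m) auto
          then show ?thesis using k[of m' j] by (simp add: c_def min.coboundedI2)
        qed
        then show ?thesis by (metis atMost_iff)
      qed
      finally show ?thesis by (simp add: C_def)
    qed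
    then have "measure (distr P borel Y) {..x} = measure P {\<omega> \<in> space P. \<forall>m\<in>{..k}. \<omega> m \<in> C m}"
      using Y by (subst measure_distr) (auto intro!: arg_cong[where f="measure P"])
    also have "\<dots> = (\<Prod>m\<le>k. measure (L m) (C m))"
      unfolding P_def by (rule measure_PiM_Collect) (auto simp: L)
    also have "\<dots> = (\<Prod>m\<le>k. measure (L m) {..x})"
    proof (rule prod.cong[OF refl])
      fix m
      interpret Lm: prob_space "L m" by (rule L)
      show "measure (L m) (C m) = measure (L m) {..x}"
      proof (cases m)
        case 0
        then show ?thesis by (simp add: C_def c_def atMost_vec_eq)
      next
        case (Suc m')
        \<comment> \<open>No mass of shell m lies above 1 / m, so the m-th law gives
          \<open>{..e m'}\<close> probability exp 0 = 1 and the truncation is almost surely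
          void.\<close>
        have empty: "A m - {..e m'} = {}" by (auto simp: A_def Suc)
        have "measure (L m) {..e m'} = exp (- measure \<mu> (A m - {..e m'}))"
          using e_pos[of m'] by (intro Lx) (simp add: less_imp_le)
        then have "measure (L m) {..e m'} = 1" by (simp only: empty measure_empty) simp
        then have "AE z in L m. z \<in> {..e m'}" by (subst (asm) Lm.prob_eq_1) (auto simp: L)
        then have "AE z in L m. z \<in> C m \<longleftrightarrow> z \<in> {..x}"
        proof (rule eventually_mono)
          fix z assume "z \<in> {..e m'}"
          then have "c m (z $ j) = z $ j" for j
            by (auto simp: less_eq_vec_def e Suc c_def min_def)
          then show "z \<in> C m \<longleftrightarrow> z \<in> {..x}" by (simp add: C_def less_eq_vec_def)
        qed
        then show ?thesis by (intro measure_eq_AE) (auto simp: L)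
      qed
    qed
    also have "\<dots> = exp (- (\<Sum>m\<le>k. measure \<mu> (A m - {..x})))"
      by (simp add: Lx[OF x0] exp_sum[symmetric] sum_negf)
    also have "(\<Sum>m\<le>k. measure \<mu> (A m - {..x})) = measure \<mu> (\<Union>m\<le>k. A m - {..x})"
    proof (rule measure_finite_Union[symmetric])
      show "(\<lambda>m. A m - {..x}) ` {..k} \<subseteq> sets \<mu>"
      proof (rule image_subsetI)
        fix m
        have "A m \<subseteq> EE" "A m \<in> sets borel" using A_meas[of m] by (simp_all add: in_sets_finite_off_zero[OF \<mu>])
        then show "A m - {..x} \<in> sets \<mu>" unfolding in_sets_finite_off_zero[OF \<mu>]
          by (intro conjI sets.Diff) (blast, simp_all)
      qed
      show "disjoint_family_on (\<lambda>m. A m - {..x}) {..k}"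
        using A_disj[of k] by (auto simp: disjoint_family_on_def)
      show "emeasure \<mu> (A m - {..x}) \<noteq> \<infinity>" for m
        using emeasure_mono[of "A m - {..x}" "A m" \<mu>] A_meas[of m] A_fin[of m] by (auto simp: top_unique)
    qed auto
    also have "(\<Union>m\<le>k. A m - {..x}) = (EE - {..e k}) - {..x}" unfolding A_Un[symmetric] by auto
    also have "\<dots> = EE - {..x}"
    proof -
      have "e k \<le> x" using k[of k] by (simp add: less_eq_vec_def e)
      then show ?thesis by auto
    qed
    finally show ?thesis .
  qed
  then show ?thesis using Y by (intro exI[of _ "distr P borel Y"]) (auto intro: P.prob_space_distr)
qed

section \<open>Decomposition along extreme directions\<close>

lemma EE_sub_borel [measurable]: "(EE_sub J :: (real^'n::finite) set) \<in> sets borel"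
proof -
  have "(EE_sub J :: (real^'n) set) = EE \<inter> (\<Inter>j. {x. 0 < x $ j \<longleftrightarrow> j \<in> J})"
    by (auto simp: EE_sub_def)
  also have "\<dots> \<in> sets borel"
    by (intro sets.Int EE_borel sets.countable_INT) auto
  finally show ?thesis .
qed

lemma EE_sub_subset: "EE_sub J \<subseteq> EE" by (auto simp: EE_sub_def)

lemma EE_sub_disjoint: "J \<noteq> J' \<Longrightarrow> EE_sub J \<inter> EE_sub J' = {}"
  by (auto simp: EE_sub_def)

lemma EE_eq_UN_EE_sub: "(EE :: (real^'n::finite) set) = (\<Union>J. EE_sub J)"
proof -
  have "x \<in> EE_sub {j. 0 < x $ j}" if "x \<in> EE" for x :: "real^'n" using that by (simp add: EE_sub_def)
  then show ?thesis using EE_sub_subset by blast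
qed

lemma EE_sub_divideR:
  assumes "0 < t" shows "y /\<^sub>R t \<in> EE_sub J \<longleftrightarrow> y \<in> EE_sub J"
proof -
  have "0 < (y /\<^sub>R t) $ j \<longleftrightarrow> 0 < y $ j" "0 \<le> (y /\<^sub>R t) $ j \<longleftrightarrow> 0 \<le> y $ j" for j
    using assms by (simp_all add: zero_less_mult_iff zero_le_mult_iff)
  moreover have "y /\<^sub>R t = 0 \<longleftrightarrow> y = 0" using assms by simp
  ultimately show ?thesis by (simp only: EE_sub_def EE_def mem_Collect_eq Diff_iff singleton_iff)
qed

text \<open>The map \<open>T\<close> carries the part of \<mu> on face \<open>J\<close> into the
  open orthant, so D is the only direction left, and dividing by the masses \<open>c\<close> makes
  all margins 1 / s. As \<open>T\<close> is linear, homogeneity of \<mu> passes to the image and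
  yields max-stability. The final clause undoes the rescaling: where \<open>c j = 0\<close> the
  constraint on \<open>z\<close> is vacuous, matching the vanishing coordinates of the face.\<close>

lemma direction_law:
  fixes \<mu> :: "(real^'n::finite) measure" and c :: "'n \<Rightarrow> real"
  assumes \<mu>: "finite_off_zero \<mu>"
    and hom: "\<And>t B. 0 < t \<Longrightarrow> B \<in> sets \<mu> \<Longrightarrow> ennreal t * emeasure \<mu> {y \<in> EE. y /\<^sub>R t \<in> B} = emeasure \<mu> B"
    and pos: "0 < emeasure \<mu> (EE_sub J)" and "J \<noteq> {}"
    and c_pos: "\<And>j. j \<in> J \<Longrightarrow> 0 < c j" and c_0: "\<And>j. j \<notin> J \<Longrightarrow> c j = 0"
    and c: "\<And>j s. 0 < s \<Longrightarrow> emeasure \<mu> (EE_sub J \<inter> {x. s < x $ j}) = ennreal (c j / s)"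
  shows "\<exists>L. prob_space L \<and> sets L = sets borel \<and> mev L \<and> unit_frechet_margins L \<and>
    {J'. extreme_direction L J'} = {UNIV} \<and>
    (\<forall>x. (\<forall>j. 0 < x $ j) \<longrightarrow> measure L {z. \<forall>j. c j * z $ j \<le> x $ j} = exp (- measure \<mu> (EE_sub J - {..x})))"
proof -
  obtain j0 where j0: "j0 \<in> J" using \<open>J \<noteq> {}\<close> by blast
  text \<open>Coordinates outside \<open>J\<close> are irrelevant for the mixture but must not vanish.\<close>
  define \<sigma> where "\<sigma> j = (if j \<in> J then j else j0)" for j
  have \<sigma>: "\<sigma> j \<in> J" for j using j0 by (simp add: \<sigma>_def)
  have c\<sigma>: "0 < c (\<sigma> j)" for j using \<sigma> c_pos by blast
  define T where "T x = (\<chi> j. x $ \<sigma> j / c (\<sigma> j))" for x :: "real^'n"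
  have T: "T x \<in> EE_sub UNIV" if "x \<in> EE_sub J" for x
  proof -
    have "0 < T x $ j" for j using that \<sigma>[of j] c\<sigma>[of j] by (simp add: T_def EE_sub_def)
    then show ?thesis unfolding EE_sub_def EE_def
      by (auto intro: less_imp_le)
  qed
  have T_EE: "T x \<in> EE" if "x \<in> EE_sub J" for x using T[OF that] EE_sub_subset by blast
  let ?M = "restrict_space \<mu> (EE_sub J)" and ?N = "restrict_space borel (EE :: (real^'n) set)"
  define \<nu> where "\<nu> = distr ?M ?N T"
  have sp: "space \<mu> = EE" by (rule space_finite_off_zero[OF \<mu>])
  have spM: "space ?M = EE_sub J" using EE_sub_subset[of J] by (auto simp: space_restrict_space sp)
  have J_sets: "EE_sub J \<in> sets \<mu>" using EE_sub_subset by (auto simp: in_sets_finite_off_zero[OF \<mu>])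
  have T_borel: "T \<in> borel_measurable borel" unfolding T_def by measurable
  have Tm: "T \<in> measurable ?M ?N"
  proof (rule measurable_restrict_space2)
    show "T \<in> space ?M \<rightarrow> EE" using T_EE by (auto simp: spM)
    have "T \<in> borel_measurable ?N" by (intro measurable_restrict_space1 T_borel)
    then have "T \<in> borel_measurable \<mu>"
      using \<mu> by (simp add: finite_off_zero_def cong: measurable_cong_sets)
    then show "T \<in> borel_measurable ?M" by (rule measurable_restrict_space1)
  qed
  have pre: "{x \<in> EE_sub J. T x \<in> B} \<in> sets \<mu>" if "B \<in> sets borel" for B
  proof -
    have "{x \<in> EE_sub J. T x \<in> B} = EE_sub J \<inter> T -` B" by auto
    also have "\<dots> \<in> sets borel" using that T_borel by (intro sets.Int EE_sub_borel measurable_sets_borel)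
    finally show ?thesis using EE_sub_subset by (auto simp: in_sets_finite_off_zero[OF \<mu>])
  qed
  have \<nu>_eq: "emeasure \<nu> B = emeasure \<mu> {x \<in> EE_sub J. T x \<in> B}" if "B \<in> sets ?N" for B
  proof -
    have "emeasure \<nu> B = emeasure ?M (T -` B \<inter> space ?M)"
      unfolding \<nu>_def using that Tm by (intro emeasure_distr)
    also have "T -` B \<inter> space ?M = {x \<in> EE_sub J. T x \<in> B}" by (auto simp: spM)
    also have "emeasure ?M {x \<in> EE_sub J. T x \<in> B} = emeasure \<mu> {x \<in> EE_sub J. T x \<in> B}"
      by (intro emeasure_restrict_space sets.Int[OF J_sets sets.top]) auto
    finally show ?thesis .
  qed
  have in_N: "EE - B \<in> sets ?N" if "B \<in> sets borel" for B
    using that by (auto simp: sets_restrict_space_iff)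
  have \<nu>_compl: "emeasure \<nu> (EE - B) = emeasure \<mu> {x \<in> EE_sub J. T x \<notin> B}" if "B \<in> sets borel" for B
  proof -
    have "{x \<in> EE_sub J. T x \<in> EE - B} = {x \<in> EE_sub J. T x \<notin> B}" using T_EE by blast
    then show ?thesis using \<nu>_eq[OF in_N[OF that]] by simp
  qed
  have fin: "emeasure \<nu> (EE - {..z}) < \<infinity>" if z: "\<forall>j. 0 < z $ j" for z
  proof -
    define m where "m = Min (range (\<lambda>j. z $ j))"
    have m: "0 < m" "m \<le> z $ j" for j using z by (auto simp: m_def Min_gr_iff)
    \<comment> \<open>A point \<open>x \<le> w\<close> has all coordinates of \<open>T x\<close> at
      most m, the least entry of \<open>z\<close>; outside \<open>J\<close> the entries of
      \<open>w\<close> only have to be positive.\<close>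
    define w where "w = (\<chi> i. if i \<in> J then c i * m else 1)"
    have w: "\<forall>j. 0 < w $ j" using m(1) c_pos by (simp add: w_def)
    have "x \<in> EE - {..w}" if x: "x \<in> EE_sub J" "T x \<notin> {..z}" for x
    proof -
      have "\<not> x \<le> w"
      proof
        assume "x \<le> w"
        have "T x $ j \<le> z $ j" for j
        proof -
          have "x $ \<sigma> j \<le> c (\<sigma> j) * m" using \<open>x \<le> w\<close> \<sigma>[of j] by (auto simp: less_eq_vec_def w_def dest!: spec[of _ "\<sigma> j"])
          then have "T x $ j \<le> m" using c\<sigma>[of j] by (simp add: T_def divide_le_eq mult.commute)
          then show ?thesis using m(2)[of j] by linarith
        qed
        then show False using x(2) by (simp add: less_eq_vec_def)
      qed
      then show ?thesis using x(1) EE_sub_subset by auto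
    qed
    then have "emeasure \<nu> (EE - {..z}) \<le> emeasure \<mu> (EE - {..w})"
      by (subst \<nu>_compl) (auto intro!: emeasure_mono simp: in_sets_finite_off_zero[OF \<mu>])
    also have "\<dots> < \<infinity>" using \<mu> w by (simp add: finite_off_zero_def)
    finally show ?thesis .
  qed
  have \<nu>: "finite_off_zero \<nu>" using fin by (auto simp: finite_off_zero_def \<nu>_def)
  have marg: "emeasure \<nu> (EE - lower_set {(j, s)}) = ennreal (1 / s)" if s: "0 < s" for j s
  proof -
    have "{x \<in> EE_sub J. T x \<notin> lower_set {(j, s)}} = EE_sub J \<inter> {x. s * c (\<sigma> j) < x $ \<sigma> j}"
      using c\<sigma>[of j] by (auto simp: lower_set_def T_def divide_le_eq not_le)
    then show ?thesis
      using c[of "s * c (\<sigma> j)" "\<sigma> j"] s c\<sigma>[of j] by (subst \<nu>_compl) (auto intro: lower_set_borel)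
  qed
  obtain L where L: "prob_space L" "sets L = sets borel"
    and Lx: "\<And>x. (\<forall>j. 0 < x $ j) \<Longrightarrow> measure L {..x} = exp (- measure \<nu> (EE - {..x}))"
    using exists_law[OF \<nu>] by blast
  have fr: "unit_frechet_margins L" by (rule unit_frechet_marginsI[OF \<nu> L Lx marg])
  have ex: "is_exponent_measure L \<nu>" by (rule is_exponent_measureI[OF \<nu> L Lx marg])
  have "mcdf L (t *\<^sub>R x) powr t = mcdf L x" if t: "0 < t" and x: "\<forall>j. 0 < x $ j" for t x
  proof -
    have tx: "\<forall>j. 0 < (t *\<^sub>R x) $ j" using t x by simp
    have "{y \<in> EE. y /\<^sub>R t \<in> {x' \<in> EE_sub J. T x' \<notin> {..x}}} = {y \<in> EE_sub J. T y \<notin> {..t *\<^sub>R x}}"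
    proof -
      have "T (y /\<^sub>R t) \<le> x \<longleftrightarrow> T y \<le> t *\<^sub>R x" for y
        using t c\<sigma> by (simp add: T_def less_eq_vec_def field_simps)
      then show ?thesis using EE_sub_subset by (auto simp: EE_sub_divideR[OF t])
    qed
    moreover have "{x' \<in> EE_sub J. T x' \<notin> {..x}} \<in> sets \<mu>" using pre[of "- {..x}"] by simp
    ultimately have scale: "ennreal t * emeasure \<nu> (EE - {..t *\<^sub>R x}) = emeasure \<nu> (EE - {..x})"
      using hom[OF t, of "{x' \<in> EE_sub J. T x' \<notin> {..x}}"] by (simp add: \<nu>_compl)
    have "t * measure \<nu> (EE - {..t *\<^sub>R x}) = enn2real (ennreal t * emeasure \<nu> (EE - {..t *\<^sub>R x}))"
      using t by (simp add: measure_def enn2real_mult)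
    then have "t * measure \<nu> (EE - {..t *\<^sub>R x}) = measure \<nu> (EE - {..x})"
      by (simp only: scale measure_def)
    then show ?thesis unfolding mcdf_def Lx[OF x] Lx[OF tx] by (simp add: exp_powr_real mult.commute)
  qed
  then have sms: "simple_max_stable L" using L fr by (simp add: simple_max_stable_def)
  have dir: "extreme_direction L J' \<longleftrightarrow> J' = UNIV" for J'
  proof -
    have "emeasure \<nu> (EE_sub J') = emeasure \<mu> {x \<in> EE_sub J. T x \<in> EE_sub J'}"
      by (intro \<nu>_eq) (use EE_sub_subset in \<open>auto simp: sets_restrict_space_iff\<close>)
    also have "{x \<in> EE_sub J. T x \<in> EE_sub J'} = (if J' = UNIV then EE_sub J else {})"
      using T EE_sub_disjoint[of J' UNIV] by auto
    finally have "0 < emeasure \<nu> (EE_sub J') \<longleftrightarrow> J' = UNIV" using pos by auto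
    moreover have "\<nu>' = \<nu>" if "is_exponent_measure L \<nu>'" for \<nu>'
      by (rule is_exponent_measure_unique[OF that ex]) (simp add: Lx)
    ultimately show ?thesis using ex unfolding extreme_direction_def by blast
  qed
  have "measure L {z. \<forall>j. c j * z $ j \<le> x $ j} = exp (- measure \<mu> (EE_sub J - {..x}))" if x: "\<forall>j. 0 < x $ j" for x
  proof -
    define H where "H = (\<lambda>j. (j, x $ j / c j)) ` J"
    have H: "constraints H" using x c_pos by (auto simp: H_def constraints_def)
    then have "finite H" by (simp add: constraints_def)
    have iff: "c j * r \<le> x $ j \<longleftrightarrow> (j \<in> J \<longrightarrow> r \<le> x $ j / c j)" for j r
      using c_pos[of j] c_0[of j] x[rule_format, of j] by (cases "j \<in> J") (simp_all add: le_divide_eq mult.commute)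
    have "{z. \<forall>j. c j * z $ j \<le> x $ j} = lower_set H"
      unfolding iff by (auto simp: H_def lower_set_def)
    moreover have "emeasure \<nu> (EE - lower_set H) = emeasure \<mu> (EE_sub J - {..x})"
    proof -
      have "T y \<notin> lower_set H \<longleftrightarrow> y \<notin> {..x}" if y: "y \<in> EE_sub J" for y
      proof -
        have "T y \<in> lower_set H \<longleftrightarrow> (\<forall>j\<in>J. y $ j \<le> x $ j)"
          using c_pos by (auto simp: H_def lower_set_def T_def \<sigma>_def divide_le_cancel dest: less_imp_le order_less_asym)
        moreover have "y $ j \<le> x $ j" if "j \<notin> J" for j
        proof -
          have "\<not> 0 < y $ j" using that y by (simp add: EE_sub_def)
          then show ?thesis using x by (meson less_imp_le not_le order_trans)
        qed
        ultimately show ?thesis by (auto simp: less_eq_vec_def)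
      qed
      then have "{y \<in> EE_sub J. T y \<notin> lower_set H} = EE_sub J - {..x}" by auto
      then show ?thesis using \<nu>_compl[OF lower_set_borel[OF \<open>finite H\<close>]] by simp
    qed
    ultimately show ?thesis using measure_lower_set_eq[OF \<nu> L Lx H] by (simp add: measure_def)
  qed
  then show ?thesis using L fr dir simple_max_stable_imp_mev[OF sms] by (intro exI[of _ L]) auto
qed

context max_stable_law begin

text \<open>The coefficient of face \<open>J\<close> at \<open>j\<close> is the mass it gives to
  \<open>1 < x $ j\<close>. Over all charged faces these masses add up to \<mu>-mass 1, which yields
  unit row sums, and positivity exactly on \<open>J\<close> makes \<open>J\<close> the signature.
  Measurability of the mixture is recorded because a transformed law is taken later.\<close>

lemma exists_mixture:
  "\<exists>(r :: nat) (A :: 'n \<Rightarrow> nat \<Rightarrow> real) (P :: (nat \<Rightarrow> real^'n) measure) (Z :: nat \<Rightarrow> (nat \<Rightarrow> real^'n) \<Rightarrow> real^'n).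
     mixture_model P r A Z \<and> different_signatures r A \<and>
     mixture r A Z \<in> borel_measurable P \<and> distr P borel (mixture r A Z) = G"
proof -
  obtain \<mu> where \<mu>: "finite_off_zero \<mu>"
    and v: "\<And>H. constraints H \<Longrightarrow> H \<noteq> {} \<Longrightarrow> emeasure \<mu> (EE - lower_set H) = ennreal (- ln (prob (lower_set H)))"
    using exists_exponent_measure by blast
  have hom: "ennreal t * emeasure \<mu> {y \<in> EE. y /\<^sub>R t \<in> B} = emeasure \<mu> B" if "0 < t" "B \<in> sets \<mu>" for t B
    by (rule exponent_measure_homogeneous[OF \<mu> v that])
  have S: "EE_sub J \<inter> B \<in> sets \<mu>" if "B \<in> sets borel" for J B
    using that EE_sub_subset by (auto simp: in_sets_finite_off_zero[OF \<mu>])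
  define c where "c J j = measure \<mu> (EE_sub J \<inter> {x. 1 < x $ j})" for J j
  have coord: "emeasure \<mu> (EE \<inter> {x. s < x $ j}) = ennreal (1 / s)" if "0 < s" for j s
  proof -
    have "EE \<inter> {x. s < x $ j} = EE - lower_set {(j, s)}" by (auto simp: lower_set_def not_le)
    then show ?thesis using v[of "{(j, s)}"] that by (simp add: lower_set_def prob_coordinate)
  qed
  have c1: "emeasure \<mu> (EE_sub J \<inter> {x. 1 < x $ j}) = ennreal (c J j)" for J j
  proof -
    have "emeasure \<mu> (EE_sub J \<inter> {x. 1 < x $ j}) \<le> emeasure \<mu> (EE \<inter> {x. 1 < x $ j})"
      using EE_sub_subset by (intro emeasure_mono) (auto simp: in_sets_finite_off_zero[OF \<mu>])
    also have "\<dots> < \<infinity>" using coord[of 1 j] by simp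
    finally show ?thesis by (simp add: c_def emeasure_eq_ennreal_measure)
  qed
  \<comment> \<open>Faces are cones, so homogeneity determines the whole margin of a face from its
    mass above 1.\<close>
  have c: "emeasure \<mu> (EE_sub J \<inter> {x. s < x $ j}) = ennreal (c J j / s)" if s: "0 < s" for J j s
  proof -
    have "{y \<in> EE. y /\<^sub>R s \<in> EE_sub J \<inter> {x. 1 < x $ j}} = EE_sub J \<inter> {x. s < x $ j}"
      using EE_sub_subset s by (auto simp: EE_sub_divideR[OF s]) (auto simp: field_simps)
    then have "ennreal s * emeasure \<mu> (EE_sub J \<inter> {x. s < x $ j}) = ennreal (c J j)"
      using hom[OF s, of "EE_sub J \<inter> {x. 1 < x $ j}"] S[of "{x. 1 < x $ j}" J] by (simp add: c1)
    then have "ennreal (1 / s) * (ennreal s * emeasure \<mu> (EE_sub J \<inter> {x. s < x $ j})) = ennreal (1 / s) * ennreal (c J j)"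
      by simp
    then show ?thesis using s by (simp add: mult.assoc[symmetric] ennreal_mult'[symmetric])
  qed
  define Ks where "Ks = {J. 0 < emeasure \<mu> (EE_sub J)}"
  have finK: "finite Ks" by simp
  have K_ne: "J \<noteq> {}" if "J \<in> Ks" for J
  proof
    assume "J = {}"
    then have "EE_sub J = ({} :: (real^'n) set)"
      by (auto simp: EE_sub_def EE_def vec_eq_iff intro: antisym simp: not_less)
    then show False using that by (simp add: Ks_def)
  qed
  \<comment> \<open>Were the mass above 1 zero, homogeneity would make the mass above every 1 / (n +
    1) zero, and these sets exhaust the face because its \<open>j\<close>-th coordinate is
    positive.\<close>
  have c_pos: "0 < c J j" if J: "J \<in> Ks" and j: "j \<in> J" for J j
  proof (rule ccontr)
    assume "\<not> 0 < c J j"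
    then have c0: "c J j = 0" by (simp add: c_def not_less measure_le_0_iff)
    have "EE_sub J = (\<Union>n. EE_sub J \<inter> {x. inverse (real (Suc n)) < x $ j})"
    proof -
      have "\<exists>n. inverse (real (Suc n)) < x $ j" if "x \<in> EE_sub J" for x
        using that j by (intro reals_Archimedean) (simp add: EE_sub_def)
      then show ?thesis by blast
    qed
    also have "emeasure \<mu> \<dots> = 0"
      using S c0 by (intro emeasure_UN_eq_0) (auto simp: c)
    finally show False using J by (simp add: Ks_def)
  qed
  have c_0: "c J j = 0" if "j \<notin> J" for J j
  proof -
    have "EE_sub J \<inter> {x. 1 < x $ j} = ({} :: (real^'n) set)"
    proof -
      have "\<not> 1 < x $ j" if "x \<in> EE_sub J" for x :: "real^'n"
        using \<open>j \<notin> J\<close> that by (force simp: EE_sub_def)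
      then show ?thesis by blast
    qed
    then show ?thesis by (simp add: c_def)
  qed
  \<comment> \<open>Uncharged faces are null, and finiteness of the total permits adding real-valued
    masses.\<close>
  have split: "(\<Sum>J\<in>Ks. measure \<mu> (EE_sub J \<inter> B)) = measure \<mu> (EE \<inter> B)"
    if B: "B \<in> sets borel" and fin: "emeasure \<mu> (EE \<inter> B) < \<infinity>" for B
  proof -
    have "(\<Sum>J\<in>Ks. measure \<mu> (EE_sub J \<inter> B)) = (\<Sum>J\<in>UNIV. measure \<mu> (EE_sub J \<inter> B))"
    proof (rule sum.mono_neutral_left)
      show "\<forall>J\<in>UNIV - Ks. measure \<mu> (EE_sub J \<inter> B) = 0"
      proof
        fix J assume "J \<in> UNIV - Ks"
        then have "emeasure \<mu> (EE_sub J) = 0" by (simp add: Ks_def)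
        moreover have "EE_sub J \<in> sets \<mu>" using S[of UNIV J] by simp
        ultimately have "emeasure \<mu> (EE_sub J \<inter> B) = 0" by (intro emeasure_eq_0[OF _ _ Int_lower1])
        then show "measure \<mu> (EE_sub J \<inter> B) = 0" by (simp add: measure_def)
      qed
    qed auto
    also have "\<dots> = measure \<mu> (\<Union>J. EE_sub J \<inter> B)"
    proof (rule measure_finite_Union[symmetric])
      show "range (\<lambda>J. EE_sub J \<inter> B) \<subseteq> sets \<mu>" using S[OF B] by auto
      show "disjoint_family (\<lambda>J. EE_sub J \<inter> B)"
        unfolding disjoint_family_on_def using EE_sub_disjoint by blast
      show "emeasure \<mu> (EE_sub J \<inter> B) \<noteq> \<infinity>" for J
      proof -
        have "emeasure \<mu> (EE_sub J \<inter> B) \<le> emeasure \<mu> (EE \<inter> B)"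
          using EE_sub_subset B by (intro emeasure_mono) (auto simp: in_sets_finite_off_zero[OF \<mu>])
        then show ?thesis using fin by (auto simp: top_unique)
      qed
    qed simp
    also have "(\<Union>J. EE_sub J \<inter> B) = EE \<inter> B" by (simp add: EE_eq_UN_EE_sub)
    finally show ?thesis .
  qed
  have c_sum: "(\<Sum>J\<in>Ks. c J j) = 1" for j
    unfolding c_def using coord[of 1 j] by (subst split) (simp_all add: measure_def)
  define Q where "Q J L \<longleftrightarrow> prob_space L \<and> sets L = sets borel \<and> mev L \<and> unit_frechet_margins L \<and>
    {J'. extreme_direction L J'} = {UNIV} \<and>
    (\<forall>x. (\<forall>j. 0 < x $ j) \<longrightarrow> measure L {z. \<forall>j. c J j * z $ j \<le> x $ j} = exp (- measure \<mu> (EE_sub J - {..x})))"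
    for J L
  have "\<forall>J\<in>Ks. \<exists>L. Q J L"
  proof
    fix J assume J: "J \<in> Ks"
    then show "\<exists>L. Q J L" unfolding Q_def
      by (intro direction_law[OF \<mu> hom] K_ne c_pos c_0 c) (simp_all add: Ks_def)
  qed
  then obtain LL where "\<forall>J\<in>Ks. Q J (LL J)" by (rule bchoice[THEN exE])
  then have LL: "\<And>J. J \<in> Ks \<Longrightarrow> prob_space (LL J)" "\<And>J. J \<in> Ks \<Longrightarrow> sets (LL J) = sets borel"
    "\<And>J. J \<in> Ks \<Longrightarrow> mev (LL J)" "\<And>J. J \<in> Ks \<Longrightarrow> unit_frechet_margins (LL J)"
    "\<And>J. J \<in> Ks \<Longrightarrow> {J'. extreme_direction (LL J) J'} = {UNIV}"
    "\<And>J x. J \<in> Ks \<Longrightarrow> (\<forall>j. 0 < x $ j) \<Longrightarrow> measure (LL J) {z. \<forall>j. c J j * z $ j \<le> x $ j} = exp (- measure \<mu> (EE_sub J - {..x}))"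
    unfolding Q_def by simp_all
  obtain f where f: "bij_betw f {1..card Ks} Ks" using ex_bij_betw_nat_finite_1[OF finK] by blast
  define r where "r = card Ks"
  have "Ks \<noteq> {}" using c_sum by (metis sum.empty zero_neq_one)
  then have r: "0 < r" using finK by (simp add: r_def card_gt_0_iff)
  have fK: "f k \<in> Ks" if "k \<in> {1..r}" for k using f that by (auto simp: r_def bij_betw_def)
  define A where "A j k = c (f k) j" for j k
  \<comment> \<open>The product runs over all naturals; indices outside \<open>{1..r}\<close> are
    filled with \<open>G\<close> merely to have a probability measure there.\<close>
  define Lk where "Lk k = (if k \<in> {1..r} then LL (f k) else G)" for k
  have Lk: "prob_space (Lk k)" "sets (Lk k) = sets borel" for k
    using LL(1,2) fK prob_space_axioms sets_G by (auto simp: Lk_def)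
  define P where "P = PiM UNIV Lk"
  interpret P: prob_space P unfolding P_def by (rule prob_space_PiM) (rule Lk)
  define Z where "Z = (\<lambda>(k::nat) (\<omega>::nat \<Rightarrow> real^'n). \<omega> k)"
  have Zm [measurable]: "Z k \<in> borel_measurable P" for k
    unfolding P_def Z_def by (rule measurable_PiM_coordinate) (simp_all add: Lk)
  have Zd: "distr P borel (Z k) = Lk k" for k
    unfolding P_def Z_def by (rule distr_PiM_coordinate) (auto simp: Lk)
  have sum_f: "(\<Sum>k\<in>{1..r}. g (f k)) = (\<Sum>J\<in>Ks. g J)" for g :: "'n set \<Rightarrow> real"
    unfolding r_def by (rule sum.reindex_bij_betw[OF f])
  have A_nonneg: "0 \<le> A j k" for j k by (simp add: A_def c_def)
  have A_sum: "(\<Sum>k\<in>{1..r}. A j k) = 1" for j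
    using sum_f[of "\<lambda>J. c J j"] c_sum[of j] by (simp add: A_def)
  have coef: "coefficient_matrix r A"
    unfolding coefficient_matrix_def
  proof (intro conjI allI ballI)
    fix j k assume k: "k \<in> {1..r}"
    show "0 \<le> A j k" by (rule A_nonneg)
    show "A j k \<le> 1" unfolding A_sum[of j, symmetric] using k A_nonneg by (intro member_le_sum) auto
  next
    fix k assume k: "k \<in> {1..r}"
    obtain j where j: "j \<in> f k" using K_ne[OF fK[OF k]] by blast
    show "0 < (\<Sum>j\<in>UNIV. A j k)"
      by (rule sum_pos2[where i=j]) (use A_nonneg c_pos[OF fK[OF k] j] in \<open>auto simp: A_def\<close>)
  qed (rule A_sum)
  have sig: "signature A k = f k" if "k \<in> {1..r}" for k
  proof -
    have "0 < A j k \<longleftrightarrow> j \<in> f k" for j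
      using c_pos[OF fK[OF that], of j] c_0[of j "f k"] by (cases "j \<in> f k") (simp_all add: A_def)
    then show ?thesis by (simp add: signature_def)
  qed
  have diff: "different_signatures r A"
    unfolding different_signatures_def using f sig inj_on_cong[of "{1..r}" "signature A" f]
    by (auto simp: r_def bij_betw_def)
  have model: "mixture_model P r A Z"
    unfolding mixture_model_def
  proof (intro conjI ballI)
    show "P.indep_vars (\<lambda>_. borel) Z {1..r}"
      unfolding P_def Z_def by (rule indep_vars_PiM_coordinates) (use Lk r in auto)
    fix k assume k: "k \<in> {1..r}"
    then have "distr P borel (Z k) = LL (f k)" by (simp add: Zd Lk_def)
    then show "mev (distr P borel (Z k))" "unit_frechet_margins (distr P borel (Z k))"
      "{J. extreme_direction (distr P borel (Z k)) J} = {UNIV}"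
      using LL(3-5)[OF fK[OF k]] by simp_all
  qed (use r coef P.prob_space_axioms in auto)
  have Mm [measurable]: "mixture r A Z \<in> borel_measurable P"
    unfolding mixture_def by measurable
  let ?D = "distr P borel (mixture r A Z)"
  have D: "prob_space ?D" by (intro P.prob_space_distr Mm)
  have mcdf_pos: "mcdf ?D x = mcdf G x" if x: "\<forall>j. 0 < x $ j" for x
  proof -
    have "mixture r A Z \<omega> \<le> x \<longleftrightarrow> (\<forall>k\<in>{1..r}. \<omega> k \<in> {z. \<forall>j. A j k * z $ j \<le> x $ j})" for \<omega>
      using r by (auto simp: mixture_def less_eq_vec_def Z_def Max_le_iff)
    then have "mcdf ?D x = measure P {\<omega> \<in> space P. \<forall>k\<in>{1..r}. \<omega> k \<in> {z. \<forall>j. A j k * z $ j \<le> x $ j}}"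
      unfolding mcdf_def by (subst measure_distr) (auto intro!: arg_cong[where f="measure P"])
    also have "\<dots> = (\<Prod>k\<in>{1..r}. measure (Lk k) {z. \<forall>j. A j k * z $ j \<le> x $ j})"
      unfolding P_def
    proof (rule measure_PiM_Collect)
      show "{z. \<forall>j. A j k * z $ j \<le> x $ j} \<in> sets (Lk k)" for k
      proof -
        have "{z :: real^'n. \<forall>j. A j k * z $ j \<le> x $ j} = (\<Inter>j. {z. A j k * z $ j \<le> x $ j})" by auto
        also have "\<dots> \<in> sets borel" by (intro sets.countable_INT) auto
        finally show ?thesis by (simp add: Lk)
      qed
    qed (auto simp: Lk)
    also have "\<dots> = (\<Prod>k\<in>{1..r}. exp (- measure \<mu> (EE_sub (f k) - {..x})))"
      by (intro prod.cong refl) (simp add: Lk_def A_def LL(6)[OF fK x])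
    also have "\<dots> = exp (- (\<Sum>k\<in>{1..r}. measure \<mu> (EE_sub (f k) - {..x})))"
      by (simp add: exp_sum[symmetric] sum_negf)
    also have "(\<Sum>k\<in>{1..r}. measure \<mu> (EE_sub (f k) - {..x})) = (\<Sum>J\<in>Ks. measure \<mu> (EE_sub J - {..x}))"
      by (rule sum_f)
    also have "\<dots> = measure \<mu> (EE - {..x})"
      using split[of "- {..x}"] \<mu> x by (simp add: Diff_eq finite_off_zero_def)
    also have "\<dots> = - ln (prob {..x})"
      using v[OF constraints_range[OF x]] prob_le_1[of "{..x}"] prob_lower_pos[OF constraints_range[OF x]]
      by (simp add: atMost_eq_lower_set[of x] measure_def)
    also have "exp (- (- ln (prob {..x}))) = prob {..x}"
      using prob_lower_pos[OF constraints_range[OF x]] by (simp add: atMost_eq_lower_set[of x])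
    finally show ?thesis by (simp add: mcdf_def)
  qed
  have "mcdf ?D x = mcdf G x" for x
  proof (cases "\<forall>j. 0 < x $ j")
    case False
    then obtain j where j: "x $ j \<le> 0" by (auto simp: not_less)
    have "mcdf ?D x \<le> exp (- real (Suc n))" for n
    proof -
      \<comment> \<open>Any positive point above \<open>x\<close> with a small \<open>j\<close>-th
        entry will do: the formula holds at \<open>y\<close>, and the \<open>j\<close>-th margin
        bounds it by exp (- (n + 1)).\<close>
      define y where "y = (\<chi> i. if i = j then inverse (real (Suc n)) else max 1 (x $ i))"
      have y: "\<forall>i. 0 < y $ i" by (simp add: y_def less_max_iff_disj)
      have "x \<le> y" using j by (auto simp: less_eq_vec_def y_def intro: order_trans[of _ 0])
      then have "mcdf ?D x \<le> mcdf ?D y" by (intro mcdf_mono[OF D]) simp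
      also have "\<dots> = mcdf G y" by (rule mcdf_pos[OF y])
      also have "\<dots> \<le> prob {z. z $ j \<le> inverse (real (Suc n))}"
        unfolding mcdf_def
        by (intro finite_measure_mono) (auto simp: sets_G less_eq_vec_def y_def dest!: spec[of _ j])
      also have "\<dots> = exp (- real (Suc n))" by (subst prob_coordinate) (simp_all add: field_simps)
      finally show ?thesis .
    qed
    then have "mcdf ?D x \<le> 0" by (intro LIMSEQ_le_const[OF exp_uminus_Suc_tendsto_0]) auto
    moreover have "mcdf G x = 0"
      using mcdf_frechet_nonpos[OF prob_space_axioms sets_G frechet_margins j] .
    ultimately show ?thesis by (simp add: mcdf_def measure_le_0_iff)
  qed (rule mcdf_pos)
  then have "?D = G"
    by (intro prob_eqI_mcdf[OF D prob_space_axioms _ sets_G]) auto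
  then show ?thesis using model diff Mm by blast
qed

end

section \<open>Transfer to generalized Pareto distributions and conclusion\<close>

lemma simple_max_stable_mixture:
  fixes G :: "(real^'n::finite) measure"
  assumes "simple_max_stable G"
  shows "\<exists>(r :: nat) (A :: 'n \<Rightarrow> nat \<Rightarrow> real) (P :: (nat \<Rightarrow> real^'n) measure) (Z :: nat \<Rightarrow> (nat \<Rightarrow> real^'n) \<Rightarrow> real^'n).
     mixture_model P r A Z \<and> different_signatures r A \<and>
     mixture r A Z \<in> borel_measurable P \<and> distr P borel (mixture r A Z) = G"
proof -
  interpret prob_space G using assms by (simp add: simple_max_stable_def)
  interpret max_stable_law G by unfold_locales (rule assms)
  show ?thesis by (rule exists_mixture)
qed

text \<open>Nothing has to be computed with \<open>H\<close>. The mixture has exactly the law of the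
  exponential of \<open>G\<close>, so its logarithm has law \<open>G\<close> as a measure, and
  association with the mixture becomes the hypothesis \<open>is_GP G H\<close> itself.\<close>

lemma mgp_mixture:
  fixes G :: "(real^'n::finite) measure"
  assumes GP: "is_GP G H"
  shows "\<exists>(r :: nat) (A :: 'n \<Rightarrow> nat \<Rightarrow> real) (P :: (nat \<Rightarrow> real^'n) measure) (Z :: nat \<Rightarrow> (nat \<Rightarrow> real^'n) \<Rightarrow> real^'n).
     mixture_model P r A Z \<and> different_signatures r A \<and> mgp_associated P r A Z H"
proof -
  have mev: "mev G" and gu: "gumbel_margins G" using GP by (auto simp: is_GP_def)
  have sG [measurable_cong]: "sets G = sets borel" using mev by (simp add: mev_def)
  obtain r and A :: "'n \<Rightarrow> nat \<Rightarrow> real" and P :: "(nat \<Rightarrow> real^'n) measure" and Z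
    where M: "mixture_model P r A Z" "different_signatures r A" and [measurable]: "mixture r A Z \<in> borel_measurable P"
    and d: "distr P borel (mixture r A Z) = distr G borel (\<lambda>x. \<chi> j. exp (x $ j))"
    using simple_max_stable_mixture[OF mev_gumbel_exp_simple_max_stable[OF mev gu]] by blast
  have "distr P borel (\<lambda>\<omega>. \<chi> j. ln (mixture r A Z \<omega> $ j)) =
      distr (distr P borel (mixture r A Z)) borel (\<lambda>y. \<chi> j. ln (y $ j))"
    by (subst distr_distr) (auto simp: comp_def)
  also have "\<dots> = distr G borel (\<lambda>x. x)"
    unfolding d by (subst distr_distr) (auto simp: comp_def vec_lambda_eta)
  also have "\<dots> = G" by (rule distr_id2) (simp add: sG)
  finally show ?thesis using M GP unfolding mgp_associated_def by metis
qed

theorem theorem4p8: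
  "(\<forall>G :: (real^'n::finite) measure.
      mev G \<and> unit_frechet_margins G \<longrightarrow>
      (\<exists>(r :: nat) (A :: 'n \<Rightarrow> nat \<Rightarrow> real) (P :: (nat \<Rightarrow> real^'n) measure)
         (Z :: nat \<Rightarrow> (nat \<Rightarrow> real^'n) \<Rightarrow> real^'n).
         mixture_model P r A Z \<and> different_signatures r A \<and>
         mcdf (distr P borel (mixture r A Z)) = mcdf G)) \<and>
   (\<forall>H :: (ereal^'n) measure.
      mgp H \<longrightarrow>
      (\<exists>(r :: nat) (A :: 'n \<Rightarrow> nat \<Rightarrow> real) (P :: (nat \<Rightarrow> real^'n) measure)
         (Z :: nat \<Rightarrow> (nat \<Rightarrow> real^'n) \<Rightarrow> real^'n).
         mixture_model P r A Z \<and> different_signatures r A \<and>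
         mgp_associated P r A Z H))"
proof (intro conjI allI impI)
  fix G :: "(real^'n) measure" assume "mev G \<and> unit_frechet_margins G"
  then have "simple_max_stable G" by (blast intro: mev_imp_simple_max_stable)
  from simple_max_stable_mixture[OF this]
  show "\<exists>r (A :: 'n \<Rightarrow> nat \<Rightarrow> real) (P :: (nat \<Rightarrow> real^'n) measure) Z.
    mixture_model P r A Z \<and> different_signatures r A \<and> mcdf (distr P borel (mixture r A Z)) = mcdf G"
    by metis
next
  fix H :: "(ereal^'n) measure" assume "mgp H"
  then obtain G :: "(real^'n) measure" where "is_GP G H" by (auto simp: mgp_def)
  then show "\<exists>r (A :: 'n \<Rightarrow> nat \<Rightarrow> real) (P :: (nat \<Rightarrow> real^'n) measure) Z.
    mixture_model P r A Z \<and> different_signatures r A \<and> mgp_associated P r A Z H"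
    by (rule mgp_mixture)
qed

end
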